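(* If $\lambda\in\mathbb{C}$ is not an eigenvalue of $L_{\mathrm{per}}$, then the resolvent $(L_{\mathrm{per}}-\lambda)^{-1}$ is a compact operator on $L^2(-\pi,\pi)$.
   Context: Let $0<\epsilon<\pi$ and let $f:\mathbb{R}\to\mathbb{R}$ be a $2\pi$-periodic function such that $f(x+\pi)=-f(x)$ and $f(-x)=-f(x)$ for all $x$, and $f(x)>0$ for $x\in(0,\pi)$ (in particular $f$ vanishes on $\pi\mathbb{Z}$). Assume that $f$ is continuous, and differentiable except possibly at a finite number of points (in a period), the points of non-differentiability excluding $\pi\mathbb{Z}$, and that $f'(0)=2/\pi$. The operator $L_{\mathrm{per}}$ is defined by $$L_{\mathrm{per}}u := i\epsilon\,(f(x)u'(x))' + i u'(x)$$ on the domain $$\mathcal{D}=\{u\in L^2(-\pi,\pi) : L_{\mathrm{per}}u\in L^2(-\pi,\pi),\ u(-\pi)=u(\pi)\}.$$ Here derivatives are taken in the weak sense on $(-\pi,\pi)$. It is known that if $u\in L^2(-\pi,\pi)$ and $L_{\mathrm{per}}u\in L^2(-\pi,\pi)$ then $u\in H^1(-\pi,\pi)$, so the boundary values $u(\pm\pi)$ make sense. The assertion that the resolvent is an operator on $L^2(-\pi,\pi)$ includes that $L_{\mathrm{per}}-\lambda:\mathcal{D}\to L^2(-\pi,\pi)$ is bijective. *)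

theory Defs
  imports "HOL-Analysis.Analysis"
begin

abbreviation per_ivl :: "real set"
  where "per_ivl \<equiv> {-pi<..<pi}"

abbreviation per_measure :: "real measure"
  where "per_measure \<equiv> lebesgue_on per_ivl"

definition square_integrable :: "(real \<Rightarrow> complex) \<Rightarrow> bool"
  where "square_integrable u \<longleftrightarrow>
    u \<in> borel_measurable per_measure \<and> integrable per_measure (\<lambda>x. (cmod (u x))\<^sup>2)"

definition l2_rel :: "(real \<Rightarrow> complex) \<Rightarrow> (real \<Rightarrow> complex) \<Rightarrow> bool"
  where "l2_rel u v \<longleftrightarrow>
    square_integrable u \<and> square_integrable v \<and> (AE x in per_measure. u x = v x)"

lemma square_integrable_zero: "square_integrable (\<lambda>x. 0)"
  by (simp add: square_integrable_def)

lemma square_integrable_mult: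
  "square_integrable u \<Longrightarrow> square_integrable (\<lambda>x. c * u x)"
  by (auto simp: square_integrable_def norm_mult power_mult_distrib)

lemma square_integrable_add:
  assumes "square_integrable u" "square_integrable v"
  shows "square_integrable (\<lambda>x. u x + v x)"
proof -
  have m[measurable]: "u \<in> borel_measurable per_measure" "v \<in> borel_measurable per_measure"
    using assms by (auto simp: square_integrable_def)
  have i: "integrable per_measure (\<lambda>x. 2 * (cmod (u x))\<^sup>2 + 2 * (cmod (v x))\<^sup>2)"
    using assms by (auto simp: square_integrable_def)
  have bd: "(cmod (a + b))\<^sup>2 \<le> 2 * (cmod a)\<^sup>2 + 2 * (cmod b)\<^sup>2" for a b :: complex
  proof -
    have "(cmod (a + b))\<^sup>2 \<le> (cmod a + cmod b)\<^sup>2"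
      by (simp add: norm_triangle_ineq power_mono)
    also have "\<dots> \<le> 2 * (cmod a)\<^sup>2 + 2 * (cmod b)\<^sup>2"
      using sum_squares_bound[of "cmod a" "cmod b"] by (simp add: power2_sum)
    finally show ?thesis .
  qed
  have "integrable per_measure (\<lambda>x. (cmod (u x + v x))\<^sup>2)"
    by (rule Bochner_Integration.integrable_bound[OF i]) (auto intro: bd order_trans)
  then show ?thesis
    by (auto simp: square_integrable_def)
qed

lemma square_integrable_inner:
  assumes "square_integrable u" "square_integrable v"
  shows "integrable per_measure (\<lambda>x. u x \<bullet> v x)"
proof -
  have m[measurable]: "u \<in> borel_measurable per_measure" "v \<in> borel_measurable per_measure"
    using assms by (auto simp: square_integrable_def)
  have i: "integrable per_measure (\<lambda>x. (cmod (u x))\<^sup>2 + (cmod (v x))\<^sup>2)"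
    using assms by (auto simp: square_integrable_def)
  have bd: "\<bar>a \<bullet> b\<bar> \<le> (cmod a)\<^sup>2 + (cmod b)\<^sup>2" for a b :: complex
  proof -
    have "\<bar>a \<bullet> b\<bar> \<le> cmod a * cmod b"
      by (rule Cauchy_Schwarz_ineq2)
    also have "\<dots> \<le> (cmod a)\<^sup>2 + (cmod b)\<^sup>2"
      using sum_squares_bound[of "cmod a" "cmod b"]
        mult_nonneg_nonneg[OF norm_ge_zero norm_ge_zero, of a b] by linarith
    finally show ?thesis .
  qed
  show ?thesis
    by (rule Bochner_Integration.integrable_bound[OF i]) (auto simp: bd)
qed

quotient_type l2 = "real \<Rightarrow> complex" / partial: l2_rel
proof (rule part_equivpI)
  show "\<exists>u. l2_rel u u"
    using square_integrable_zero by (auto simp: l2_rel_def)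
  show "symp l2_rel"
    by (auto simp: l2_rel_def symp_def elim: AE_mp)
  show "transp l2_rel"
    by (auto simp: l2_rel_def transp_def elim: AE_mp)
qed

lift_definition l2_scale :: "complex \<Rightarrow> l2 \<Rightarrow> l2"
  is "\<lambda>c u x. c * u x"
  by (auto simp: l2_rel_def square_integrable_mult elim: AE_mp)

instantiation l2 :: real_inner
begin

lift_definition zero_l2 :: l2 is "\<lambda>x. 0"
  by (simp add: l2_rel_def square_integrable_zero)

lift_definition plus_l2 :: "l2 \<Rightarrow> l2 \<Rightarrow> l2" is "\<lambda>u v x. u x + v x"
  by (auto simp: l2_rel_def square_integrable_add elim: AE_mp)

lift_definition scaleR_l2 :: "real \<Rightarrow> l2 \<Rightarrow> l2" is "\<lambda>r u x. of_real r * u x"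
  by (auto simp: l2_rel_def square_integrable_mult elim: AE_mp)

definition uminus_l2 :: "l2 \<Rightarrow> l2" where "uminus_l2 u = (-1) *\<^sub>R u"

definition minus_l2 :: "l2 \<Rightarrow> l2 \<Rightarrow> l2" where "minus_l2 u v = u + - v"

text \<open>The inner product on \<^typ>\<open>complex\<close> is the real part of the sesquilinear one, so
  \<open>norm\<close> below is the usual norm of the complex Hilbert space.\<close>

lift_definition inner_l2 :: "l2 \<Rightarrow> l2 \<Rightarrow> real"
  is "\<lambda>u v. integral\<^sup>L per_measure (\<lambda>x. u x \<bullet> v x)"
  by (auto simp: l2_rel_def square_integrable_def intro!: integral_cong_AE elim: AE_mp)

definition norm_l2 :: "l2 \<Rightarrow> real" where "norm_l2 u = sqrt (u \<bullet> u)"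
definition sgn_l2 :: "l2 \<Rightarrow> l2" where "sgn_l2 u = inverse (norm u) *\<^sub>R u"
definition dist_l2 :: "l2 \<Rightarrow> l2 \<Rightarrow> real" where "dist_l2 u v = norm (u - v)"
definition uniformity_l2 :: "(l2 \<times> l2) filter"
  where "uniformity_l2 = (INF e\<in>{0<..}. principal {(x, y). dist x y < e})"
definition open_l2 :: "l2 set \<Rightarrow> bool"
  where "open_l2 U = (\<forall>x\<in>U. \<forall>\<^sub>F (x', y) in uniformity. x' = x \<longrightarrow> y \<in> U)"

instance
proof
  fix a b c :: l2 and r s :: real
  show "a + b + c = a + (b + c)"
    by transfer (auto simp: l2_rel_def square_integrable_add algebra_simps)
  show "a + b = b + a"
    by transfer (auto simp: l2_rel_def square_integrable_add algebra_simps)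
  show "0 + a = a"
    by transfer (auto simp: l2_rel_def)
  show "- a + a = 0"
    unfolding uminus_l2_def
    by transfer (auto simp: l2_rel_def square_integrable_zero)
  show "a - b = a + - b"
    by (simp add: minus_l2_def)
  show "r *\<^sub>R (a + b) = r *\<^sub>R a + r *\<^sub>R b"
    by transfer
      (auto simp: l2_rel_def square_integrable_add square_integrable_mult distrib_left)
  show "(r + s) *\<^sub>R a = r *\<^sub>R a + s *\<^sub>R a"
    by transfer
      (auto simp: l2_rel_def square_integrable_add square_integrable_mult distrib_right
        dest: square_integrable_mult[of _ "of_real (r + s)"])
  show "r *\<^sub>R s *\<^sub>R a = (r * s) *\<^sub>R a"
    by transfer (auto simp: l2_rel_def square_integrable_mult mult.assoc)
  show "1 *\<^sub>R a = a"
    by transfer (auto simp: l2_rel_def)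
  show "dist a b = norm (a - b)"
    by (simp add: dist_l2_def)
  show "sgn a = inverse (norm a) *\<^sub>R a"
    by (simp add: sgn_l2_def)
  show "uniformity = (INF e\<in>{0<..}. principal {(x, y :: l2). dist x y < e})"
    by (simp add: uniformity_l2_def)
  show "open U = (\<forall>x\<in>U. \<forall>\<^sub>F (x', y) in uniformity. x' = x \<longrightarrow> y \<in> U)" for U :: "l2 set"
    by (simp add: open_l2_def)
  show "a \<bullet> b = b \<bullet> a"
    by transfer (simp add: inner_commute)
  show "(a + b) \<bullet> c = a \<bullet> c + b \<bullet> c"
    by transfer
      (auto simp: l2_rel_def inner_add_left square_integrable_inner)
  show "(r *\<^sub>R a) \<bullet> b = r * (a \<bullet> b)"
    by transfer (simp flip: scaleR_conv_of_real)
  show "0 \<le> a \<bullet> a"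
    by transfer (auto intro!: Bochner_Integration.integral_nonneg)
  show "(a \<bullet> a = 0) = (a = 0)"
  proof transfer
    fix u assume "l2_rel u u"
    then have u: "square_integrable u" by (simp add: l2_rel_def)
    have "(integral\<^sup>L per_measure (\<lambda>x. u x \<bullet> u x) = 0) \<longleftrightarrow> (AE x in per_measure. u x \<bullet> u x = 0)"
      by (rule integral_nonneg_eq_0_iff_AE) (auto simp: square_integrable_inner u)
    then show "(integral\<^sup>L per_measure (\<lambda>x. u x \<bullet> u x) = 0) = l2_rel u (\<lambda>x. 0)"
      by (simp add: l2_rel_def u square_integrable_zero)
  qed
  show "norm a = sqrt (a \<bullet> a)"
    by (simp add: norm_l2_def)
qed

end

definition test_function :: "(real \<Rightarrow> real) \<Rightarrow> bool"
  where "test_function \<phi> \<longleftrightarrow>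
    (\<forall>n x. (deriv ^^ n) \<phi> differentiable (at x)) \<and>
    compact (closure {x. \<phi> x \<noteq> 0}) \<and> closure {x. \<phi> x \<noteq> 0} \<subseteq> per_ivl"

definition locally_integrable :: "(real \<Rightarrow> complex) \<Rightarrow> bool"
  where "locally_integrable u \<longleftrightarrow>
    (\<forall>K. compact K \<and> K \<subseteq> per_ivl \<longrightarrow> u absolutely_integrable_on K)"

text \<open>Weak derivatives are locally integrable functions on the whole open interval; a jump of
  \<open>u\<close> at 0, where the coefficient of the operator vanishes, is therefore excluded.\<close>

definition has_weak_derivative :: "(real \<Rightarrow> complex) \<Rightarrow> (real \<Rightarrow> complex) \<Rightarrow> bool"
  where "has_weak_derivative u v \<longleftrightarrow>
    locally_integrable u \<and> locally_integrable v \<and>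
    (\<forall>\<phi>. test_function \<phi> \<longrightarrow>
      integral\<^sup>L per_measure (\<lambda>x. u x * of_real (deriv \<phi> x)) =
      - integral\<^sup>L per_measure (\<lambda>x. v x * of_real (\<phi> x)))"

text \<open>The function \<^term>\<open>rep_l2 u\<close> is an arbitrary representative of the class \<^term>\<open>u\<close>.
  The notions below do not depend on which one is chosen. The next relation is the
  graph of the differential expression on its maximal domain (no boundary condition);
  since weak derivatives are unique almost everywhere, it is single-valued.\<close>

definition Lmax_graph :: "real \<Rightarrow> (real \<Rightarrow> real) \<Rightarrow> l2 \<Rightarrow> l2 \<Rightarrow> bool"
  where "Lmax_graph \<epsilon> f u g \<longleftrightarrow>
    (\<exists>u' w. has_weak_derivative (rep_l2 u) u' \<and>
            has_weak_derivative (\<lambda>x. of_real (f x) * u' x) w \<and>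
            (AE x in per_measure. rep_l2 g x = \<i> * of_real \<epsilon> * w x + \<i> * u' x))"

text \<open>Boundary values are those of the representative that is continuous up to the end
  points.\<close>

definition periodic_bc :: "l2 \<Rightarrow> bool"
  where "periodic_bc u \<longleftrightarrow>
    (\<exists>v. continuous_on {-pi..pi} v \<and> (AE x in per_measure. rep_l2 u x = v x) \<and>
         v (-pi) = v pi)"

definition Lper_dom :: "real \<Rightarrow> (real \<Rightarrow> real) \<Rightarrow> l2 set"
  where "Lper_dom \<epsilon> f = {u. (\<exists>g. Lmax_graph \<epsilon> f u g) \<and> periodic_bc u}"

definition Lper :: "real \<Rightarrow> (real \<Rightarrow> real) \<Rightarrow> l2 \<Rightarrow> l2"
  where "Lper \<epsilon> f u = (THE g. Lmax_graph \<epsilon> f u g)"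

definition eigenvalue_Lper :: "real \<Rightarrow> (real \<Rightarrow> real) \<Rightarrow> complex \<Rightarrow> bool"
  where "eigenvalue_Lper \<epsilon> f \<mu> \<longleftrightarrow>
    (\<exists>u\<in>Lper_dom \<epsilon> f. u \<noteq> 0 \<and> Lper \<epsilon> f u = l2_scale \<mu> u)"

definition Lper_shift :: "real \<Rightarrow> (real \<Rightarrow> real) \<Rightarrow> complex \<Rightarrow> l2 \<Rightarrow> l2"
  where "Lper_shift \<epsilon> f \<mu> u = Lper \<epsilon> f u - l2_scale \<mu> u"

definition Lper_resolvent :: "real \<Rightarrow> (real \<Rightarrow> real) \<Rightarrow> complex \<Rightarrow> l2 \<Rightarrow> l2"
  where "Lper_resolvent \<epsilon> f \<mu> = inv_into (Lper_dom \<epsilon> f) (Lper_shift \<epsilon> f \<mu>)"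

definition compact_operator :: "(l2 \<Rightarrow> l2) \<Rightarrow> bool"
  where "compact_operator T \<longleftrightarrow>
    (\<forall>u v. T (u + v) = T u + T v) \<and> (\<forall>c u. T (l2_scale c u) = l2_scale c (T u)) \<and>
    (\<forall>B. bounded B \<longrightarrow> compact (closure (T ` B)))"

end

theory Submission
  imports Defs "HOL-Complex_Analysis.Great_Picard"
begin

text \<open>
  Put \<open>h = g + \<mu> u\<close> and \<open>W = f u'\<close>. The equation \<open>(L - \<mu>) u = g\<close> says that
  \<open>\<i> \<epsilon> W' + \<i> u' = h\<close>, with \<open>W\<close> absolutely continuous across the zero of \<open>f\<close> at 0 and
  \<open>u' = W / f\<close> integrable there. Let \<open>p\<close> be the even positive solution of
  \<open>p' = p / (\<epsilon> f)\<close> on both sides of 0. Near 0 and \<open>\<plusminus>pi\<close>, \<open>\<bar>f\<bar>\<close> is at most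
  a multiple of the distance to these points. Hence \<open>p\<close> tends to 0 at 0 and
  to infinity at \<open>\<plusminus>pi\<close>, and it increases with \<open>\<bar>x\<bar>\<close> (lemma \<open>weight_exists\<close>).
  The product rule gives \<open>(p W)' = - \<i> p h / \<epsilon>\<close>, and \<open>p W\<close> vanishes
  at 0, so the integral of \<open>p h\<close> from 0 determines \<open>W\<close>. Integrating the equation itself yields
  \<open>u = c + T h\<close>, where
  \<open>T h x = - \<i> \<integral> (1 - p z / p x) h z dz\<close>, integrated from 0 to \<open>x\<close>.
  Conversely every \<open>c + T h\<close> with \<open>h\<close> in \<open>L\<^sup>2\<close> solves the equation (lemmas \<open>ode_imp_T\<close> and
  \<open>T_imp_ode\<close>). As the quotient \<open>p z / p x\<close> vanishes at \<open>x = \<plusminus>pi\<close>, the periodic boundary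
  condition becomes \<open>\<integral> h = 0\<close> (lemma \<open>T_ends\<close>).

  The resolvent equation is therefore the system \<open>u = c + T g + \<mu> T u\<close>, \<open>\<integral> (g + \<mu> u) = 0\<close> for
  the unknowns \<open>u\<close> and \<open>c\<close>. The kernel of \<open>T\<close> is bounded by 1 and of Volterra type on both sides
  of 0, so \<open>v = G + \<mu> T v\<close> has exactly one continuous solution for every continuous \<open>G\<close>: the right
  hand side is a contraction for the norm with weight \<open>exp (- M \<bar>x\<bar>)\<close> (lemmas
  \<open>volterra_exists\<close> and \<open>volterra_bound\<close>). Let \<open>e\<close> be the solution for \<open>G = 1\<close> and \<open>r\<close> the one
  for \<open>G = T g\<close>. Then \<open>u = c e + r\<close>, and \<open>c\<close> has to satisfy
  \<open>c \<mu> \<integral> e = - \<integral> g - \<mu> \<integral> r\<close>. If \<open>\<mu> \<integral> e\<close> were 0, \<open>e\<close> would be an eigenfunction; hence \<open>c\<close>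
  exists and is unique, and \<open>L - \<mu>\<close> is a bijection.

  For \<open>g\<close> in a bounded set, \<open>c\<close> and \<open>u\<close> stay bounded. The kernel depends continuously on \<open>x\<close> as
  an element of \<open>L\<^sup>2\<close>, up to the end points (lemma \<open>ker_L2_continuous\<close>), so \<open>T\<close> maps bounded sets
  to equicontinuous ones, and the theorem of Arzela and Ascoli gives compactness.

  The passage between weak derivatives and absolutely continuous functions rests on two facts that
  are proved first: integration by parts for indefinite integrals of integrable functions, and the
  fundamental lemma of the calculus of variations.
\<close>

section \<open>Integration by parts for indefinite integrals\<close>

text \<open>By Henstock's lemma the Riemann sums of \<open>norm \<circ> h\<close> over fine
  divisions are close to sums of norms of integrals over intervals, which vanish here.\<close>

lemma AE_zero_if_interval_integrals_zero:
  fixes h :: "real \<Rightarrow> 'a::euclidean_space"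
  assumes h: "h absolutely_integrable_on {a..b}"
    and zero: "\<And>c d. a \<le> c \<Longrightarrow> c \<le> d \<Longrightarrow> d \<le> b \<Longrightarrow> integral {c..d} h = 0"
  shows "AE x in lebesgue_on {a..b}. h x = 0"
proof -
  have int: "h integrable_on cbox a b"
    using h by (simp add: absolutely_integrable_on_def)
  have "((\<lambda>x. norm (h x)) has_integral 0) (cbox a b)"
    unfolding has_integral
  proof (intro allI impI)
    fix e :: real assume "e > 0"
    show "\<exists>\<gamma>. gauge \<gamma> \<and> (\<forall>\<D>. \<D> tagged_division_of cbox a b \<and> \<gamma> fine \<D> \<longrightarrow>
           norm ((\<Sum>(x, k)\<in>\<D>. measure lborel k *\<^sub>R norm (h x)) - 0) < e)"
    proof (rule Henstock_lemma[OF int \<open>e > 0\<close>], intro exI conjI allI impI, assumption)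
      fix \<gamma> p
      assume H: "\<And>p. \<lbrakk>p tagged_partial_division_of (cbox a b); \<gamma> fine p\<rbrakk> \<Longrightarrow>
             sum (\<lambda>(x,k). norm (measure lborel k *\<^sub>R h x - integral k h)) p < e"
        and p: "p tagged_division_of cbox a b \<and> \<gamma> fine p"
      have *: "(\<Sum>(x, k)\<in>p. measure lborel k *\<^sub>R norm (h x))
          = (\<Sum>(x,k)\<in>p. norm (measure lborel k *\<^sub>R h x - integral k h))"
      proof (rule sum.cong[OF refl], clarify)
        fix x k assume xk: "(x, k) \<in> p"
        then obtain c d where cd: "k = cbox c d" and "k \<subseteq> cbox a b" "x \<in> k"
          using tagged_division_ofD(2,3,4)[OF conjunct1[OF p] xk] by metis
        then have "integral k h = 0"
          using zero[of c d] by auto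
        then show "measure lborel k *\<^sub>R norm (h x) = norm (measure lborel k *\<^sub>R h x - integral k h)"
          by simp
      qed
      have "(\<Sum>(x,k)\<in>p. norm (measure lborel k *\<^sub>R h x - integral k h)) < e"
        using p tagged_division_of_def by (intro H) blast+
      moreover have "0 \<le> (\<Sum>(x,k)\<in>p. norm (measure lborel k *\<^sub>R h x - integral k h))"
        by (intro sum_nonneg) auto
      ultimately show "norm ((\<Sum>(x, k)\<in>p. measure lborel k *\<^sub>R norm (h x)) - 0) < e"
        unfolding * by simp
    qed
  qed
  then have "integral {a..b} (\<lambda>x. norm (h x)) = 0"
    by (simp add: integral_unique)
  moreover have "integrable (lebesgue_on {a..b}) (\<lambda>x. norm (h x))"
    using h by (simp add: set_integrable_def integrable_restrict_space flip: norm_scaleR)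
  ultimately have "integral\<^sup>L (lebesgue_on {a..b}) (\<lambda>x. norm (h x)) = 0"
    by (subst lebesgue_integral_eq_integral) auto
  with \<open>integrable (lebesgue_on {a..b}) (\<lambda>x. norm (h x))\<close>
  have "AE x in lebesgue_on {a..b}. norm (h x) = 0"
    using integral_nonneg_eq_0_iff_AE[of "lebesgue_on {a..b}" "\<lambda>x. norm (h x)"] by auto
  then show ?thesis
    by simp
qed

text \<open>Fubini's theorem is applied to the product of the Borel measures, so Lebesgue measurable
  functions are first replaced by Borel measurable ones.\<close>

lemma ex_integrable_lborel_version:
  fixes f :: "real \<Rightarrow> complex"
  assumes f: "f absolutely_integrable_on S" and S: "S \<in> sets borel"
  obtains g where "integrable lborel g" "AE x in lborel. g x = indicator S x *\<^sub>R f x"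
    "\<And>x. x \<notin> S \<Longrightarrow> g x = 0"
proof -
  define F where "F = (\<lambda>x. indicator S x *\<^sub>R f x)"
  have F: "integrable lebesgue F"
    using f by (simp add: set_integrable_def F_def)
  have "(\<lambda>x. Re (F x)) \<in> borel_measurable (completion lborel)"
       "(\<lambda>x. Im (F x)) \<in> borel_measurable (completion lborel)"
    using borel_measurable_integrable[OF F] by (auto intro: borel_measurable_Re borel_measurable_Im)
  then obtain r s where r: "r \<in> borel_measurable lborel" "AE x in lborel. Re (F x) = r x"
    and s: "s \<in> borel_measurable lborel" "AE x in lborel. Im (F x) = s x"
    using completion_ex_borel_measurable_real by metis
  define g where "g = (\<lambda>x. indicator S x *\<^sub>R Complex (r x) (s x))"
  have eq: "AE x in lborel. g x = F x"
    using r(2) s(2) by eventually_elim (auto simp: g_def F_def indicator_def complex_eq_iff)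
  have [measurable]: "r \<in> borel_measurable borel" "s \<in> borel_measurable borel" "S \<in> sets borel"
    using r s S by auto
  have gm: "g \<in> borel_measurable borel"
    unfolding g_def Complex_eq by measurable
  have "integrable lebesgue g"
  proof (subst integrable_cong_AE)
    show "AE x in lebesgue. g x = F x"
      using eq AE_completion by blast
    show "g \<in> borel_measurable lebesgue"
      using gm by (simp add: measurable_completion)
  qed (use F in auto)
  then have "integrable lborel g"
    using gm integrable_completion[of g lborel] by simp
  then show ?thesis
    using that[of g] eq by (simp add: g_def F_def)
qed

text \<open>Fubini on the two triangles that make up a square.\<close>

lemma integral_by_parts_indefinite:
  fixes f g :: "real \<Rightarrow> complex"
  assumes f: "f absolutely_integrable_on {a..b}" and g: "g absolutely_integrable_on {a..b}"
  shows "(\<lambda>x. integral {a..x} f * g x + f x * integral {a..x} g) absolutely_integrable_on {a..b}"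
    and "integral {a..b} (\<lambda>x. integral {a..x} f * g x + f x * integral {a..x} g)
      = integral {a..b} f * integral {a..b} g"
proof -
  have prod: "(\<lambda>x. integral {a..x} u * v x) absolutely_integrable_on {a..b}"
    if u: "u absolutely_integrable_on {a..b}" and v: "v absolutely_integrable_on {a..b}"
    for u v :: "real \<Rightarrow> complex"
  proof (rule absolutely_integrable_bounded_measurable_product[OF bilinear_times])
    have c: "continuous_on {a..b} (\<lambda>x. integral {a..x} u)"
      using u indefinite_integral_continuous_1 absolutely_integrable_on_def by blast
    show "(\<lambda>x. integral {a..x} u) \<in> borel_measurable (lebesgue_on {a..b})"
      using c by (simp add: continuous_imp_measurable_on_sets_lebesgue)
    show "bounded ((\<lambda>x. integral {a..x} u) ` {a..b})"
      using c compact_continuous_image compact_imp_bounded by blast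
  qed (use v in auto)
  show fg: "(\<lambda>x. integral {a..x} f * g x + f x * integral {a..x} g) absolutely_integrable_on {a..b}"
    using set_integral_add(1)[OF prod[OF f g] prod[OF g f]] by (simp add: mult.commute)
  obtain f0 where f0: "integrable lborel f0" "AE x in lborel. f0 x = indicator {a..b} x *\<^sub>R f x"
    "\<And>x. x \<notin> {a..b} \<Longrightarrow> f0 x = 0" using ex_integrable_lborel_version[OF f] by auto
  obtain g0 where g0: "integrable lborel g0" "AE x in lborel. g0 x = indicator {a..b} x *\<^sub>R g x"
    "\<And>x. x \<notin> {a..b} \<Longrightarrow> g0 x = 0" using ex_integrable_lborel_version[OF g] by auto
  have [measurable]: "f0 \<in> borel_measurable borel" "g0 \<in> borel_measurable borel"
    using f0(1) g0(1) borel_measurable_integrable by auto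
  have HK: "(\<integral>x. u0 x \<partial>lborel) = integral {a..b} u"
    if "integrable lborel u0" "AE x in lborel. u0 x = indicator {a..b} x *\<^sub>R u x"
      "u absolutely_integrable_on {a..b}" for u u0 :: "real \<Rightarrow> complex"
  proof -
    have "(\<integral>x. u0 x \<partial>lborel) = (\<integral>x. u0 x \<partial>lebesgue)"
      using that(1) by (metis borel_measurable_integrable integral_completion)
    also have "\<dots> = (LINT x:{a..b}|lebesgue. u x)"
      unfolding set_lebesgue_integral_def
      by (rule integral_cong_AE)
        (use that in \<open>auto simp: set_integrable_def AE_completion measurable_completion
          dest: borel_measurable_integrable\<close>)
    also have "\<dots> = integral {a..b} u"
      using that(3) by (rule set_lebesgue_integral_eq_integral(2))
    finally show ?thesis .
  qed
  have part: "(\<integral>y. of_bool (y \<le> x) *\<^sub>R u0 y \<partial>lborel) = integral {a..x} u"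
       "(\<integral>y. of_bool (y < x) *\<^sub>R u0 y \<partial>lborel) = integral {a..x} u"
    if "integrable lborel u0" "AE x in lborel. u0 x = indicator {a..b} x *\<^sub>R u x"
      "u absolutely_integrable_on {a..b}" "x \<in> {a..b}" for u u0 :: "real \<Rightarrow> complex" and x
  proof -
    have [measurable]: "u0 \<in> borel_measurable borel"
      using that(1) borel_measurable_integrable by auto
    have "(\<integral>y. of_bool (y \<le> x) *\<^sub>R u0 y \<partial>lborel) = integral {a..b} (\<lambda>y. of_bool (y \<le> x) *\<^sub>R u y)"
    proof (rule HK)
      show "integrable lborel (\<lambda>y. of_bool (y \<le> x) *\<^sub>R u0 y)"
        by (rule Bochner_Integration.integrable_bound[OF that(1)]) auto
      show "AE y in lborel. of_bool (y \<le> x) *\<^sub>R u0 y = indicator {a..b} y *\<^sub>R of_bool (y \<le> x) *\<^sub>R u y"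
        using that(2) by eventually_elim auto
      have "set_integrable lebesgue {a..x} u"
        using that(3,4) by (auto intro: set_integrable_subset)
      moreover have "(\<lambda>y. indicat_real {a..b} y *\<^sub>R of_bool (y \<le> x) *\<^sub>R u y) = (\<lambda>y. indicat_real {a..x} y *\<^sub>R u y)"
        using that(4) by (auto simp: indicator_def)
      ultimately show "(\<lambda>y. of_bool (y \<le> x) *\<^sub>R u y) absolutely_integrable_on {a..b}"
        unfolding set_integrable_def by simp
    qed
    also have "\<dots> = integral {a..b} (\<lambda>y. if y \<in> {a..x} then u y else 0)"
      by (rule Henstock_Kurzweil_Integration.integral_cong) auto
    also have "\<dots> = integral {a..x} u"
      using that(4) by (subst integral_restrict_Int) (auto intro: arg_cong[where f="\<lambda>S. integral S u"])
    finally show *: "(\<integral>y. of_bool (y \<le> x) *\<^sub>R u0 y \<partial>lborel) = integral {a..x} u" .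
    have "(\<integral>y. of_bool (y < x) *\<^sub>R u0 y \<partial>lborel) = (\<integral>y. of_bool (y \<le> x) *\<^sub>R u0 y \<partial>lborel)"
    proof (rule integral_cong_AE)
      have "AE y in lborel. y \<noteq> x" using AE_lborel_singleton by blast
      then show "AE y in lborel. of_bool (y < x) *\<^sub>R u0 y = of_bool (y \<le> x) *\<^sub>R u0 y"
        by eventually_elim auto
    qed auto
    with * show "(\<integral>y. of_bool (y < x) *\<^sub>R u0 y \<partial>lborel) = integral {a..x} u" by simp
  qed
  have I: "integrable (lborel \<Otimes>\<^sub>M lborel) (\<lambda>(x,y). f0 x * g0 y)"
  proof (rule lborel_pair.Fubini_integrable)
    show "integrable lborel (\<lambda>x. \<integral>y. norm (case (x, y) of (x, y) \<Rightarrow> f0 x * g0 y) \<partial>lborel)"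
      using f0(1) g0(1) by (simp add: norm_mult integrable_norm)
    show "AE x in lborel. integrable lborel (\<lambda>y. case (x, y) of (x, y) \<Rightarrow> f0 x * g0 y)"
      using g0(1) by simp
  qed simp
  have I1: "integrable (lborel \<Otimes>\<^sub>M lborel) (\<lambda>(x,y). of_bool (x \<le> y) *\<^sub>R (f0 x * g0 y))"
    by (rule Bochner_Integration.integrable_bound[OF I]) auto
  have I2: "integrable (lborel \<Otimes>\<^sub>M lborel) (\<lambda>(x,y). of_bool (y < x) *\<^sub>R (f0 x * g0 y))"
    by (rule Bochner_Integration.integrable_bound[OF I]) auto
  have "integral {a..b} f * integral {a..b} g = (\<integral>x. f0 x \<partial>lborel) * (\<integral>x. g0 x \<partial>lborel)"
    using HK[OF f0(1,2) f] HK[OF g0(1,2) g] by simp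
  also have "\<dots> = (\<integral>x. \<integral>y. f0 x * g0 y \<partial>lborel \<partial>lborel)"
    by simp
  also have "\<dots> = integral\<^sup>L (lborel \<Otimes>\<^sub>M lborel) (\<lambda>(x,y). f0 x * g0 y)"
    by (rule lborel_pair.integral_fst[OF I])
  also have "\<dots> = integral\<^sup>L (lborel \<Otimes>\<^sub>M lborel) (\<lambda>p. (\<lambda>(x,y). of_bool (x \<le> y) *\<^sub>R (f0 x * g0 y)) p + 
       (\<lambda>(x,y). of_bool (y < x) *\<^sub>R (f0 x * g0 y)) p)"
    by (rule Bochner_Integration.integral_cong) auto
  also have "\<dots> = integral\<^sup>L (lborel \<Otimes>\<^sub>M lborel) (\<lambda>(x,y). of_bool (x \<le> y) *\<^sub>R (f0 x * g0 y)) + 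
       integral\<^sup>L (lborel \<Otimes>\<^sub>M lborel) (\<lambda>(x,y). of_bool (y < x) *\<^sub>R (f0 x * g0 y))"
    by (rule Bochner_Integration.integral_add[OF I1 I2])
  also have "integral\<^sup>L (lborel \<Otimes>\<^sub>M lborel) (\<lambda>(x,y). of_bool (x \<le> y) *\<^sub>R (f0 x * g0 y))
      = (\<integral>y. (\<integral>x. of_bool (x \<le> y) *\<^sub>R f0 x \<partial>lborel) * g0 y \<partial>lborel)"
    by (subst lborel_pair.integral_snd[OF I1, symmetric]) (simp flip: mult_scaleR_left)
  also have "integral\<^sup>L (lborel \<Otimes>\<^sub>M lborel) (\<lambda>(x,y). of_bool (y < x) *\<^sub>R (f0 x * g0 y))
      = (\<integral>x. f0 x * (\<integral>y. of_bool (y < x) *\<^sub>R g0 y \<partial>lborel) \<partial>lborel)"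
    by (subst lborel_pair.integral_fst[OF I2, symmetric]) (simp flip: mult_scaleR_right)
  also have "(\<integral>y. (\<integral>x. of_bool (x \<le> y) *\<^sub>R f0 x \<partial>lborel) * g0 y \<partial>lborel)
      = integral {a..b} (\<lambda>x. integral {a..x} f * g x)"
  proof (rule HK[OF _ _ prod[OF f g]])
    show "integrable lborel (\<lambda>y. (\<integral>x. of_bool (x \<le> y) *\<^sub>R f0 x \<partial>lborel) * g0 y)"
      using lborel_pair.integrable_snd[OF I1] by (simp flip: mult_scaleR_left)
    show "AE y in lborel. (\<integral>x. of_bool (x \<le> y) *\<^sub>R f0 x \<partial>lborel) * g0 y
       = indicator {a..b} y *\<^sub>R (integral {a..y} f * g y)"
      using g0(2) by eventually_elim (auto simp: indicator_def part[OF f0(1,2) f] split: if_splits)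
  qed
  also have "(\<integral>x. f0 x * (\<integral>y. of_bool (y < x) *\<^sub>R g0 y \<partial>lborel) \<partial>lborel)
      = integral {a..b} (\<lambda>x. integral {a..x} g * f x)"
  proof (rule HK[OF _ _ prod[OF g f]])
    show "integrable lborel (\<lambda>x. f0 x * (\<integral>y. of_bool (y < x) *\<^sub>R g0 y \<partial>lborel))"
      using lborel_pair.integrable_fst[OF I2] by (simp flip: mult_scaleR_right)
    show "AE x in lborel. f0 x * (\<integral>y. of_bool (y < x) *\<^sub>R g0 y \<partial>lborel)
       = indicator {a..b} x *\<^sub>R (integral {a..x} g * f x)"
      using f0(2) by eventually_elim (auto simp: indicator_def part[OF g0(1,2) g] split: if_splits)
  qed
  finally show "integral {a..b} (\<lambda>x. integral {a..x} f * g x + f x * integral {a..x} g)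
      = integral {a..b} f * integral {a..b} g"
    using prod[OF f g] prod[OF g f]
    by (simp add: mult.commute absolutely_integrable_on_def Henstock_Kurzweil_Integration.integral_add)
qed

section \<open>Functions with an integrable derivative\<close>

text \<open>\<open>indef_on S U v\<close>: on every closed interval inside \<open>S\<close>,
  \<open>v\<close> is integrable and \<open>U\<close> is an indefinite integral of \<open>v\<close>.
  For an interval \<open>S\<close> this says that \<open>U\<close> is locally absolutely continuous
  with derivative \<open>v\<close> almost everywhere; no behaviour at the ends of \<open>S\<close>
  is required.\<close>

definition indef_on :: "real set \<Rightarrow> (real \<Rightarrow> complex) \<Rightarrow> (real \<Rightarrow> complex) \<Rightarrow> bool"
  where "indef_on S U v \<longleftrightarrow> (\<forall>a b. a \<le> b \<longrightarrow> {a..b} \<subseteq> S \<longrightarrow>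
    v absolutely_integrable_on {a..b} \<and> integral {a..b} v = U b - U a)"

lemma indef_onD:
  assumes "indef_on S U v" "a \<le> b" "{a..b} \<subseteq> S"
  shows "v absolutely_integrable_on {a..b}" "integral {a..b} v = U b - U a"
  using assms by (auto simp: indef_on_def)

lemma Icc_subset_Ioo [simp]:
  fixes a :: real shows "{s..t} \<subseteq> {a<..<b} \<longleftrightarrow> t < s \<or> a < s \<and> t < b"
  by (auto simp: subset_iff)

lemma Icc_subset_interval:
  fixes a :: real
  assumes "is_interval S" "a \<in> S" "b \<in> S"
  shows "{a..b} \<subseteq> S"
  using assms unfolding is_interval_1 by (meson atLeastAtMost_iff subsetI)

lemma indef_on_subset: "indef_on S U v \<Longrightarrow> T \<subseteq> S \<Longrightarrow> indef_on T U v"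
  by (auto simp: indef_on_def)

lemma indef_on_cong:
  assumes "\<And>x. x \<in> S \<Longrightarrow> U x = U' x" "\<And>x. x \<in> S \<Longrightarrow> v x = v' x" "indef_on S U v"
  shows "indef_on S U' v'"
  unfolding indef_on_def
proof (intro allI impI)
  fix a b :: real assume ab: "a \<le> b" "{a..b} \<subseteq> S"
  have "v absolutely_integrable_on {a..b} \<longleftrightarrow> v' absolutely_integrable_on {a..b}"
    using ab assms(2) by (intro set_integrable_cong) auto
  moreover have "integral {a..b} v = integral {a..b} v'"
    using ab assms(2) by (intro Henstock_Kurzweil_Integration.integral_cong) auto
  ultimately show "v' absolutely_integrable_on {a..b} \<and> integral {a..b} v' = U' b - U' a"
    using indef_onD[OF assms(3) ab] assms(1) ab by (metis atLeastAtMost_iff order_refl subsetD)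
qed

lemma indef_on_AE_cong:
  assumes v: "AE x in lebesgue_on S. v x = v' x" and S: "S \<in> sets lebesgue" and U: "indef_on S U v"
  shows "indef_on S U v'"
  unfolding indef_on_def
proof (intro allI impI)
  fix a b :: real assume ab: "a \<le> b" "{a..b} \<subseteq> S"
  have "AE x in lebesgue. x \<in> S \<longrightarrow> v x = v' x"
    using v S by (simp add: AE_restrict_space_iff)
  then obtain N where N: "N \<in> null_sets lebesgue" "{x. \<not> (x \<in> S \<longrightarrow> v x = v' x)} \<subseteq> N"
    unfolding eventually_ae_filter by auto
  then have neg: "negligible N" by (simp add: negligible_iff_null_sets)
  have eq: "v' x = v x" if "x \<in> {a..b} - N" for x
    using that N(2) ab by fastforce
  show "v' absolutely_integrable_on {a..b} \<and> integral {a..b} v' = U b - U a"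
    using absolutely_integrable_spike[OF indef_onD(1)[OF U ab] neg eq]
      integral_spike[of N "{a..b}" v' v, OF neg eq] indef_onD(2)[OF U ab] by simp
qed

lemma indef_on_const: "indef_on S (\<lambda>x. c) (\<lambda>x. 0)"
  by (simp add: indef_on_def)

lemma indef_on_add:
  assumes "indef_on S U v" "indef_on S U' v'"
  shows "indef_on S (\<lambda>x. U x + U' x) (\<lambda>x. v x + v' x)"
  unfolding indef_on_def
proof (intro allI impI)
  fix a b :: real assume ab: "a \<le> b" "{a..b} \<subseteq> S"
  show "(\<lambda>x. v x + v' x) absolutely_integrable_on {a..b} \<and>
    integral {a..b} (\<lambda>x. v x + v' x) = U b + U' b - (U a + U' a)"
    using indef_onD[OF assms(1) ab] indef_onD[OF assms(2) ab]
    by (auto simp: set_integral_add Henstock_Kurzweil_Integration.integral_add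
        set_lebesgue_integral_eq_integral(1))
qed

lemma indef_on_cmult:
  assumes "indef_on S U v"
  shows "indef_on S (\<lambda>x. c * U x) (\<lambda>x. c * v x)"
  using assms by (simp add: indef_on_def right_diff_distrib)

lemma indef_on_diff:
  assumes "indef_on S U v" "indef_on S U' v'"
  shows "indef_on S (\<lambda>x. U x - U' x) (\<lambda>x. v x - v' x)"
  using indef_on_add[OF assms(1) indef_on_cmult[OF assms(2), of "-1"]] by simp

lemma indef_on_continuous_Icc:
  assumes "indef_on S U v" "{a..b} \<subseteq> S"
  shows "continuous_on {a..b} U"
proof (cases "a \<le> b")
  case True
  have "v integrable_on {a..b}"
    using indef_onD(1)[OF assms(1) True assms(2)] set_lebesgue_integral_eq_integral(1) by blast
  then have "continuous_on {a..b} (\<lambda>x. U a + integral {a..x} v)"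
    by (intro continuous_intros indefinite_integral_continuous_1)
  then show ?thesis
  proof (rule continuous_on_eq)
    fix x assume "x \<in> {a..b}"
    then have "a \<le> x" "{a..x} \<subseteq> S" using assms(2) by auto
    then show "U a + integral {a..x} v = U x"
      using indef_onD(2)[OF assms(1), of a x] by simp
  qed
qed auto

lemma indef_on_continuous:
  assumes "indef_on {a<..<b} U v"
  shows "continuous_on {a<..<b} U"
proof -
  have "isCont U x" if x: "x \<in> {a<..<b}" for x
  proof -
    obtain c where c: "a < c" "c < x" using dense[of a x] x by auto
    obtain d where d: "x < d" "d < b" using dense[of x b] x by auto
    from c d show ?thesis
      using indef_on_continuous_Icc[OF assms, of c d]
      by (intro continuous_on_interior[of "{c..d}"]) (auto simp: interior_atLeastAtMost_real)
  qed
  then show ?thesis by (simp add: continuous_at_imp_continuous_on)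
qed

lemma indef_on_mult:
  assumes U: "indef_on S U v" and P: "indef_on S P q"
  shows "indef_on S (\<lambda>x. U x * P x) (\<lambda>x. v x * P x + U x * q x)"
  unfolding indef_on_def
proof (intro allI impI)
  fix a b :: real assume ab: "a \<le> b" "{a..b} \<subseteq> S"
  have v: "v absolutely_integrable_on {a..b}" and q: "q absolutely_integrable_on {a..b}"
    using indef_onD(1)[OF U ab] indef_onD(1)[OF P ab] by auto
  have Ux: "U x = U a + integral {a..x} v" "P x = P a + integral {a..x} q" if "x \<in> {a..b}" for x
  proof -
    have "a \<le> x" "{a..x} \<subseteq> S" using that ab by auto
    then show "U x = U a + integral {a..x} v" "P x = P a + integral {a..x} q"
      using indef_onD(2)[OF U, of a x] indef_onD(2)[OF P, of a x] by auto
  qed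
  note parts = integral_by_parts_indefinite[OF v q]
  let ?r = "\<lambda>x. (integral {a..x} v * q x + v x * integral {a..x} q) + (P a * v x + U a * q x)"
  have r: "v x * P x + U x * q x = ?r x" if "x \<in> {a..b}" for x
    by (simp add: Ux[OF that] algebra_simps)
  have l: "(\<lambda>x. P a * v x + U a * q x) absolutely_integrable_on {a..b}"
    using v q by (intro set_integral_add set_integrable_mult_right) auto
  have "?r absolutely_integrable_on {a..b}"
    by (intro set_integral_add(1) parts(1) l)
  moreover have "integral {a..b} ?r = integral {a..b} v * integral {a..b} q +
      (P a * integral {a..b} v + U a * integral {a..b} q)"
    using parts l v q
    by (simp add: Henstock_Kurzweil_Integration.integral_add set_lebesgue_integral_eq_integral(1))
  moreover have "\<dots> = U b * P b - U a * P a"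
    by (simp add: indef_onD(2)[OF U ab] indef_onD(2)[OF P ab] algebra_simps)
  moreover have "(\<lambda>x. v x * P x + U x * q x) absolutely_integrable_on {a..b} \<longleftrightarrow> ?r absolutely_integrable_on {a..b}"
    using r by (intro set_integrable_cong) auto
  moreover have "integral {a..b} (\<lambda>x. v x * P x + U x * q x) = integral {a..b} ?r"
    using r by (intro Henstock_Kurzweil_Integration.integral_cong) auto
  ultimately show "(\<lambda>x. v x * P x + U x * q x) absolutely_integrable_on {a..b} \<and>
       integral {a..b} (\<lambda>x. v x * P x + U x * q x) = U b * P b - U a * P a"
    by simp
qed

lemma indef_on_vector_derivative:
  assumes "\<And>x. x \<in> S \<Longrightarrow> (U has_vector_derivative v x) (at x)" "continuous_on S v"
  shows "indef_on S U v"
  unfolding indef_on_def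
proof (intro allI impI conjI)
  fix a b :: real assume ab: "a \<le> b" "{a..b} \<subseteq> S"
  show "v absolutely_integrable_on {a..b}"
    using assms(2) ab continuous_on_subset by (intro absolutely_integrable_continuous_real) auto
  show "integral {a..b} v = U b - U a"
    using assms(1) ab
    by (intro integral_unique fundamental_theorem_of_calculus)
       (auto intro: has_vector_derivative_at_within simp: subset_iff)
qed

text \<open>A point can be added to the domain if \<open>U\<close> is continuous there and
  \<open>v\<close> is integrable across it. This is how the two sides of the singular point 0 are
  joined.\<close>

lemma indef_on_glue:
  assumes l: "indef_on {a<..<c} U v" and r: "indef_on {c<..<b} U v"
    and c: "a < c" "c < b" "isCont U c"
    and v: "\<And>s t. a < s \<Longrightarrow> s \<le> t \<Longrightarrow> t < b \<Longrightarrow> v absolutely_integrable_on {s..t}"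
  shows "indef_on {a<..<b} U v"
proof -
  have R: "integral {c..t} v = U t - U c" if "c \<le> t" "t < b" for t
  proof (cases "t = c")
    case False
    then have t: "c < t" using that by simp
    have vi: "v integrable_on {c..t}"
      using v[of c t] c t that set_lebesgue_integral_eq_integral(1) by auto
    have "((\<lambda>s. integral {s..t} v) \<longlongrightarrow> integral {c..t} v) (at c within {c..t})"
      using indefinite_integral_continuous_1'[OF vi] t by (auto simp: continuous_on_def)
    then have "((\<lambda>s. integral {s..t} v) \<longlongrightarrow> integral {c..t} v) (at_right c)"
      using t by (simp add: at_within_Icc_at_right)
    moreover have "((\<lambda>s. U t - U s) \<longlongrightarrow> U t - U c) (at_right c)"
      using c(3) by (intro tendsto_intros) (simp add: isCont_def filterlim_at_split)
    moreover have "\<forall>\<^sub>F s in at_right c. U t - U s = integral {s..t} v"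
      using eventually_at_right_real[OF t]
    proof eventually_elim
      case (elim s)
      then show ?case using indef_onD(2)[OF r, of s t] that by auto
    qed
    ultimately show ?thesis
      by (intro tendsto_unique[OF trivial_limit_at_right_real, OF _ Lim_transform_eventually])
         (auto elim: eventually_mono)
  qed auto
  have L: "integral {t..c} v = U c - U t" if "t \<le> c" "a < t" for t
  proof (cases "t = c")
    case False
    then have t: "t < c" using that by simp
    have vi: "v integrable_on {t..c}"
      using v[of t c] c t that set_lebesgue_integral_eq_integral(1) by auto
    have "((\<lambda>s. integral {t..s} v) \<longlongrightarrow> integral {t..c} v) (at c within {t..c})"
      using indefinite_integral_continuous_1[OF vi] t by (auto simp: continuous_on_def)
    then have "((\<lambda>s. integral {t..s} v) \<longlongrightarrow> integral {t..c} v) (at_left c)"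
      using t by (simp add: at_within_Icc_at_left)
    moreover have "((\<lambda>s. U s - U t) \<longlongrightarrow> U c - U t) (at_left c)"
      using c(3) by (intro tendsto_intros) (simp add: isCont_def filterlim_at_split)
    moreover have "\<forall>\<^sub>F s in at_left c. U s - U t = integral {t..s} v"
      using eventually_at_left_real[OF t]
    proof eventually_elim
      case (elim s)
      then show ?case using indef_onD(2)[OF l, of t s] that by auto
    qed
    ultimately show ?thesis
      by (intro tendsto_unique[OF trivial_limit_at_left_real, OF _ Lim_transform_eventually])
         (auto elim: eventually_mono)
  qed auto
  show ?thesis
    unfolding indef_on_def
  proof (intro allI impI conjI)
    fix s t :: real assume st: "s \<le> t" "{s..t} \<subseteq> {a<..<b}"
    then have st': "a < s" "t < b" by auto
    then show vst: "v absolutely_integrable_on {s..t}"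
      using v st by auto
    consider "t < c" | "c < s" | "s \<le> c" "c \<le> t" by linarith
    then show "integral {s..t} v = U t - U s"
    proof cases
      case 1 then show ?thesis using indef_onD(2)[OF l, of s t] st st' by auto
    next
      case 2 then show ?thesis using indef_onD(2)[OF r, of s t] st st' by auto
    next
      case 3
      have "integral {s..t} v = integral {s..c} v + integral {c..t} v"
        using 3 vst set_lebesgue_integral_eq_integral(1)
        by (metis Henstock_Kurzweil_Integration.integral_combine)
      then show ?thesis using R[of t] L[of s] 3 st' by simp
    qed
  qed
qed

lemma indef_on_exists:
  assumes v: "\<And>a b. a \<le> b \<Longrightarrow> {a..b} \<subseteq> S \<Longrightarrow> v absolutely_integrable_on {a..b}"
    and S: "is_interval S" "c \<in> S"
  obtains U where "indef_on S U v" "U c = 0"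
proof -
  define U where "U = (\<lambda>x. if c \<le> x then integral {c..x} v else - integral {x..c} v)"
  have int: "v integrable_on {a..b}" if "a \<in> S" "b \<in> S" for a b
  proof (cases "a \<le> b")
    case True
    then have "{a..b} \<subseteq> S"
      using S that by (intro Icc_subset_interval)
    then show ?thesis using v[OF True] set_lebesgue_integral_eq_integral(1) by blast
  qed auto
  have "indef_on S U v"
    unfolding indef_on_def
  proof (intro allI impI conjI)
    fix a b :: real assume ab: "a \<le> b" "{a..b} \<subseteq> S"
    then show "v absolutely_integrable_on {a..b}" by (rule v)
    have abS: "a \<in> S" "b \<in> S" using ab by auto
    consider "c \<le> a" | "b \<le> c" | "a < c" "c < b" by linarith
    then show "integral {a..b} v = U b - U a"
    proof cases
      case 1
      then have "integral {c..a} v + integral {a..b} v = integral {c..b} v"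
        using ab int[OF S(2) abS(2)] by (intro Henstock_Kurzweil_Integration.integral_combine) auto
      then show ?thesis using 1 ab by (auto simp: U_def algebra_simps)
    next
      case 2
      then have "integral {a..b} v + integral {b..c} v = integral {a..c} v"
        using ab int[OF abS(1) S(2)] by (intro Henstock_Kurzweil_Integration.integral_combine) auto
      then show ?thesis using 2 ab by (auto simp: U_def algebra_simps)
    next
      case 3
      then have "integral {a..c} v + integral {c..b} v = integral {a..b} v"
        using ab int[OF abS] by (intro Henstock_Kurzweil_Integration.integral_combine) auto
      then show ?thesis using 3 by (auto simp: U_def algebra_simps)
    qed
  qed
  then show ?thesis using that[of U] by (simp add: U_def)
qed

lemma indef_on_zero_imp_constant:
  assumes "indef_on S U (\<lambda>x. 0)" "is_interval S" "x \<in> S" "y \<in> S"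
  shows "U x = U y"
proof -
  have "U a = U b" if "a \<le> b" "a \<in> S" "b \<in> S" for a b
    using indef_onD(2)[OF assms(1) that(1) Icc_subset_interval[OF assms(2) that(2,3)]] by simp
  note this[of x y] this[of y x]
  then show ?thesis using assms(3,4) by (metis nle_le)
qed

lemma indef_on_unique:
  assumes "indef_on S U v" "indef_on S U' v" "is_interval S" "x \<in> S" "y \<in> S"
  shows "U x - U' x = U y - U' y"
proof (rule indef_on_zero_imp_constant[OF _ assms(3-5)])
  show "indef_on S (\<lambda>x. U x - U' x) (\<lambda>x. 0)"
    using indef_on_diff[OF assms(1,2)] by simp
qed

lemma AE_open_interval_if_closed:
  fixes a b :: real
  assumes "\<And>c d. a < c \<Longrightarrow> c \<le> d \<Longrightarrow> d < b \<Longrightarrow> AE x in lebesgue_on {c..d}. P x"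
  shows "AE x in lebesgue_on {a<..<b}. P x"
proof -
  have "AE x in lebesgue. \<forall>n::nat. x \<in> {a + 1 / Suc n..b - 1 / Suc n} \<longrightarrow> P x"
    unfolding AE_all_countable
  proof
    fix n :: nat
    show "AE x in lebesgue. x \<in> {a + 1 / Suc n..b - 1 / Suc n} \<longrightarrow> P x"
    proof (cases "a + 1 / Suc n \<le> b - 1 / Suc n")
      case True
      have "AE x in lebesgue_on {a + 1 / Suc n..b - 1 / Suc n}. P x"
        using True by (intro assms) auto
      then show ?thesis by (simp add: AE_restrict_space_iff)
    next
      case False
      then have "{a + 1 / Suc n..b - 1 / Suc n} = {}" by (intro atLeastatMost_empty) linarith
      then show ?thesis by (simp only: empty_iff) simp
    qed
  qed
  then have "AE x in lebesgue. x \<in> {a<..<b} \<longrightarrow> P x"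
  proof eventually_elim
    case (elim x)
    show ?case
    proof
      assume x: "x \<in> {a<..<b}"
      then have "min (x - a) (b - x) > 0" by auto
      then obtain n :: nat where "1 / Suc n < min (x - a) (b - x)"
        using nat_approx_posE by metis
      then have "x \<in> {a + 1 / Suc n..b - 1 / Suc n}" by simp
      then show "P x" using elim by blast
    qed
  qed
  then show ?thesis by (simp add: AE_restrict_space_iff)
qed

lemma indef_on_const_imp_AE_zero:
  assumes "indef_on {a<..<b} (\<lambda>x. c) v"
  shows "AE x in lebesgue_on {a<..<b}. v x = 0"
proof (rule AE_open_interval_if_closed)
  fix s t :: real assume st: "a < s" "s \<le> t" "t < b"
  show "AE x in lebesgue_on {s..t}. v x = 0"
  proof (rule AE_zero_if_interval_integrals_zero)
    show "v absolutely_integrable_on {s..t}"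
      using indef_onD(1)[OF assms, of s t] st by auto
    fix x y assume "s \<le> x" "x \<le> y" "y \<le> t"
    then show "integral {x..y} v = 0"
      using indef_onD(2)[OF assms, of x y] st by auto
  qed
qed

section \<open>Smooth bump functions and the fundamental lemma\<close>

text \<open>Real functions that are infinitely often differentiable on the whole line.\<close>

definition smooth :: "(real \<Rightarrow> real) \<Rightarrow> bool"
  where "smooth f \<longleftrightarrow> (\<forall>n x. (deriv ^^ n) f differentiable (at x))"

text \<open>A family that contains a derivative of each of its members consists of smooth
  functions.\<close>

lemma smooth_coinduct:
  assumes "f \<in> S"
    and S: "\<And>g. g \<in> S \<Longrightarrow> \<exists>g'\<in>S. \<forall>x. (g has_real_derivative g' x) (at x)"
  shows "smooth f"
proof -
  have "(deriv ^^ n) f \<in> S" for n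
  proof (induction n)
    case (Suc n)
    then obtain g' where g': "g' \<in> S" "\<forall>x. ((deriv ^^ n) f has_real_derivative g' x) (at x)"
      using S by blast
    then have "deriv ((deriv ^^ n) f) = g'"
      by (intro ext) (simp add: DERIV_imp_deriv)
    then show ?case using g' by simp
  qed (use assms in simp)
  then show ?thesis
    using S unfolding smooth_def by (meson real_differentiable_def)
qed

text \<open>The functions \<open>P (1/y) exp (- 1/y)\<close> for \<open>y > 0\<close>, extended by
  0, where \<open>P\<close> is a polynomial. The polynomial factor makes the family closed under
  derivatives.\<close>

definition exp_germ :: "real poly \<Rightarrow> real \<Rightarrow> real"
  where "exp_germ P y = (if y > 0 then poly P (1 / y) * exp (- (1 / y)) else 0)"

lemma exp_germ_smult: "exp_germ (smult k P) y = k * exp_germ P y"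
  by (simp add: exp_germ_def)

lemma poly_times_exp_minus_tendsto_0:
  fixes P :: "real poly"
  shows "((\<lambda>t. poly P t * exp (- t)) \<longlongrightarrow> 0) at_top"
proof -
  have "((\<lambda>t. \<Sum>i\<le>degree P. coeff P i * (t ^ i / exp t)) \<longlongrightarrow> (\<Sum>i\<le>degree P. coeff P i * 0)) at_top"
    by (intro tendsto_intros tendsto_power_div_exp_0)
  moreover have "(\<lambda>t. \<Sum>i\<le>degree P. coeff P i * (t ^ i / exp t)) = (\<lambda>t. poly P t * exp (- t))"
    by (auto simp: poly_altdef sum_distrib_right exp_minus divide_inverse mult.assoc)
  ultimately show ?thesis by simp
qed

lemma exp_germ_has_derivative:
  "(exp_germ P has_real_derivative exp_germ ([:0, 0, 1:] * (P - pderiv P)) y) (at y)"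
proof (cases y "0::real" rule: linorder_cases)
  case less
  have "((\<lambda>y. 0) has_real_derivative 0) (at y)" by simp
  then have "(exp_germ P has_real_derivative 0) (at y)"
    by (rule has_field_derivative_transform_within_open[of _ _ _ "{..<0}"])
       (use less in \<open>auto simp: exp_germ_def\<close>)
  then show ?thesis using less by (simp add: exp_germ_def)
next
  case greater
  have "((\<lambda>y. poly P (1 / y) * exp (- (1 / y))) has_real_derivative
     exp_germ ([:0, 0, 1:] * (P - pderiv P)) y) (at y)"
    using greater
    by (auto intro!: derivative_eq_intros poly_DERIV[THEN DERIV_chain2]
        simp: exp_germ_def field_simps power2_eq_square)
  then show ?thesis
    by (rule has_field_derivative_transform_within_open[of _ _ _ "{0<..}"])
       (use greater in \<open>auto simp: exp_germ_def\<close>)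
next
  case equal
  have "((\<lambda>y. poly (pCons 0 P) (1 / y) * exp (- (1 / y))) \<longlongrightarrow> 0) (at_right 0)"
    using filterlim_compose[OF poly_times_exp_minus_tendsto_0[of "pCons 0 P"] filterlim_inverse_at_top_right]
    by (simp add: inverse_eq_divide)
  then have "((\<lambda>y. (exp_germ P y - exp_germ P 0) / (y - 0)) \<longlongrightarrow> 0) (at_right 0)"
    by (rule Lim_transform_eventually)
       (auto simp: eventually_at_filter exp_germ_def intro!: always_eventually)
  moreover have "((\<lambda>y. (exp_germ P y - exp_germ P 0) / (y - 0)) \<longlongrightarrow> 0) (at_left 0)"
    by (rule Lim_transform_eventually[OF tendsto_const])
       (auto simp: eventually_at_filter exp_germ_def intro!: always_eventually)
  ultimately show ?thesis
    using equal by (simp add: has_field_derivative_iff filterlim_split_at exp_germ_def)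
qed

text \<open>Sums of products of two such germs that vanish to the left of \<open>a \<ge> c\<close>
  and to the right of \<open>b \<le> d\<close>. The family is closed under sums, multiples and
  derivatives, and its members vanish outside the interval from \<open>c\<close> to
  \<open>d\<close>.\<close>

inductive_set bumps :: "real \<Rightarrow> real \<Rightarrow> (real \<Rightarrow> real) set" for c d where
  base: "c \<le> a \<Longrightarrow> b \<le> d \<Longrightarrow> r > 0 \<Longrightarrow>
     (\<lambda>x. exp_germ P (r * (x - a)) * exp_germ Q (r * (b - x))) \<in> bumps c d"
| add: "\<phi> \<in> bumps c d \<Longrightarrow> \<psi> \<in> bumps c d \<Longrightarrow> (\<lambda>x. \<phi> x + \<psi> x) \<in> bumps c d"

lemma bumps_closed_derivative:
  "\<phi> \<in> bumps c d \<Longrightarrow> \<exists>\<phi>'\<in>bumps c d. \<forall>x. (\<phi> has_real_derivative \<phi>' x) (at x)"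
proof (induction rule: bumps.induct)
  case (base a b r P Q)
  let ?D = "\<lambda>P. [:0, 0, 1:] * (P - pderiv P)"
  let ?\<phi>' = "\<lambda>x. exp_germ (smult r (?D P)) (r * (x - a)) * exp_germ Q (r * (b - x)) +
     exp_germ P (r * (x - a)) * exp_germ (smult (- r) (?D Q)) (r * (b - x))"
  have "?\<phi>' \<in> bumps c d"
    using base by (intro bumps.intros)
  moreover have "((\<lambda>x. exp_germ P (r * (x - a)) * exp_germ Q (r * (b - x)))
     has_real_derivative ?\<phi>' x) (at x)" for x
    unfolding exp_germ_smult
    by (rule derivative_eq_intros exp_germ_has_derivative[THEN DERIV_chain2] refl)+
       (simp add: algebra_simps)
  ultimately show ?case by (intro bexI[of _ ?\<phi>']) auto
next
  case (add \<phi> \<psi>)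
  then obtain \<phi>' \<psi>' where *: "\<phi>' \<in> bumps c d" "\<And>x. (\<phi> has_real_derivative \<phi>' x) (at x)"
    "\<psi>' \<in> bumps c d" "\<And>x. (\<psi> has_real_derivative \<psi>' x) (at x)"
    by blast
  show ?case
    by (rule bexI[of _ "\<lambda>x. \<phi>' x + \<psi>' x"]) (auto intro: * DERIV_add bumps.add)
qed

lemma bumps_scale: "\<phi> \<in> bumps c d \<Longrightarrow> (\<lambda>x. k * \<phi> x) \<in> bumps c d"
proof (induction rule: bumps.induct)
  case (base a b r P Q)
  then show ?case
    using bumps.base[of c a b d r "smult k P" Q] by (simp add: exp_germ_smult mult.assoc)
next
  case (add \<phi> \<psi>)
  then have "(\<lambda>x. k * \<phi> x + k * \<psi> x) \<in> bumps c d" by (intro bumps.add)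
  then show ?case by (simp add: distrib_left)
qed

lemma bumps_outside: "\<phi> \<in> bumps c d \<Longrightarrow> x \<le> c \<or> d \<le> x \<Longrightarrow> \<phi> x = 0"
  by (induction rule: bumps.induct) (auto simp: exp_germ_def zero_less_mult_iff)

lemma bumps_mono: "\<phi> \<in> bumps c d \<Longrightarrow> c' \<le> c \<Longrightarrow> d \<le> d' \<Longrightarrow> \<phi> \<in> bumps c' d'"
  by (induction rule: bumps.induct) (auto intro: bumps.intros)

lemma bumps_continuous: "\<phi> \<in> bumps c d \<Longrightarrow> continuous_on S \<phi>"
  using bumps_closed_derivative[of \<phi> c d]
  by (auto intro!: continuous_at_imp_continuous_on intro: DERIV_isCont)

text \<open>Bumps with values in the unit interval that tend pointwise to the indicator function of
  the open interval from \<open>a\<close> to \<open>b\<close>.\<close>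

definition plateau :: "real \<Rightarrow> real \<Rightarrow> nat \<Rightarrow> real \<Rightarrow> real"
  where "plateau a b n x = exp_germ 1 (real (Suc n) * (x - a)) * exp_germ 1 (real (Suc n) * (b - x))"

lemma plateau_in_bumps: "plateau a b n \<in> bumps a b"
  using bumps.base[of a a b b "real (Suc n)" 1 1] unfolding plateau_def by simp

lemma plateau_bounds: "0 \<le> plateau a b n x" "plateau a b n x \<le> 1"
  by (auto simp: plateau_def exp_germ_def intro!: mult_le_one)

lemma plateau_pos: "a < x \<Longrightarrow> x < b \<Longrightarrow> 0 < plateau a b n x"
  by (auto simp: plateau_def exp_germ_def)

lemma plateau_tendsto: 
  assumes "a < x" "x < b"
  shows "(\<lambda>n. plateau a b n x) \<longlonglongrightarrow> 1"
proof -
  have *: "(\<lambda>n. exp (- (1 / (real (Suc n) * y)))) \<longlonglongrightarrow> 1" if "y > 0" for y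
  proof -
    have "(\<lambda>n. inverse (real (Suc n)) * (1 / y)) \<longlonglongrightarrow> 0 * (1 / y)"
      by (intro tendsto_mult LIMSEQ_inverse_real_of_nat tendsto_const)
    then have "(\<lambda>n. exp (- (inverse (real (Suc n)) * (1 / y)))) \<longlonglongrightarrow> exp (- 0)"
      by (intro tendsto_exp tendsto_minus) simp
    then show ?thesis by (simp add: divide_inverse mult.commute)
  qed
  have "(\<lambda>n. plateau a b n x) = (\<lambda>n. exp (- (1 / (real (Suc n) * (x - a)))) * exp (- (1 / (real (Suc n) * (b - x)))))"
    using assms by (auto simp: plateau_def exp_germ_def)
  then show ?thesis using tendsto_mult[OF *[of "x - a"] *[of "b - x"]] assms by simp
qed

lemma absolutely_integrable_mult_continuous:
  fixes h g :: "real \<Rightarrow> complex"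
  assumes h: "h absolutely_integrable_on {c..d}" and g: "continuous_on {c..d} g"
  shows "(\<lambda>x. h x * g x) absolutely_integrable_on {c..d}"
proof -
  have "(\<lambda>x. g x * h x) absolutely_integrable_on {c..d}"
  proof (rule absolutely_integrable_bounded_measurable_product[OF bilinear_times])
    show "g \<in> borel_measurable (lebesgue_on {c..d})"
      using g by (simp add: continuous_imp_measurable_on_sets_lebesgue)
    show "bounded (g ` {c..d})"
      using g compact_continuous_image compact_imp_bounded by blast
  qed (use h in auto)
  then show ?thesis by (simp add: mult.commute)
qed

text \<open>The fundamental lemma of the calculus of variations. The plateaus approximate indicator
  functions of intervals, and dominated convergence shows that the integrals of \<open>h\<close>
  over intervals vanish.\<close>

lemma AE_zero_if_orthogonal_to_bumps:
  fixes h :: "real \<Rightarrow> complex"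
  assumes h: "\<And>c d. a < c \<Longrightarrow> c \<le> d \<Longrightarrow> d < b \<Longrightarrow> h absolutely_integrable_on {c..d}"
    and 0: "\<And>c d \<psi>. a < c \<Longrightarrow> c < d \<Longrightarrow> d < b \<Longrightarrow> \<psi> \<in> bumps c d \<Longrightarrow>
        integral {c..d} (\<lambda>x. h x * of_real (\<psi> x)) = 0"
  shows "AE x in lebesgue_on {a<..<b}. h x = 0"
proof (rule AE_open_interval_if_closed)
  fix s t :: real assume st: "a < s" "s \<le> t" "t < b"
  show "AE x in lebesgue_on {s..t}. h x = 0"
  proof (rule AE_zero_if_interval_integrals_zero)
    show "h absolutely_integrable_on {s..t}" using h st by auto
    fix c d assume cd: "s \<le> c" "c \<le> d" "d \<le> t"
    show "integral {c..d} h = 0"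
    proof (cases "c = d")
      case False
      then have cd': "a < c" "c < d" "d < b" using cd st by auto
      have hi: "h absolutely_integrable_on {c..d}" using h cd' by simp
      have "(\<lambda>n. integral {c..d} (\<lambda>x. h x * of_real (plateau c d n x))) \<longlonglongrightarrow>
          integral {c..d} (\<lambda>x. h x * indicator {c<..<d} x)"
      proof (rule dominated_convergence(2)[where h="\<lambda>x. norm (h x)"])
        show "(\<lambda>x. norm (h x)) integrable_on {c..d}"
          using hi absolutely_integrable_on_def by blast
        show "(\<lambda>x. h x * of_real (plateau c d n x)) integrable_on {c..d}" for n
        proof -
          have "continuous_on {c..d} (\<lambda>x. complex_of_real (plateau c d n x))"
            by (intro continuous_intros bumps_continuous[OF plateau_in_bumps])
          then show ?thesis
            using absolutely_integrable_mult_continuous[OF hi] set_lebesgue_integral_eq_integral(1) by blast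
        qed
        show "norm (h x * of_real (plateau c d n x)) \<le> norm (h x)" for n x
          using plateau_bounds[of c d n x] by (simp add: norm_mult mult_left_le)
        show "(\<lambda>n. h x * of_real (plateau c d n x)) \<longlonglongrightarrow> h x * indicator {c<..<d} x" for x
        proof (cases "c < x \<and> x < d")
          case True
          then have "(\<lambda>n. h x * of_real (plateau c d n x)) \<longlonglongrightarrow> h x * of_real 1"
            by (intro tendsto_intros plateau_tendsto) auto
          then show ?thesis using True by simp
        next
          case False
          then show ?thesis
            using bumps_outside[OF plateau_in_bumps, of x c d] by (auto simp: indicator_def)
        qed
      qed
      moreover have "integral {c..d} (\<lambda>x. h x * of_real (plateau c d n x)) = 0" for n
        using 0[OF cd' plateau_in_bumps] .
      moreover have "integral {c..d} (\<lambda>x. h x * indicator {c<..<d} x) = integral {c..d} h"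
        by (rule integral_spike[of "{c, d}"]) (auto simp: indicator_def)
      ultimately show ?thesis
        by (simp add: LIMSEQ_const_iff)
    qed auto
  qed
qed

section \<open>Weak derivatives on the interval\<close>

lemma per_measure_integral_eq:
  fixes F :: "real \<Rightarrow> complex"
  assumes F: "F absolutely_integrable_on {c..d}" and cd: "-pi < c" "d < pi"
    and 0: "\<And>x. x \<notin> {c..d} \<Longrightarrow> F x = 0"
  shows "integrable per_measure F" "integral\<^sup>L per_measure F = integral {c..d} F"
proof -
  have "(\<lambda>x. indicat_real per_ivl x *\<^sub>R F x) = (\<lambda>x. indicat_real {c..d} x *\<^sub>R F x)"
    using cd 0 by (fastforce simp: indicator_def)
  then show "integrable per_measure F" "integral\<^sup>L per_measure F = integral {c..d} F"
    using F set_lebesgue_integral_eq_integral(2)[OF F]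
    by (simp_all add: integrable_restrict_space integral_restrict_space set_integrable_def
        set_lebesgue_integral_def)
qed

lemma compact_subset_Ioo:
  fixes a b :: real
  assumes "compact K" "K \<subseteq> {a<..<b}" "a < b"
  obtains c d where "a < c" "c < d" "d < b" "K \<subseteq> {c<..<d}"
proof (cases "K = {}")
  case True
  obtain d where "a < d" "d < b" using dense[OF assms(3)] by blast
  moreover obtain c where "a < c" "c < d" using dense[OF \<open>a < d\<close>] by blast
  ultimately show ?thesis using that[of c d] True by simp
next
  case False
  obtain k where k: "k \<in> K" "\<forall>x\<in>K. k \<le> x" using compact_attains_inf[OF assms(1) False] by blast
  obtain l where l: "l \<in> K" "\<forall>x\<in>K. x \<le> l" using compact_attains_sup[OF assms(1) False] by blast
  have "a < k" "l < b" using k l assms by auto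
  then obtain c d where "a < c" "c < k" "l < d" "d < b"
    using dense[OF \<open>a < k\<close>] dense[OF \<open>l < b\<close>] by blast
  then show ?thesis using that[of c d] k l by fastforce
qed

lemma test_functionD:
  assumes "test_function \<phi>"
  shows "(\<phi> has_real_derivative deriv \<phi> x) (at x)" "continuous_on S (deriv \<phi>)"
proof -
  have d: "(deriv ^^ n) \<phi> differentiable (at x)" for n x
    using assms by (simp add: test_function_def)
  show "(\<phi> has_real_derivative deriv \<phi> x) (at x)"
    using d[of 0 x] by (simp add: DERIV_deriv_iff_real_differentiable)
  show "continuous_on S (deriv \<phi>)"
    using d[of 1] by (auto intro!: continuous_at_imp_continuous_on differentiable_imp_continuous_within)
qed

lemma test_function_support:
  assumes "test_function \<phi>"
  obtains c d where "-pi < c" "c < d" "d < pi"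
    "\<And>x. x \<le> c \<or> d \<le> x \<Longrightarrow> \<phi> x = 0" "\<And>x. x \<le> c \<or> d \<le> x \<Longrightarrow> deriv \<phi> x = 0"
proof -
  let ?K = "closure {x. \<phi> x \<noteq> 0}"
  obtain c d where cd: "-pi < c" "c < d" "d < pi" "?K \<subseteq> {c<..<d}"
    using compact_subset_Ioo[of ?K "-pi" pi] assms by (auto simp: test_function_def)
  have out: "x \<in> - ?K" if "x \<le> c \<or> d \<le> x" for x
    using cd that by fastforce
  have 0: "\<phi> x = 0" if "x \<in> - ?K" for x
    using that closure_subset[of "{x. \<phi> x \<noteq> 0}"] by auto
  have "deriv \<phi> x = 0" if "x \<in> - ?K" for x
  proof -
    have "((\<lambda>x. 0) has_real_derivative 0) (at x)" by simp
    then have "(\<phi> has_real_derivative 0) (at x)"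
      by (rule has_field_derivative_transform_within_open[OF _ _ that 0[symmetric]]) auto
    then show ?thesis by (rule DERIV_imp_deriv)
  qed
  then show ?thesis using that[of c d] cd(1-3) out 0 by blast
qed

lemma AE_lebesgue_onE:
  assumes "AE x in lebesgue_on S. P x" "S \<in> sets lebesgue"
  obtains N where "negligible N" "\<And>x. x \<in> S \<Longrightarrow> x \<notin> N \<Longrightarrow> P x"
proof -
  have "AE x in lebesgue. x \<in> S \<longrightarrow> P x"
    using assms by (simp add: AE_restrict_space_iff)
  then obtain N where "N \<in> null_sets lebesgue" "{x. \<not> (x \<in> S \<longrightarrow> P x)} \<subseteq> N"
    unfolding eventually_ae_filter by auto
  then show ?thesis using that[of N] by (auto simp: negligible_iff_null_sets)
qed

lemma locally_integrableI:
  assumes "\<And>c d. -pi < c \<Longrightarrow> c \<le> d \<Longrightarrow> d < pi \<Longrightarrow> u absolutely_integrable_on {c..d}"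
  shows "locally_integrable u"
  unfolding locally_integrable_def
proof (intro allI impI)
  fix K :: "real set" assume K: "compact K \<and> K \<subseteq> per_ivl"
  obtain c d where cd: "-pi < c" "c < d" "d < pi" "K \<subseteq> {c<..<d}"
    using compact_subset_Ioo[of K "-pi" pi] K by auto
  have "u absolutely_integrable_on {c..d}" using assms cd by simp
  then show "u absolutely_integrable_on K"
    by (rule set_integrable_subset)
       (use cd K in \<open>auto intro: borel_compact[THEN sets_completionI_sets] dest: greaterThanLessThan_subseteq_atLeastAtMost_iff[THEN iffD2] lmeasurable_compact\<close>)
qed

lemma indef_on_imp_has_weak_derivative:
  assumes U: "indef_on per_ivl U v" and u: "AE x in per_measure. u x = U x"
  shows "has_weak_derivative u v"
proof -
  obtain N where N: "negligible N" "\<And>x. x \<in> per_ivl \<Longrightarrow> x \<notin> N \<Longrightarrow> u x = U x"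
    using AE_lebesgue_onE[OF u] by auto
  have v: "v absolutely_integrable_on {c..d}" if "-pi < c" "c \<le> d" "d < pi" for c d
    using indef_onD(1)[OF U, of c d] that by auto
  have ui: "u absolutely_integrable_on {c..d}" if "-pi < c" "c \<le> d" "d < pi" for c d
  proof (rule absolutely_integrable_spike)
    show "U absolutely_integrable_on {c..d}"
      using indef_on_continuous_Icc[OF U] that by (intro absolutely_integrable_continuous_real) auto
  qed (use N that in auto)
  show ?thesis
    unfolding has_weak_derivative_def
  proof (intro conjI allI impI locally_integrableI)
    fix \<phi> assume \<phi>: "test_function \<phi>"
    obtain c d where cd: "-pi < c" "c < d" "d < pi"
      and 0: "\<And>x. x \<le> c \<or> d \<le> x \<Longrightarrow> \<phi> x = 0" "\<And>x. x \<le> c \<or> d \<le> x \<Longrightarrow> deriv \<phi> x = 0"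
      using test_function_support[OF \<phi>] by metis
    have \<phi>': "(\<phi> has_real_derivative deriv \<phi> x) (at x)" for x
      using test_functionD(1)[OF \<phi>] .
    have cont: "continuous_on {c..d} (\<lambda>x. complex_of_real (deriv \<phi> x))"
         "continuous_on {c..d} (\<lambda>x. complex_of_real (\<phi> x))"
      using test_functionD(2)[OF \<phi>] \<phi>'
      by (auto intro!: continuous_intros continuous_at_imp_continuous_on DERIV_isCont)
    have "indef_on per_ivl (\<lambda>x. complex_of_real (\<phi> x)) (\<lambda>x. of_real (deriv \<phi> x))"
      using \<phi>' test_functionD(2)[OF \<phi>]
      by (intro indef_on_vector_derivative)
         (auto intro!: continuous_intros has_vector_derivative_of_real
           simp flip: has_real_derivative_iff_has_vector_derivative)
    note prod = indef_onD(2)[OF indef_on_mult[OF U this], of c d]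
    have "integral {c..d} (\<lambda>x. v x * of_real (\<phi> x) + U x * of_real (deriv \<phi> x)) = 0"
      using prod cd by (simp add: 0)
    moreover have "integral {c..d} (\<lambda>x. v x * of_real (\<phi> x) + U x * of_real (deriv \<phi> x))
       = integral {c..d} (\<lambda>x. v x * of_real (\<phi> x) + u x * of_real (deriv \<phi> x))"
      using N cd by (intro integral_spike[of N]) auto
    moreover have i: "(\<lambda>x. v x * of_real (\<phi> x)) absolutely_integrable_on {c..d}"
         "(\<lambda>x. u x * of_real (deriv \<phi> x)) absolutely_integrable_on {c..d}"
      using v[of c d] ui[of c d] cd cont by (auto intro!: absolutely_integrable_mult_continuous)
    ultimately have "integral {c..d} (\<lambda>x. v x * of_real (\<phi> x)) + integral {c..d} (\<lambda>x. u x * of_real (deriv \<phi> x)) = 0"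
      by (simp add: Henstock_Kurzweil_Integration.integral_add set_lebesgue_integral_eq_integral(1))
    then show "integral\<^sup>L per_measure (\<lambda>x. u x * of_real (deriv \<phi> x)) =
          - integral\<^sup>L per_measure (\<lambda>x. v x * of_real (\<phi> x))"
      by (subst (1 2) per_measure_integral_eq(2)[OF _ cd(1,3)])
         (use i 0 in \<open>auto simp: add_eq_0_iff not_le less_imp_le\<close>)
  qed (use v ui in auto)
qed

text \<open>A bump with integral 0 is the derivative of a test function.\<close>

lemma bump_has_test_antiderivative:
  assumes \<rho>: "\<rho> \<in> bumps c d" and cd: "-pi < c" "c < d" "d < pi" and int: "integral {c..d} \<rho> = 0"
  obtains \<phi> where "test_function \<phi>" "\<And>x. deriv \<phi> x = \<rho> x"
proof -
  have "\<exists>F. \<forall>x::real. -\<infinity> < ereal x \<longrightarrow> ereal x < \<infinity> \<longrightarrow> (F has_vector_derivative \<rho> x) (at x)"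
    using bumps_continuous[OF \<rho>, of UNIV]
    by (intro einterval_antiderivative) (auto simp: continuous_on_eq_continuous_at)
  then obtain F where F: "\<And>x. (F has_real_derivative \<rho> x) (at x)"
    by (auto simp: has_real_derivative_iff_has_vector_derivative)
  define \<phi> where "\<phi> = (\<lambda>x. F x - F c)"
  have \<phi>: "(\<phi> has_real_derivative \<rho> x) (at x)" for x
    unfolding \<phi>_def using F by (auto intro!: derivative_eq_intros)
  have "(\<rho> has_integral (F d - F c)) {c..d}"
    using F cd by (intro fundamental_theorem_of_calculus)
      (auto intro: has_field_derivative_at_within simp flip: has_real_derivative_iff_has_vector_derivative)
  then have "F d = F c" using int by (simp add: integral_unique)
  have left: "\<phi> x = 0" if "x \<le> c" for x
  proof (cases "x = c")
    case False
    then have "x < c" using that by simp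
    then obtain z where "x < z" "z < c" "\<phi> c - \<phi> x = (c - x) * \<rho> z"
      using MVT2[of x c \<phi> \<rho>] \<phi> by blast
    then show ?thesis using bumps_outside[OF \<rho>, of z] by (simp add: \<phi>_def)
  qed (simp add: \<phi>_def)
  have right: "\<phi> x = 0" if "d \<le> x" for x
  proof (cases "x = d")
    case False
    then have "d < x" using that by simp
    then obtain z where "d < z" "z < x" "\<phi> x - \<phi> d = (x - d) * \<rho> z"
      using MVT2[of d x \<phi> \<rho>] \<phi> by blast
    then show ?thesis using bumps_outside[OF \<rho>, of z] \<open>F d = F c\<close> by (simp add: \<phi>_def)
  qed (simp add: \<phi>_def \<open>F d = F c\<close>)
  have "smooth \<phi>"
  proof (rule smooth_coinduct[of _ "insert \<phi> (bumps c d)"])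
    fix g assume "g \<in> insert \<phi> (bumps c d)"
    then have "\<exists>g'\<in>bumps c d. \<forall>x. (g has_real_derivative g' x) (at x)"
      using \<phi> \<rho> bumps_closed_derivative by auto
    then show "\<exists>g'\<in>insert \<phi> (bumps c d). \<forall>x. (g has_real_derivative g' x) (at x)"
      by blast
  qed simp
  moreover have "closure {x. \<phi> x \<noteq> 0} \<subseteq> {c..d}"
    by (intro closure_minimal) (auto, metis left less_imp_le not_le, metis right less_imp_le not_le)
  moreover from this have "compact (closure {x. \<phi> x \<noteq> 0})"
    by (meson bounded_closed_interval bounded_subset closed_closure compact_eq_bounded_closed)
  ultimately have "test_function \<phi>"
    using cd unfolding test_function_def smooth_def by fastforce
  moreover have "deriv \<phi> x = \<rho> x" for x
    using \<phi> by (simp add: DERIV_imp_deriv)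
  ultimately show ?thesis using that by blast
qed

lemma integral_zero_outside:
  fixes f :: "real \<Rightarrow> 'a::banach"
  assumes "S \<subseteq> T" "\<And>x. x \<in> T \<Longrightarrow> x \<notin> S \<Longrightarrow> f x = 0"
  shows "integral T f = integral S f"
proof -
  have "integral T f = integral T (\<lambda>x. if x \<in> S then f x else 0)"
    using assms(2) by (intro Henstock_Kurzweil_Integration.integral_cong) auto
  also have "\<dots> = integral (S \<inter> T) f"
    by (rule integral_restrict_Int)
  finally show ?thesis using assms(1) by (simp add: inf.absorb1)
qed

text \<open>The lemma of du Bois-Reymond. Let \<open>V\<close> be an indefinite integral of
  \<open>v\<close>. Then \<open>W = u - V\<close> is orthogonal to all bumps with integral 0.
  Subtracting from an arbitrary bump a multiple of the fixed bump \<open>\<eta>\<close> shows that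
  \<open>W - C\<close> is orthogonal to all bumps for a suitable constant \<open>C\<close>.\<close>

lemma has_weak_derivative_imp_indef_on:
  assumes "has_weak_derivative u v"
  obtains U where "indef_on per_ivl U v" "AE x in per_measure. u x = U x"
proof -
  have u: "u absolutely_integrable_on {c..d}" and v: "v absolutely_integrable_on {c..d}"
    if "-pi < c" "c \<le> d" "d < pi" for c d
    using assms that by (auto simp: has_weak_derivative_def locally_integrable_def)
  obtain V where V: "indef_on per_ivl V v"
    by (rule indef_on_exists[of per_ivl v 0]) (auto simp: is_interval_oo intro: v)
  have Vi: "V absolutely_integrable_on {c..d}" if "-pi < c" "c \<le> d" "d < pi" for c d
    using indef_on_continuous_Icc[OF V] that by (intro absolutely_integrable_continuous_real) auto
  define W where "W = (\<lambda>x. u x - V x)"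
  have W: "W absolutely_integrable_on {c..d}" if "-pi < c" "c \<le> d" "d < pi" for c d
    unfolding W_def using u[OF that] Vi[OF that] by (rule set_integral_diff(1))
  have orth: "integral {c..d} (\<lambda>x. W x * of_real (\<rho> x)) = 0"
    if \<rho>: "\<rho> \<in> bumps c d" and cd: "-pi < c" "c < d" "d < pi" and int: "integral {c..d} \<rho> = 0" for \<rho> c d
  proof -
    obtain \<phi> where \<phi>: "test_function \<phi>" "\<And>x. deriv \<phi> x = \<rho> x"
      using bump_has_test_antiderivative[OF \<rho> cd int] by blast
    have weak: "integral\<^sup>L per_measure (\<lambda>x. g x * of_real (\<rho> x)) = - integral\<^sup>L per_measure (\<lambda>x. v x * of_real (\<phi> x))"
      if "has_weak_derivative g v" for g
    proof -
      have "deriv \<phi> = \<rho>" using \<phi>(2) by blast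
      then show ?thesis using that \<phi>(1) unfolding has_weak_derivative_def by metis
    qed
    have eq: "integral\<^sup>L per_measure (\<lambda>x. u x * of_real (\<rho> x)) = integral\<^sup>L per_measure (\<lambda>x. V x * of_real (\<rho> x))"
      using weak[OF assms] weak[OF indef_on_imp_has_weak_derivative[OF V AE_I2]] by simp
    have cont: "continuous_on {c..d} (\<lambda>x. complex_of_real (\<rho> x))"
      by (intro continuous_intros bumps_continuous[OF \<rho>])
    have out: "\<rho> x = 0" if "x \<notin> {c..d}" for x
      using bumps_outside[OF \<rho>, of x] that by auto
    have i: "(\<lambda>x. u x * of_real (\<rho> x)) absolutely_integrable_on {c..d}"
       "(\<lambda>x. V x * of_real (\<rho> x)) absolutely_integrable_on {c..d}"
      using u[of c d] Vi[of c d] cd cont by (auto intro!: absolutely_integrable_mult_continuous)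
    have "integral {c..d} (\<lambda>x. W x * of_real (\<rho> x))
      = integral {c..d} (\<lambda>x. u x * of_real (\<rho> x)) - integral {c..d} (\<lambda>x. V x * of_real (\<rho> x))"
      using i by (simp add: W_def left_diff_distrib Henstock_Kurzweil_Integration.integral_diff
          set_lebesgue_integral_eq_integral(1))
    then show ?thesis
      using per_measure_integral_eq(2)[OF i(1) cd(1,3)] per_measure_integral_eq(2)[OF i(2) cd(1,3)] out eq
      by simp
  qed
  define \<eta> where "\<eta> = plateau (-1) 1 0"
  define m where "m = integral {-1..1} \<eta>"
  have \<eta>: "\<eta> \<in> bumps (-1) 1" unfolding \<eta>_def by (rule plateau_in_bumps)
  have \<eta>i: "\<eta> integrable_on S" if "S = {c..d}" for S c d
    using bumps_continuous[OF \<eta>] that by (auto intro!: integrable_continuous_real)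
  have "m > 0"
  proof -
    have "m \<ge> 0"
      unfolding m_def \<eta>_def by (rule integral_nonneg[OF \<eta>i[unfolded \<eta>_def]]) (auto simp: plateau_bounds)
    moreover have "m \<noteq> 0"
      using integral_cbox_eq_0_iff[of "-1" 1 \<eta>] bumps_continuous[OF \<eta>] plateau_pos[of "-1" 0 1 0]
      by (auto simp: m_def \<eta>_def plateau_bounds box_real intro!: bexI[of _ 0])
    ultimately show ?thesis by simp
  qed
  define C where "C = integral {-1..1} (\<lambda>x. W x * of_real (\<eta> x)) / of_real m"
  have "AE x in per_measure. W x - C = 0"
  proof (rule AE_zero_if_orthogonal_to_bumps)
    fix c d assume "-pi < c" "c \<le> d" "d < pi"
    then show "(\<lambda>x. W x - C) absolutely_integrable_on {c..d}"
      using W by (intro set_integral_diff(1)) auto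
  next
    fix c d \<psi> assume cd: "-pi < c" "c < d" "d < pi" and \<psi>: "\<psi> \<in> bumps c d"
    define c' where "c' = min c (-1)"
    define d' where "d' = max d 1"
    have cd': "-pi < c'" "c' < d'" "d' < pi" "{c..d} \<subseteq> {c'..d'}" "{-1..1} \<subseteq> {c'..d'}"
      using cd pi_gt3 by (auto simp: c'_def d'_def)
    define k where "k = integral {c..d} \<psi> / m"
    define \<rho> where "\<rho> = (\<lambda>x. \<psi> x + (- k) * \<eta> x)"
    have \<rho>: "\<rho> \<in> bumps c' d'"
      unfolding \<rho>_def by (intro bumps.add bumps_scale bumps_mono[OF \<psi>] bumps_mono[OF \<eta>])
        (auto simp: c'_def d'_def)
    have ext: "integral {c'..d'} g = integral {s..t} g"
      if "\<And>x. x < s \<or> t < x \<Longrightarrow> g x = 0" "{s..t} \<subseteq> {c'..d'}" for g :: "real \<Rightarrow> 'a::banach" and s t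
      using that by (intro integral_zero_outside) (auto simp: not_le)
    have \<psi>0: "\<psi> x = 0" if "x < c \<or> d < x" for x using bumps_outside[OF \<psi>] that by auto
    have \<eta>0: "\<eta> x = 0" if "x < -1 \<or> 1 < x" for x using bumps_outside[OF \<eta>] that by auto
    have \<psi>i: "\<psi> integrable_on {c'..d'}"
      using bumps_continuous[OF \<psi>] by (auto intro!: integrable_continuous_real)
    have Wi: "(\<lambda>x. W x * of_real (\<phi> x)) integrable_on {c'..d'}" if "\<phi> \<in> bumps s t" for \<phi> s t
    proof -
      have "continuous_on {c'..d'} (\<lambda>x. complex_of_real (\<phi> x))"
        by (intro continuous_intros bumps_continuous[OF that])
      then have "(\<lambda>x. W x * of_real (\<phi> x)) absolutely_integrable_on {c'..d'}"
        using W[of c' d'] cd' by (intro absolutely_integrable_mult_continuous) auto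
      then show ?thesis by (rule set_lebesgue_integral_eq_integral(1))
    qed
    have \<eta>k: "(\<lambda>x. - k * \<eta> x) integrable_on {c'..d'}"
      using integrable_cmul[OF \<eta>i[OF refl], of "- k"] by simp
    have "integral {c'..d'} \<rho> = integral {c'..d'} \<psi> - k * integral {c'..d'} \<eta>"
      unfolding \<rho>_def Henstock_Kurzweil_Integration.integral_add[OF \<psi>i \<eta>k] by simp
    also have "\<dots> = 0"
      using ext[OF \<psi>0 cd'(4)] ext[OF \<eta>0 cd'(5)] \<open>m > 0\<close> by (simp add: k_def m_def)
    finally have "integral {c'..d'} (\<lambda>x. W x * of_real (\<rho> x)) = 0"
      using orth[OF \<rho> cd'(1-3)] by simp
    also have "integral {c'..d'} (\<lambda>x. W x * of_real (\<rho> x))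
        = integral {c'..d'} (\<lambda>x. W x * of_real (\<psi> x) - of_real k * (W x * of_real (\<eta> x)))"
      by (simp add: \<rho>_def algebra_simps)
    also have "\<dots> = integral {c'..d'} (\<lambda>x. W x * of_real (\<psi> x)) - of_real k * integral {c'..d'} (\<lambda>x. W x * of_real (\<eta> x))"
      using Wi[OF \<psi>] Wi[OF \<eta>]
      by (subst Henstock_Kurzweil_Integration.integral_diff) (auto intro: integrable_on_cmult_left)
    also have "integral {c'..d'} (\<lambda>x. W x * of_real (\<eta> x)) = of_real m * C"
      using \<open>m > 0\<close> \<eta>0 by (subst ext[OF _ cd'(5)]) (auto simp: C_def)
    finally have Wpsi: "integral {c'..d'} (\<lambda>x. W x * of_real (\<psi> x)) = C * of_real (integral {c..d} \<psi>)"
      using \<open>m > 0\<close> by (simp add: k_def)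
    have "integral {c..d} (\<lambda>x. (W x - C) * of_real (\<psi> x)) = integral {c'..d'} (\<lambda>x. (W x - C) * of_real (\<psi> x))"
      using \<psi>0 by (subst ext[OF _ cd'(4)]) auto
    also have "\<dots> = integral {c'..d'} (\<lambda>x. W x * of_real (\<psi> x)) - C * integral {c'..d'} (\<lambda>x. of_real (\<psi> x))"
      unfolding left_diff_distrib using Wi[OF \<psi>] \<psi>i
      by (subst Henstock_Kurzweil_Integration.integral_diff)
         (auto intro!: integrable_on_mult_right has_integral_integrable[OF has_integral_of_real[OF integrable_integral]])
    also have "integral {c'..d'} (\<lambda>x. complex_of_real (\<psi> x)) = of_real (integral {c..d} \<psi>)"
      using integral_unique[OF has_integral_of_real[OF integrable_integral[OF \<psi>i]]] ext[OF \<psi>0 cd'(4)] by simp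
    finally show "integral {c..d} (\<lambda>x. (W x - C) * of_real (\<psi> x)) = 0"
      by (simp add: Wpsi)
  qed
  then have "AE x in per_measure. u x = V x + C"
    by eventually_elim (simp add: W_def algebra_simps)
  moreover have "indef_on per_ivl (\<lambda>x. V x + C) v"
    using indef_on_add[OF V indef_on_const[of _ C]] by simp
  ultimately show ?thesis using that by blast
qed

lemma AE_eq_imp_eq_open:
  fixes U V :: "real \<Rightarrow> complex"
  assumes U: "continuous_on S U" and V: "continuous_on S V" and S: "open S"
    and eq: "AE x in lebesgue_on S. U x = V x" and x: "x \<in> S"
  shows "U x = V x"
proof (rule ccontr)
  assume ne: "U x \<noteq> V x"
  obtain N where N: "negligible N" "\<And>x. x \<in> S \<Longrightarrow> x \<notin> N \<Longrightarrow> U x = V x"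
    using AE_lebesgue_onE[OF eq] S by (auto simp: borel_open)
  let ?D = "S \<inter> (\<lambda>x. U x - V x) -` (- {0})"
  have "open ?D"
    using U V S by (intro continuous_open_preimage continuous_intros) auto
  moreover have "x \<in> ?D" using x ne by simp
  ultimately have "\<not> negligible ?D"
    using open_not_negligible by blast
  moreover have "?D \<subseteq> N" using N(2) by auto
  ultimately show False using N(1) negligible_subset by blast
qed

lemma AE_eq_imp_eq_Icc:
  fixes U V :: "real \<Rightarrow> complex"
  assumes U: "continuous_on {a..b} U" and V: "continuous_on {a..b} V" and ab: "a < b"
    and eq: "AE x in lebesgue_on {a<..<b}. U x = V x" and x: "x \<in> {a..b}"
  shows "U x = V x"
proof -
  have 0: "U y - V y = 0" if "y \<in> {a<..<b}" for y
    using AE_eq_imp_eq_open[OF _ _ _ eq that] continuous_on_subset[OF U greaterThanLessThan_subseteq_atLeastAtMost_iff[THEN iffD2]]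
      continuous_on_subset[OF V greaterThanLessThan_subseteq_atLeastAtMost_iff[THEN iffD2]] by simp
  have "U x - V x = 0"
    by (rule continuous_constant_on_closure[of "{a<..<b}"])
       (use U V x ab 0 in \<open>auto intro!: continuous_intros\<close>)
  then show ?thesis by simp
qed

lemma has_weak_derivative_unique:
  assumes v: "has_weak_derivative u v" and v': "has_weak_derivative u' v'"
    and u: "AE x in per_measure. u x = u' x"
  shows "AE x in per_measure. v x = v' x"
proof -
  obtain U where U: "indef_on per_ivl U v" "AE x in per_measure. u x = U x"
    using has_weak_derivative_imp_indef_on[OF v] .
  obtain U' where U': "indef_on per_ivl U' v'" "AE x in per_measure. u' x = U' x"
    using has_weak_derivative_imp_indef_on[OF v'] .
  have "AE x in per_measure. U x = U' x"
    using u U(2) U'(2) by eventually_elim simp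
  then have eq: "U x = U' x" if "x \<in> per_ivl" for x
    using AE_eq_imp_eq_open[OF indef_on_continuous[OF U(1)] indef_on_continuous[OF U'(1)] open_greaterThanLessThan] that
    by blast
  have "indef_on per_ivl (\<lambda>x. 0) (\<lambda>x. v x - v' x)"
    by (rule indef_on_cong[OF _ _ indef_on_diff[OF U(1) U'(1)]]) (simp_all add: eq)
  from indef_on_const_imp_AE_zero[OF this] show ?thesis by simp
qed

section \<open>The Hilbert space of square integrable functions\<close>

lemma l2_rel_refl [simp]: "l2_rel u u \<longleftrightarrow> square_integrable u"
  by (simp add: l2_rel_def)

lemma square_integrable_rep_l2 [simp]: "square_integrable (rep_l2 u)"
  using Quotient_rep_reflp[OF Quotient_l2] by simp

lemma abs_rep_l2 [simp]: "abs_l2 (rep_l2 u) = u"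
  by (rule Quotient_abs_rep[OF Quotient_l2])

lemma rep_abs_l2:
  assumes "square_integrable u"
  shows "AE x in per_measure. rep_l2 (abs_l2 u) x = u x"
proof -
  have "l2_rel (rep_l2 (abs_l2 u)) u"
    using Quotient_rep_abs[OF Quotient_l2] assms by simp
  then show ?thesis by (simp add: l2_rel_def)
qed

lemma l2_eqI:
  assumes "AE x in per_measure. rep_l2 u x = rep_l2 v x"
  shows "u = v"
proof -
  have "l2_rel (rep_l2 u) (rep_l2 v)" using assms by (simp add: l2_rel_def)
  then show ?thesis by (metis Quotient_rel_rep[OF Quotient_l2])
qed

lemma rep_l2_zero: "AE x in per_measure. rep_l2 0 x = 0"
  unfolding zero_l2_def by (rule rep_abs_l2) (rule square_integrable_zero)

lemma rep_l2_add: "AE x in per_measure. rep_l2 (u + v) x = rep_l2 u x + rep_l2 v x"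
proof -
  have "u + v = abs_l2 (\<lambda>x. rep_l2 u x + rep_l2 v x)"
    using plus_l2.abs_eq[of "rep_l2 u" "rep_l2 v"] by simp
  then show ?thesis by (simp add: rep_abs_l2 square_integrable_add)
qed

lemma rep_l2_scale: "AE x in per_measure. rep_l2 (l2_scale c u) x = c * rep_l2 u x"
proof -
  have "l2_scale c u = abs_l2 (\<lambda>x. c * rep_l2 u x)"
    using l2_scale.abs_eq[of "rep_l2 u" c] by simp
  then show ?thesis by (simp add: rep_abs_l2 square_integrable_mult)
qed

lemma rep_l2_diff: "AE x in per_measure. rep_l2 (u - v) x = rep_l2 u x - rep_l2 v x"
  using rep_l2_add[of "u - v" v] by eventually_elim simp

lemma norm_l2_eq: "norm u = sqrt (\<integral>x. (cmod (rep_l2 u x))\<^sup>2 \<partial>per_measure)"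
proof -
  have "u \<bullet> u = (\<integral>x. rep_l2 u x \<bullet> rep_l2 u x \<partial>per_measure)"
    using inner_l2.abs_eq[of "rep_l2 u" "rep_l2 u"] by simp
  then show ?thesis by (simp add: norm_eq_sqrt_inner power2_norm_eq_inner)
qed

text \<open>The \<open>L\<^sup>2\<close> norm for functions instead of classes. It is meaningful for
  square integrable functions only.\<close>

definition l2_norm :: "(real \<Rightarrow> complex) \<Rightarrow> real"
  where "l2_norm h = sqrt (\<integral>x. (cmod (h x))\<^sup>2 \<partial>per_measure)"

lemma l2_norm_cong_AE:
  assumes "square_integrable u" "square_integrable v" "AE x in per_measure. u x = v x"
  shows "l2_norm u = l2_norm v"
proof -
  have [measurable]: "u \<in> borel_measurable per_measure" "v \<in> borel_measurable per_measure"
    using assms by (auto simp: square_integrable_def)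
  have "(\<integral>x. (cmod (u x))\<^sup>2 \<partial>per_measure) = (\<integral>x. (cmod (v x))\<^sup>2 \<partial>per_measure)"
    by (rule integral_cong_AE) (use assms(3) in auto)
  then show ?thesis by (simp add: l2_norm_def)
qed

lemma norm_abs_l2: "square_integrable u \<Longrightarrow> norm (abs_l2 u) = l2_norm u"
  using l2_norm_cong_AE[OF _ _ rep_abs_l2] by (simp add: norm_l2_eq l2_norm_def)

lemma norm_rep_l2: "l2_norm (rep_l2 u) = norm u"
  by (simp add: norm_l2_eq l2_norm_def)

lemma l2_norm_nonneg: "0 \<le> l2_norm h"
  by (simp add: l2_norm_def)

lemma l2_norm_add_le:
  assumes "square_integrable u" "square_integrable v"
  shows "l2_norm (\<lambda>x. u x + v x) \<le> l2_norm u + l2_norm v"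
proof -
  have "abs_l2 (\<lambda>x. u x + v x) = abs_l2 u + abs_l2 v"
    using plus_l2.abs_eq[of u v] assms by simp
  then show ?thesis
    using norm_triangle_ineq[of "abs_l2 u" "abs_l2 v"] assms
    by (metis norm_abs_l2 square_integrable_add)
qed

lemma l2_norm_scale: "l2_norm (\<lambda>x. c * u x) = cmod c * l2_norm u"
  by (simp add: l2_norm_def norm_mult power_mult_distrib real_sqrt_mult)

text \<open>The inequality is the one of the inner product space \<^typ>\<open>l2\<close>, applied
  to the absolute values of \<open>g\<close> and \<open>h\<close>.\<close>

lemma Cauchy_Schwarz_per_measure:
  assumes g: "square_integrable g" and h: "square_integrable h"
  shows "integrable per_measure (\<lambda>x. g x * h x)"
    and "cmod (\<integral>x. g x * h x \<partial>per_measure) \<le> l2_norm g * l2_norm h"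
proof -
  have [measurable]: "g \<in> borel_measurable per_measure" "h \<in> borel_measurable per_measure"
    using assms by (auto simp: square_integrable_def)
  let ?g = "\<lambda>x. complex_of_real (cmod (g x))" and ?h = "\<lambda>x. complex_of_real (cmod (h x))"
  have gh: "square_integrable ?g" "square_integrable ?h"
    using assms by (auto simp: square_integrable_def)
  have "integrable per_measure (\<lambda>x. ?g x \<bullet> ?h x)"
    by (rule square_integrable_inner[OF gh])
  moreover have inner: "?g x \<bullet> ?h x = cmod (g x) * cmod (h x)" for x
    by (simp add: inner_complex_def)
  ultimately have int: "integrable per_measure (\<lambda>x. cmod (g x) * cmod (h x))"
    by simp
  then show "integrable per_measure (\<lambda>x. g x * h x)"
    by (rule Bochner_Integration.integrable_bound) (auto simp: norm_mult)
  have "cmod (\<integral>x. g x * h x \<partial>per_measure) \<le> (\<integral>x. cmod (g x * h x) \<partial>per_measure)"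
    by (rule integral_norm_bound)
  also have "\<dots> = abs_l2 ?g \<bullet> abs_l2 ?h"
    using inner_l2.abs_eq[of ?g ?h] gh by (simp add: inner norm_mult)
  also have "\<dots> \<le> norm (abs_l2 ?g) * norm (abs_l2 ?h)"
    by (rule norm_cauchy_schwarz)
  also have "\<dots> = l2_norm g * l2_norm h"
    using gh by (simp add: norm_abs_l2) (simp add: l2_norm_def)
  finally show "cmod (\<integral>x. g x * h x \<partial>per_measure) \<le> l2_norm g * l2_norm h" .
qed

lemma finite_measure_per_measure: "finite_measure per_measure"
  by (intro finite_measureI) (simp add: emeasure_restrict_space)

lemma measure_per_measure: "measure per_measure per_ivl = 2 * pi"
  by (simp add: measure_restrict_space)

lemma square_integrable_bounded:
  assumes [measurable]: "h \<in> borel_measurable per_measure" and b: "\<And>x. x \<in> per_ivl \<Longrightarrow> cmod (h x) \<le> B"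
  shows "square_integrable h" "l2_norm h \<le> sqrt (2 * pi) * B"
proof -
  interpret finite_measure per_measure by (rule finite_measure_per_measure)
  have "cmod (h 0) \<le> B" using b[of 0] by simp
  then have B: "0 \<le> B" by (rule order_trans[OF norm_ge_zero])
  have sq: "(cmod (h x))\<^sup>2 \<le> B\<^sup>2" if "x \<in> per_ivl" for x
    using b[OF that] by (simp add: power_mono)
  have int: "integrable per_measure (\<lambda>x. (cmod (h x))\<^sup>2)"
    by (rule integrable_const_bound[of _ "B\<^sup>2"]) (use sq in \<open>auto intro!: AE_I2 simp: space_restrict_space\<close>)
  then show "square_integrable h" by (simp add: square_integrable_def)
  have "(\<integral>x. (cmod (h x))\<^sup>2 \<partial>per_measure) \<le> (\<integral>x. B\<^sup>2 \<partial>per_measure)"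
    by (rule integral_mono[OF int]) (use sq in \<open>auto simp: space_restrict_space\<close>)
  also have "\<dots> = 2 * pi * B\<^sup>2"
    by (simp add: measure_per_measure)
  finally have "l2_norm h \<le> sqrt (2 * pi * B\<^sup>2)"
    unfolding l2_norm_def by simp
  then show "l2_norm h \<le> sqrt (2 * pi) * B"
    using B by (simp add: real_sqrt_mult)
qed

lemma square_integrable_continuous:
  fixes v :: "real \<Rightarrow> complex"
  assumes "continuous_on {-pi..pi} v"
  shows "square_integrable v"
proof -
  have "v \<in> borel_measurable per_measure"
    using assms by (intro continuous_imp_measurable_on_sets_lebesgue) (auto elim: continuous_on_subset)
  moreover obtain B where "\<forall>x\<in>{-pi..pi}. cmod (v x) \<le> B"
    using compact_imp_bounded[OF compact_continuous_image[OF assms compact_Icc]]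
    by (auto simp: bounded_iff)
  ultimately show ?thesis
    by (intro square_integrable_bounded(1)[of v B]) auto
qed

lemma square_integrable_integrable:
  assumes "square_integrable h"
  shows "integrable per_measure h"
  using Cauchy_Schwarz_per_measure(1)[OF square_integrable_continuous[of "\<lambda>x. 1"] assms] by simp

section \<open>The weight and the integral operator\<close>

lemma per_measure_integral_Ioo:
  fixes F :: "real \<Rightarrow> 'a::euclidean_space"
  assumes F: "F absolutely_integrable_on {a..b}" and ab: "-pi \<le> a" "b \<le> pi"
  shows "integrable per_measure (\<lambda>z. of_bool (a < z \<and> z < b) *\<^sub>R F z)"
    and "(\<integral>z. of_bool (a < z \<and> z < b) *\<^sub>R F z \<partial>per_measure) = integral {a..b} F"
proof -
  have eq: "(\<lambda>z. indicat_real per_ivl z *\<^sub>R (of_bool (a < z \<and> z < b) *\<^sub>R F z)) = (\<lambda>z. indicat_real {a<..<b} z *\<^sub>R F z)"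
    using ab by (auto simp: indicator_def)
  have abs: "F absolutely_integrable_on {a<..<b}"
    using F by (simp add: absolutely_integrable_on_Icc_iff_Ioo)
  show "integrable per_measure (\<lambda>z. of_bool (a < z \<and> z < b) *\<^sub>R F z)"
    using abs eq by (simp add: integrable_restrict_space set_integrable_def)
  have "(\<integral>z. of_bool (a < z \<and> z < b) *\<^sub>R F z \<partial>per_measure) = (LINT z:{a<..<b}|lebesgue. F z)"
    using eq by (simp add: integral_restrict_space set_lebesgue_integral_def)
  also have "\<dots> = integral {a..b} F"
    using set_lebesgue_integral_eq_integral(2)[OF abs] by (simp add: integral_open_interval_real)
  finally show "(\<integral>z. of_bool (a < z \<and> z < b) *\<^sub>R F z \<partial>per_measure) = integral {a..b} F" .
qed

lemma exp_weight_integral: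
  assumes x: "x \<in> {-pi..pi}" and M: "0 < M"
  defines "g \<equiv> \<lambda>z. of_bool (0 < z \<and> z < x \<or> x < z \<and> z < 0) * exp (M * \<bar>z\<bar>)"
  shows "integrable per_measure g" "integral\<^sup>L per_measure g = (exp (M * \<bar>x\<bar>) - 1) / M"
proof -
  have "integrable per_measure g \<and> integral\<^sup>L per_measure g = (exp (M * \<bar>x\<bar>) - 1) / M"
  proof (cases "0 \<le> x")
    case True
    then have g: "g = (\<lambda>z. of_bool (0 < z \<and> z < x) * exp (M * z))"
      by (auto simp: g_def)
    have "((\<lambda>z. exp (M * z)) has_integral (exp (M * x) / M - exp (M * 0) / M)) {0..x}"
      using True M
      by (intro fundamental_theorem_of_calculus)
         (auto intro!: derivative_eq_intros simp flip: has_real_derivative_iff_has_vector_derivative)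
    then have "integral {0..x} (\<lambda>z. exp (M * z)) = (exp (M * x) - 1) / M"
      by (simp add: integral_unique diff_divide_distrib)
    moreover have "(\<lambda>z. exp (M * z)) absolutely_integrable_on {0..x}"
      by (intro absolutely_integrable_continuous_real continuous_intros)
    ultimately show ?thesis
      using per_measure_integral_Ioo[of 0 x "\<lambda>z. exp (M * z)"] x True
      unfolding g by simp
  next
    case False
    then have g: "g = (\<lambda>z. of_bool (x < z \<and> z < 0) * exp (- (M * z)))"
      by (auto simp: g_def)
    have "((\<lambda>z. exp (- (M * z))) has_integral (- exp (- (M * 0)) / M - - exp (- (M * x)) / M)) {x..0}"
      using False M
      by (intro fundamental_theorem_of_calculus)
         (auto intro!: derivative_eq_intros simp flip: has_real_derivative_iff_has_vector_derivative)
    then have "integral {x..0} (\<lambda>z. exp (- (M * z))) = (exp (M * \<bar>x\<bar>) - 1) / M"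
      using False by (simp add: integral_unique diff_divide_distrib)
    moreover have "(\<lambda>z. exp (- (M * z))) absolutely_integrable_on {x..0}"
      by (intro absolutely_integrable_continuous_real continuous_intros)
    ultimately show ?thesis
      using per_measure_integral_Ioo[of x 0 "\<lambda>z. exp (- (M * z))"] x False
      unfolding g by simp
  qed
  then show "integrable per_measure g" "integral\<^sup>L per_measure g = (exp (M * \<bar>x\<bar>) - 1) / M"
    by auto
qed

text \<open>The properties of \<open>f\<close> and of the weight \<open>p\<close> on which the
  analysis rests. The weight solves \<open>p' = p / (\<epsilon> f)\<close> on both sides of 0. The
  values \<open>p (\<plusminus>pi) = 0\<close> are a convention: with division by 0 equal to 0, the
  quotient \<open>p z / p x\<close> takes its limit 0 at \<open>x = \<plusminus>pi\<close>.\<close>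

locale weight =
  fixes \<epsilon> :: real and f p :: "real \<Rightarrow> real"
  assumes eps: "0 < \<epsilon>"
    and f_cont: "continuous_on UNIV f"
    and f_pos: "0 < x \<Longrightarrow> x < pi \<Longrightarrow> 0 < f x"
    and f_neg: "-pi < x \<Longrightarrow> x < 0 \<Longrightarrow> f x < 0"
    and f_zero: "f 0 = 0"
    and f_lower: "\<exists>m>0. \<exists>r>0. \<forall>x. \<bar>x\<bar> \<le> r \<longrightarrow> m * \<bar>x\<bar> \<le> \<bar>f x\<bar>"
    and p_deriv: "x \<noteq> 0 \<Longrightarrow> -pi < x \<Longrightarrow> x < pi \<Longrightarrow> (p has_real_derivative p x / (\<epsilon> * f x)) (at x)"
    and p_pos: "x \<noteq> 0 \<Longrightarrow> -pi < x \<Longrightarrow> x < pi \<Longrightarrow> 0 < p x"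
    and p_zero: "p 0 = 0" "p pi = 0" "p (-pi) = 0"
    and p_cont_0: "isCont p 0"
    and p_mono: "0 < z \<Longrightarrow> z \<le> x \<Longrightarrow> x < pi \<Longrightarrow> p z \<le> p x"
    and p_antimono: "-pi < x \<Longrightarrow> x \<le> z \<Longrightarrow> z < 0 \<Longrightarrow> p z \<le> p x"
    and p_ends: "((\<lambda>x. inverse (p x)) \<longlongrightarrow> 0) (at_left pi)" "((\<lambda>x. inverse (p x)) \<longlongrightarrow> 0) (at_right (-pi))"
begin

text \<open>The real kernel of the solution operator. It is supported in the \<open>z\<close>
  between 0 and \<open>x\<close>; for \<open>x < 0\<close> the sign accounts for the orientation of
  the integral from 0 to \<open>x\<close>.\<close>

definition ker :: "real \<Rightarrow> real \<Rightarrow> real"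
  where "ker x z = (if 0 < z \<and> z < x then 1 - p z / p x
                    else if x < z \<and> z < 0 then p z / p x - 1 else 0)"

text \<open>The solution operator: the functions \<open>c + T h\<close> are the solutions
  \<open>u\<close> of \<open>\<i> \<epsilon> (f u')' + \<i> u' = h\<close>.\<close>

definition T :: "(real \<Rightarrow> complex) \<Rightarrow> real \<Rightarrow> complex"
  where "T h x = - \<i> * (\<integral>z. of_real (ker x z) * h z \<partial>per_measure)"

lemma p_isCont: "x \<in> per_ivl \<Longrightarrow> isCont p x"
  using p_deriv[of x] p_cont_0 by (cases "x = 0") (auto intro: DERIV_isCont)

lemma ker_bound: "x \<in> {-pi..pi} \<Longrightarrow> \<bar>ker x z\<bar> \<le> of_bool (0 < z \<and> z < x \<or> x < z \<and> z < 0)"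
proof -
  assume x: "x \<in> {-pi..pi}"
  have 1: "0 \<le> p z / p x \<and> p z / p x \<le> 1" if "0 < z" "z < x"
  proof (cases "x = pi")
    case False
    then show ?thesis using that x p_mono[of z x] p_pos[of x] p_pos[of z] by auto
  qed (simp add: p_zero)
  have 2: "0 \<le> p z / p x \<and> p z / p x \<le> 1" if "x < z" "z < 0"
  proof (cases "x = -pi")
    case False
    then show ?thesis using that x p_antimono[of x z] p_pos[of x] p_pos[of z] by auto
  qed (simp add: p_zero)
  show ?thesis using 1 2 by (auto simp: ker_def)
qed

lemma ker_abs_le_1: "x \<in> {-pi..pi} \<Longrightarrow> \<bar>ker x z\<bar> \<le> 1"
  using ker_bound[of x z] by (auto simp: of_bool_def split: if_splits)

lemma p_measurable: "p \<in> borel_measurable per_measure"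
  by (intro continuous_imp_measurable_on_sets_lebesgue continuous_at_imp_continuous_on)
     (auto intro: p_isCont)

lemma ker_measurable [measurable]: "ker x \<in> borel_measurable per_measure"
proof -
  have [measurable]: "p \<in> borel_measurable per_measure" by (rule p_measurable)
  have [measurable]: "(\<lambda>z. z) \<in> borel_measurable per_measure"
    by (intro continuous_imp_measurable_on_sets_lebesgue) auto
  show ?thesis unfolding ker_def by measurable
qed

lemma inverse_p_continuous: 
  assumes "x \<in> {-pi..pi}" "x \<noteq> 0"
  shows "((\<lambda>y. inverse (p y)) \<longlongrightarrow> inverse (p x)) (at x within {-pi..pi})"
proof -
  consider "x = pi" | "x = -pi" | "x \<in> per_ivl" using assms by fastforce
  then show ?thesis
  proof cases
    case 1
    then show ?thesis using p_ends(1) p_zero by (simp add: at_within_Icc_at_left)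
  next
    case 2
    then show ?thesis using p_ends(2) p_zero by (simp add: at_within_Icc_at_right)
  next
    case 3
    then have "isCont (\<lambda>y. inverse (p y)) x"
      using p_isCont p_pos[of x] assms by (intro continuous_intros) auto
    then show ?thesis
      unfolding isCont_def by (rule filterlim_mono) (auto intro: at_le)
  qed
qed

text \<open>At \<open>x = \<plusminus>pi\<close> the divergence of \<open>p\<close> is used, and at
  0 the shrinking of the support.\<close>

lemma ker_tendsto:
  assumes x: "x \<in> {-pi..pi}" and z: "z \<noteq> x"
  shows "((\<lambda>y. ker y z) \<longlongrightarrow> ker x z) (at x within {-pi..pi})"
proof -
  have lt: "\<forall>\<^sub>F y in at x within {-pi..pi}. z < y" if "z < x"
    using order_tendstoD(1)[OF tendsto_ident_at that] .
  have gt: "\<forall>\<^sub>F y in at x within {-pi..pi}. y < z" if "x < z"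
    using order_tendstoD(2)[OF tendsto_ident_at that] .
  consider "0 < z" "z < x" | "x < z" "z < 0" | "0 \<le> z" "x < z" | "z \<le> 0" "z < x"
    using z by linarith
  then show ?thesis
  proof cases
    case 1
    have "((\<lambda>y. 1 - p z * inverse (p y)) \<longlongrightarrow> 1 - p z * inverse (p x)) (at x within {-pi..pi})"
      using 1 x by (intro tendsto_intros inverse_p_continuous) auto
    moreover have "\<forall>\<^sub>F y in at x within {-pi..pi}. 1 - p z * inverse (p y) = ker y z"
      using lt[OF 1(2)] by eventually_elim (use 1 in \<open>simp add: ker_def divide_inverse\<close>)
    ultimately show ?thesis
      using 1 by (simp add: ker_def divide_inverse Lim_transform_eventually)
  next
    case 2
    have "((\<lambda>y. p z * inverse (p y) - 1) \<longlongrightarrow> p z * inverse (p x) - 1) (at x within {-pi..pi})"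
      using 2 x by (intro tendsto_intros inverse_p_continuous) auto
    moreover have "\<forall>\<^sub>F y in at x within {-pi..pi}. p z * inverse (p y) - 1 = ker y z"
      using gt[OF 2(1)] by eventually_elim (use 2 in \<open>simp add: ker_def divide_inverse\<close>)
    ultimately show ?thesis
      using 2 by (simp add: ker_def divide_inverse Lim_transform_eventually)
  next
    case 3
    have "\<forall>\<^sub>F y in at x within {-pi..pi}. 0 = ker y z"
      using gt[OF 3(2)] by eventually_elim (use 3 in \<open>simp add: ker_def\<close>)
    from Lim_transform_eventually[OF tendsto_const this] show ?thesis using 3 by (simp add: ker_def)
  next
    case 4
    have "\<forall>\<^sub>F y in at x within {-pi..pi}. 0 = ker y z"
      using lt[OF 4(2)] by eventually_elim (use 4 in \<open>simp add: ker_def\<close>)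
    from Lim_transform_eventually[OF tendsto_const this] show ?thesis using 4 by (simp add: ker_def)
  qed
qed

lemma ker_square_integrable: 
  assumes "x \<in> {-pi..pi}"
  shows "square_integrable (\<lambda>z. of_real (ker x z))"
  by (rule square_integrable_bounded(1)[where B = 1]) (auto simp: ker_abs_le_1[OF assms])

lemma ker_diff_square_integrable: 
  assumes "x \<in> {-pi..pi}" "y \<in> {-pi..pi}"
  shows "square_integrable (\<lambda>z. of_real (ker y z - ker x z))"
  using square_integrable_add[OF ker_square_integrable[OF assms(2)]
      square_integrable_mult[OF ker_square_integrable[OF assms(1)], of "-1"]] by simp

text \<open>Dominated convergence, with pointwise convergence of the kernels for \<open>z \<noteq> x\<close>.\<close>

lemma ker_L2_continuous:
  assumes x: "x \<in> {-pi..pi}"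
  shows "((\<lambda>y. l2_norm (\<lambda>z. of_real (ker y z - ker x z))) \<longlongrightarrow> 0) (at x within {-pi..pi})"
proof -
  interpret finite_measure per_measure by (rule finite_measure_per_measure)
  have "((\<lambda>y. \<integral>z. (ker y z - ker x z)\<^sup>2 \<partial>per_measure) \<longlongrightarrow> 0) (at x within {-pi..pi})"
    unfolding tendsto_at_iff_sequentially
  proof (intro allI impI)
    fix X :: "nat \<Rightarrow> real" assume X: "\<forall>i. X i \<in> {-pi..pi} - {x}" "X \<longlonglongrightarrow> x"
    have "(\<lambda>n. \<integral>z. (ker (X n) z - ker x z)\<^sup>2 \<partial>per_measure) \<longlonglongrightarrow> (\<integral>z. 0 \<partial>per_measure)"
    proof (rule integral_dominated_convergence[where w = "\<lambda>_. 4"])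
      have "AE z in lebesgue. z \<noteq> x" by (intro AE_completion AE_lborel_singleton)
      then have "AE z in per_measure. z \<noteq> x" by (auto simp: AE_restrict_space_iff elim: eventually_mono)
      then show "AE z in per_measure. (\<lambda>n. (ker (X n) z - ker x z)\<^sup>2) \<longlonglongrightarrow> 0"
      proof eventually_elim
        case (elim z)
        have "(\<lambda>n. ker (X n) z) \<longlonglongrightarrow> ker x z"
          using ker_tendsto[OF x elim] X unfolding tendsto_at_iff_sequentially comp_def by blast
        then have "(\<lambda>n. (ker (X n) z - ker x z)\<^sup>2) \<longlonglongrightarrow> (ker x z - ker x z)\<^sup>2"
          by (intro tendsto_intros)
        then show ?case by simp
      qed
      show "AE z in per_measure. norm ((ker (X n) z - ker x z)\<^sup>2) \<le> 4" for n
      proof (rule AE_I2)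
        fix z
        have "\<bar>ker (X n) z - ker x z\<bar> \<le> 2"
          using ker_abs_le_1[OF x, of z] ker_abs_le_1[of "X n" z] X by fastforce
        then have "\<bar>ker (X n) z - ker x z\<bar>\<^sup>2 \<le> 2\<^sup>2" by (intro power_mono) auto
        then show "norm ((ker (X n) z - ker x z)\<^sup>2) \<le> 4" by simp
      qed
    qed auto
    then show "((\<lambda>y. \<integral>z. (ker y z - ker x z)\<^sup>2 \<partial>per_measure) \<circ> X) \<longlonglongrightarrow> 0"
      by (simp add: comp_def)
  qed
  then have "((\<lambda>y. sqrt (\<integral>z. (ker y z - ker x z)\<^sup>2 \<partial>per_measure)) \<longlongrightarrow> sqrt 0) (at x within {-pi..pi})"
    by (rule tendsto_real_sqrt)
  then show ?thesis by (simp add: l2_norm_def norm_of_real del: of_real_diff)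
qed

lemma T_integrable: "x \<in> {-pi..pi} \<Longrightarrow> square_integrable h \<Longrightarrow> integrable per_measure (\<lambda>z. of_real (ker x z) * h z)"
  by (intro Cauchy_Schwarz_per_measure(1) ker_square_integrable)

lemma T_diff_le:
  assumes "x \<in> {-pi..pi}" "y \<in> {-pi..pi}" "square_integrable h"
  shows "cmod (T h y - T h x) \<le> l2_norm (\<lambda>z. of_real (ker y z - ker x z)) * l2_norm h"
proof -
  have "T h y - T h x = - \<i> * (\<integral>z. of_real (ker y z - ker x z) * h z \<partial>per_measure)"
    using T_integrable[OF assms(1,3)] T_integrable[OF assms(2,3)]
    by (simp add: T_def left_diff_distrib Bochner_Integration.integral_diff right_diff_distrib)
  then show ?thesis
    using Cauchy_Schwarz_per_measure(2)[OF ker_diff_square_integrable[OF assms(1,2)] assms(3)]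
    by (simp add: norm_mult)
qed

lemma T_bound:
  assumes "x \<in> {-pi..pi}" "square_integrable h"
  shows "cmod (T h x) \<le> sqrt (2 * pi) * l2_norm h"
proof -
  have "cmod (T h x) \<le> l2_norm (\<lambda>z. of_real (ker x z)) * l2_norm h"
    using Cauchy_Schwarz_per_measure(2)[OF ker_square_integrable[OF assms(1)] assms(2)]
    by (simp add: T_def norm_mult)
  also have "\<dots> \<le> (sqrt (2 * pi) * 1) * l2_norm h"
    by (intro mult_right_mono square_integrable_bounded(2)) (auto simp: ker_abs_le_1[OF assms(1)] l2_norm_nonneg)
  finally show ?thesis by simp
qed

lemma T_equicontinuous:
  assumes x: "x \<in> {-pi..pi}" and e: "0 < e" and B: "0 \<le> B"
  obtains d where "0 < d" "\<And>h y. square_integrable h \<Longrightarrow> l2_norm h \<le> B \<Longrightarrow> y \<in> {-pi..pi} \<Longrightarrow>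
     \<bar>y - x\<bar> < d \<Longrightarrow> cmod (T h y - T h x) < e"
proof -
  have "e / (B + 1) > 0" using e B by simp
  from order_tendstoD(2)[OF ker_L2_continuous[OF x] this]
  obtain d where d: "d > 0" "\<And>y. y \<in> {-pi..pi} \<Longrightarrow> y \<noteq> x \<Longrightarrow> dist y x < d \<Longrightarrow>
     l2_norm (\<lambda>z. of_real (ker y z - ker x z)) < e / (B + 1)"
    unfolding eventually_at by blast
  show ?thesis
  proof (rule that[OF d(1)])
    fix h y assume h: "square_integrable h" "l2_norm h \<le> B" and y: "y \<in> {-pi..pi}" "\<bar>y - x\<bar> < d"
    show "cmod (T h y - T h x) < e"
    proof (cases "y = x")
      case False
      have "cmod (T h y - T h x) \<le> l2_norm (\<lambda>z. of_real (ker y z - ker x z)) * l2_norm h"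
        by (rule T_diff_le[OF x y(1) h(1)])
      also have "\<dots> \<le> e / (B + 1) * B"
        using d(2)[OF y(1) False] y(2) h(2) e B
        by (intro mult_mono) (auto simp: dist_real_def l2_norm_nonneg)
      also have "\<dots> < e" using e B by (simp add: field_simps)
      finally show ?thesis .
    qed (use e in simp)
  qed
qed

lemma T_continuous:
  assumes "square_integrable h"
  shows "continuous_on {-pi..pi} (T h)"
  unfolding continuous_on_iff
proof (intro ballI allI impI)
  fix x e :: real assume "x \<in> {-pi..pi}" "0 < e"
  then obtain d where "0 < d" "\<And>y. y \<in> {-pi..pi} \<Longrightarrow> \<bar>y - x\<bar> < d \<Longrightarrow> cmod (T h y - T h x) < e"
    using T_equicontinuous[of x e "l2_norm h"] l2_norm_nonneg assms by (metis order_refl)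
  then show "\<exists>d>0. \<forall>x'\<in>{-pi..pi}. dist x' x < d \<longrightarrow> dist (T h x') (T h x) < e"
    by (auto simp: dist_norm)
qed

lemma T_add:
  assumes "x \<in> {-pi..pi}" "square_integrable g" "square_integrable h"
  shows "T (\<lambda>z. g z + h z) x = T g x + T h x"
  using T_integrable[OF assms(1,2)] T_integrable[OF assms(1,3)]
  by (simp add: T_def distrib_left)

lemma T_cmult: "T (\<lambda>z. c * h z) x = c * T h x"
proof -
  have "(\<integral>z. of_real (ker x z) * (c * h z) \<partial>per_measure) = (\<integral>z. c * (of_real (ker x z) * h z) \<partial>per_measure)"
    by (simp add: mult_ac)
  also have "\<dots> = c * (\<integral>z. of_real (ker x z) * h z \<partial>per_measure)"
    by (rule integral_mult_right_zero)
  finally show ?thesis by (simp add: T_def)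
qed

lemma T_cong_AE:
  assumes "g \<in> borel_measurable per_measure" "h \<in> borel_measurable per_measure" "AE z in per_measure. g z = h z"
  shows "T g x = T h x"
  unfolding T_def by (intro arg_cong2[where f="(*)"] refl integral_cong_AE) (use assms in auto)

text \<open>For the norm with weight \<open>exp (- M \<bar>x\<bar>)\<close> the operator
  \<open>T\<close> is bounded by \<open>1 / M\<close>.\<close>

lemma T_exp_bound:
  assumes x: "x \<in> {-pi..pi}" and M: "0 < M" and h: "square_integrable h" and s: "0 \<le> s"
    and b: "\<And>z. z \<in> {-pi..pi} \<Longrightarrow> cmod (h z) \<le> s * exp (M * \<bar>z\<bar>)"
  shows "cmod (T h x) \<le> s / M * exp (M * \<bar>x\<bar>)"
proof -
  define g where "g = (\<lambda>z. s * (of_bool (0 < z \<and> z < x \<or> x < z \<and> z < 0) * exp (M * \<bar>z\<bar>)))"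
  have "s * (exp (M * \<bar>x\<bar>) - 1) \<le> s * exp (M * \<bar>x\<bar>)" using s by (intro mult_left_mono) auto
  then have gi: "integrable per_measure g \<and> integral\<^sup>L per_measure g \<le> s / M * exp (M * \<bar>x\<bar>)"
    unfolding g_def using exp_weight_integral[OF x M] M by (simp add: divide_right_mono)
  have "cmod (T h x) \<le> (\<integral>z. cmod (of_real (ker x z) * h z) \<partial>per_measure)"
    using integral_norm_bound[of per_measure "\<lambda>z. of_real (ker x z) * h z"] by (simp add: T_def norm_mult)
  also have "\<dots> \<le> integral\<^sup>L per_measure g"
  proof (rule integral_mono)
    show "integrable per_measure (\<lambda>z. cmod (of_real (ker x z) * h z))"
      using T_integrable[OF x h] by simp
    show "cmod (of_real (ker x z) * h z) \<le> g z" if "z \<in> space per_measure" for z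
    proof -
      have "\<bar>ker x z\<bar> * cmod (h z) \<le> of_bool (0 < z \<and> z < x \<or> x < z \<and> z < 0) * (s * exp (M * \<bar>z\<bar>))"
        using that ker_bound[OF x, of z] b[of z] by (intro mult_mono) (auto simp: space_restrict_space)
      then show ?thesis by (simp add: norm_mult g_def mult_ac)
    qed
  qed (use gi in simp)
  finally show ?thesis using gi by linarith
qed

end

section \<open>The Volterra equation\<close>

context weight
begin

lemma T_diff:
  assumes "x \<in> {-pi..pi}" "square_integrable g" "square_integrable h"
  shows "T (\<lambda>z. g z - h z) x = T g x - T h x"
  using T_integrable[OF assms(1,2)] T_integrable[OF assms(1,3)]
  by (simp add: T_def right_diff_distrib)

text \<open>With \<open>M = 2 \<bar>\<mu>\<bar> + 1\<close>, \<open>\<mu> T\<close> has norm at most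
  \<open>1 / 2\<close> for the weighted supremum norm, so the weighted norm of \<open>v\<close> is
  at most \<open>2 m\<close>.\<close>

lemma volterra_bound:
  assumes v: "continuous_on {-pi..pi} v"
    and eq: "\<And>x. x \<in> {-pi..pi} \<Longrightarrow> v x = G x + \<mu> * T v x"
    and G: "\<And>x. x \<in> {-pi..pi} \<Longrightarrow> cmod (G x) \<le> m"
    and x: "x \<in> {-pi..pi}"
  shows "cmod (v x) \<le> 2 * m * exp ((2 * cmod \<mu> + 1) * pi)"
proof -
  define M where "M = 2 * cmod \<mu> + 1"
  have M: "0 < M" "cmod \<mu> \<le> M / 2" by (auto simp: M_def add_pos_nonneg intro: add_nonneg_pos)
  define w where "w = (\<lambda>x. exp (- (M * \<bar>x\<bar>)) * cmod (v x))"
  have "continuous_on {-pi..pi} w"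
    unfolding w_def using v by (intro continuous_intros)
  then obtain y where y: "y \<in> {-pi..pi}" "\<forall>z\<in>{-pi..pi}. w z \<le> w y"
    using continuous_attains_sup[of "{-pi..pi}" w] by auto
  have vw: "cmod (v z) = w z * exp (M * \<bar>z\<bar>)" for z
    by (simp add: w_def exp_minus)
  have w0: "0 \<le> w z" for z by (simp add: w_def)
  have "cmod (T v y) \<le> w y / M * exp (M * \<bar>y\<bar>)"
  proof (rule T_exp_bound[OF y(1) M(1) square_integrable_continuous[OF v] w0])
    show "cmod (v z) \<le> w y * exp (M * \<bar>z\<bar>)" if "z \<in> {-pi..pi}" for z
      unfolding vw using y(2) that by (intro mult_right_mono) auto
  qed
  have "cmod (v y) \<le> cmod (G y) + cmod \<mu> * cmod (T v y)"
    using eq[OF y(1)] by (metis norm_mult norm_triangle_ineq)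
  also have "\<dots> \<le> m + M / 2 * (w y / M * exp (M * \<bar>y\<bar>))"
    using G[OF y(1)] M \<open>cmod (T v y) \<le> _\<close> by (intro add_mono mult_mono) auto
  finally have "w y * exp (M * \<bar>y\<bar>) \<le> m + w y / 2 * exp (M * \<bar>y\<bar>)"
    using M by (simp add: vw)
  then have "w y / 2 * exp (M * \<bar>y\<bar>) \<le> m" by simp
  moreover have "w y / 2 * 1 \<le> w y / 2 * exp (M * \<bar>y\<bar>)"
    using M w0[of y] by (intro mult_left_mono) auto
  ultimately have "w y \<le> 2 * m" by simp
  moreover have "w x \<le> w y" using y(2) x by blast
  moreover have "exp (M * \<bar>x\<bar>) \<le> exp (M * pi)" using M x by auto
  ultimately show ?thesis
    unfolding vw M_def[symmetric] using w0[of x] by (intro mult_mono) auto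
qed

text \<open>Banach's fixed point theorem in the space of bounded continuous functions on the line.
  The unknown is \<open>exp (- M \<bar>x\<bar>) v x\<close>, extended from the interval by
  constants.\<close>

lemma volterra_exists:
  assumes G: "continuous_on {-pi..pi} G"
  obtains v where "continuous_on {-pi..pi} v" "\<And>x. x \<in> {-pi..pi} \<Longrightarrow> v x = G x + \<mu> * T v x"
proof -
  define M where "M = 2 * cmod \<mu> + 1"
  have M: "0 < M" "cmod \<mu> \<le> M / 2" by (auto simp: M_def add_pos_nonneg intro: add_nonneg_pos)
  define E where "E = (\<lambda>y z. complex_of_real (exp (M * \<bar>z\<bar>)) * apply_bcontfun y z)"
  define \<Psi> where "\<Psi> = (\<lambda>y x. of_real (exp (- (M * \<bar>x\<bar>))) * (G x + \<mu> * T (E y) x))"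
  have Ec: "continuous_on S (E y)" for y S
    unfolding E_def by (intro continuous_intros continuous_on_apply_bcontfun)
  have \<Psi>c: "continuous_on (cbox (-pi) pi) (\<Psi> y)" for y
    unfolding \<Psi>_def using G T_continuous[OF square_integrable_continuous[OF Ec]]
    by (auto intro!: continuous_intros)
  have "\<exists>g. \<forall>z. apply_bcontfun g z = \<Psi> y (clamp (-pi) pi z)" for y
    using continuous_on_cbox_bcontfunE[OF \<Psi>c] by metis
  then obtain \<Phi> where \<Phi>: "\<And>y z. apply_bcontfun (\<Phi> y) z = \<Psi> y (clamp (-pi) pi z)"
    by metis
  have clamp: "clamp (-pi) pi z \<in> {-pi..pi}" for z
    using clamp_in_interval[of "-pi" pi z] by simp
  have "\<exists>!y. \<Phi> y = y"
  proof (rule banach_fix_type)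
    show "(0::real) \<le> 1/2" "1/2 < (1::real)" by auto
    show "\<forall>y y'. dist (\<Phi> y) (\<Phi> y') \<le> 1 / 2 * dist y y'"
    proof (intro allI dist_bound)
      fix y y' z
      let ?c = "clamp (-pi) pi z"
      define h where "h = (\<lambda>z. E y z - E y' z)"
      have "cmod (T h ?c) \<le> dist y y' / M * exp (M * \<bar>?c\<bar>)"
      proof (rule T_exp_bound[OF clamp M(1)])
        show "square_integrable h"
          unfolding h_def by (intro square_integrable_continuous continuous_intros Ec)
        show "cmod (h z) \<le> dist y y' * exp (M * \<bar>z\<bar>)" for z
        proof -
          have "h z = of_real (exp (M * \<bar>z\<bar>)) * (apply_bcontfun y z - apply_bcontfun y' z)"
            by (simp add: h_def E_def algebra_simps)
          then show ?thesis
            using dist_bounded[of y z y'] by (simp add: norm_mult dist_norm mult.commute)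
        qed
      qed auto
      moreover have "T h ?c = T (E y) ?c - T (E y') ?c"
        unfolding h_def
        by (intro T_diff[OF clamp] square_integrable_continuous Ec)
      moreover have "\<Psi> y ?c - \<Psi> y' ?c = of_real (exp (- (M * \<bar>?c\<bar>))) * (\<mu> * (T (E y) ?c - T (E y') ?c))"
        by (simp add: \<Psi>_def algebra_simps)
      ultimately have "cmod (\<Psi> y ?c - \<Psi> y' ?c) \<le> exp (- (M * \<bar>?c\<bar>)) * (M / 2 * (dist y y' / M * exp (M * \<bar>?c\<bar>)))"
        using M by (simp only: norm_mult norm_of_real abs_exp_cancel) (intro mult_mono, auto)
      also have "\<dots> = 1 / 2 * dist y y'"
        using M by (simp add: exp_minus field_simps)
      finally show "dist (apply_bcontfun (\<Phi> y) z) (apply_bcontfun (\<Phi> y') z) \<le> 1 / 2 * dist y y'"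
        by (simp add: \<Phi> dist_norm)
    qed
  qed
  then obtain y where y: "\<Phi> y = y" by blast
  show ?thesis
  proof (rule that[of "E y"])
    show "continuous_on {-pi..pi} (E y)" by (rule Ec)
    fix x assume x: "x \<in> {-pi..pi}"
    have "apply_bcontfun y x = \<Psi> y x"
      using \<Phi>[of y x] y x by simp
    then show "E y x = G x + \<mu> * T (E y) x"
      by (simp add: E_def[of] \<Psi>_def exp_minus)
  qed
qed

end

section \<open>Primitives and the kernel\<close>

lemma square_integrable_imp_absolutely_integrable:
  assumes "square_integrable h" "-pi \<le> a" "b \<le> pi"
  shows "h absolutely_integrable_on {a..b}"
proof -
  have "set_integrable lebesgue per_ivl h"
    using square_integrable_integrable[OF assms(1)] by (simp add: integrable_restrict_space set_integrable_def)
  then have "h absolutely_integrable_on {a<..<b}"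
    by (rule set_integrable_subset) (use assms in auto)
  then show ?thesis by (simp add: absolutely_integrable_on_Icc_iff_Ioo)
qed

lemma absolutely_integrable_bounded_near_0:
  fixes u :: "real \<Rightarrow> complex"
  assumes meas: "u \<in> borel_measurable (lebesgue_on {s..t})"
    and cont: "continuous_on ({s..t} - {0}) u"
    and r: "0 < r" and near: "\<And>x. x \<in> {s..t} \<Longrightarrow> \<bar>x\<bar> \<le> r \<Longrightarrow> cmod (u x) \<le> C * \<bar>x\<bar> powr (-1/2)"
    and C: "0 \<le> C"
  shows "u absolutely_integrable_on {s..t}"
proof -
  obtain B where B: "0 \<le> B" "\<And>x. x \<in> {s..t} \<Longrightarrow> r < \<bar>x\<bar> \<Longrightarrow> cmod (u x) \<le> B"
  proof -
    have "compact ({s..t} - {-r<..<r})" by (intro compact_diff) auto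
    moreover have "continuous_on ({s..t} - {-r<..<r}) u"
      using cont r by (auto elim!: continuous_on_subset)
    ultimately have "bounded (u ` ({s..t} - {-r<..<r}))"
      using compact_continuous_image compact_imp_bounded by blast
    then obtain B where "\<forall>x \<in> {s..t} - {-r<..<r}. cmod (u x) \<le> B"
      by (auto simp: bounded_iff)
    then have "cmod (u x) \<le> max B 0" if "x \<in> {s..t}" "r < \<bar>x\<bar>" for x
      using that by (fastforce simp: le_max_iff_disj)
    then show ?thesis using that[of "max B 0"] by simp
  qed
  define c where "c = max \<bar>s\<bar> \<bar>t\<bar>"
  have pos: "(\<lambda>x. \<bar>x\<bar> powr (-1/2)) integrable_on {0..c}"
    using integrable_on_powr_from_0[of "-1/2" c] by (rule integrable_eq) (auto simp: c_def)
  have "(\<lambda>x. \<bar>-x\<bar> powr (-1/2)) integrable_on {-c..-0}"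
    by (rule Henstock_Kurzweil_Integration.integrable_reflect_real[THEN iffD2, OF pos])
  then have "(\<lambda>x. \<bar>x\<bar> powr (-1/2)) integrable_on {-c..c}"
    using pos by (intro Henstock_Kurzweil_Integration.integrable_combine[of "-c" 0 c]) (simp_all add: c_def)
  then have "(\<lambda>x. \<bar>x\<bar> powr (-1/2)) integrable_on {s..t}"
    by (rule integrable_on_subinterval) (auto simp: c_def)
  then have "(\<lambda>x. B + C * \<bar>x\<bar> powr (-1/2)) integrable_on {s..t}"
    by (intro Henstock_Kurzweil_Integration.integrable_add integrable_on_mult_right) auto
  then show ?thesis
  proof (rule measurable_bounded_by_integrable_imp_absolutely_integrable[OF meas, rotated 1])
    fix x assume x: "x \<in> {s..t}"
    show "cmod (u x) \<le> B + C * \<bar>x\<bar> powr (-1/2)"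
      using near[OF x] B(1) B(2)[OF x] C by (cases "\<bar>x\<bar> \<le> r") (auto intro: add_increasing add_increasing2)
  qed auto
qed

context weight
begin

lemma p_continuous_Icc:
  assumes "-pi < a" "b < pi"
  shows "continuous_on {a..b} (\<lambda>x. complex_of_real (p x))"
  using assms by (intro continuous_on_of_real continuous_at_imp_continuous_on) (auto intro: p_isCont)

lemma ex_primitives:
  assumes h: "square_integrable h"
  obtains H P where "indef_on per_ivl H h" "H 0 = 0"
    "indef_on per_ivl P (\<lambda>x. of_real (p x) * h x)" "P 0 = 0"
proof -
  have abs: "h absolutely_integrable_on {a..b} \<and> (\<lambda>x. of_real (p x) * h x) absolutely_integrable_on {a..b}"
    if "a \<le> b" "{a..b} \<subseteq> per_ivl" for a b
    using that absolutely_integrable_mult_continuous[OF square_integrable_imp_absolutely_integrable[OF h, of a b] p_continuous_Icc[of a b]]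
      square_integrable_imp_absolutely_integrable[OF h, of a b]
    by (auto simp: mult.commute)
  obtain H where H: "indef_on per_ivl H h" "H 0 = 0"
    by (rule indef_on_exists[of per_ivl h 0]) (use abs in \<open>auto simp: is_interval_oo\<close>)
  obtain P where P: "indef_on per_ivl P (\<lambda>x. of_real (p x) * h x)" "P 0 = 0"
    by (rule indef_on_exists[of per_ivl "\<lambda>x. of_real (p x) * h x" 0]) (use abs in \<open>auto simp: is_interval_oo\<close>)
  show ?thesis using that H P by blast
qed

lemma T_0 [simp]: "T h 0 = 0"
proof -
  have "ker 0 = (\<lambda>z. 0)" by (auto simp: ker_def fun_eq_iff)
  then show ?thesis by (simp add: T_def)
qed

text \<open>The quotient \<open>P x / p x\<close> is, up to a constant factor, the flux \<open>W = f
  u'\<close> of the solution.\<close>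

lemma weighted_mean_eq:
  assumes P: "indef_on per_ivl P (\<lambda>x. of_real (p x) * h x)" "P 0 = 0" 
    and x: "x \<in> per_ivl" "x \<noteq> 0"
  defines "k \<equiv> \<lambda>z. if 0 < z \<and> z < x then p z / p x else if x < z \<and> z < 0 then - (p z / p x) else 0"
  shows "P x / of_real (p x) = (\<integral>z. of_real (k z) * h z \<partial>per_measure)"
proof (cases "0 < x")
  case True
  have abs: "(\<lambda>z. of_real (p z) * h z) absolutely_integrable_on {0..x}"
    and int: "integral {0..x} (\<lambda>z. of_real (p z) * h z) = P x"
    using indef_onD[OF P(1), of 0 x] x True P(2) by auto
  have "(\<integral>z. of_real (k z) * h z \<partial>per_measure)
      = (\<integral>z. (of_bool (0 < z \<and> z < x) *\<^sub>R (of_real (p z) * h z)) / of_real (p x) \<partial>per_measure)"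
    using True by (intro Bochner_Integration.integral_cong) (auto simp: k_def)
  also have "\<dots> = P x / of_real (p x)"
    using per_measure_integral_Ioo[OF abs] x int by simp
  finally show ?thesis by simp
next
  case False
  then have x0: "x < 0" using x by simp
  have abs: "(\<lambda>z. of_real (p z) * h z) absolutely_integrable_on {x..0}"
    and int: "integral {x..0} (\<lambda>z. of_real (p z) * h z) = - P x"
    using indef_onD[OF P(1), of x 0] x x0 P(2) by auto
  have "(\<integral>z. of_real (k z) * h z \<partial>per_measure)
      = (\<integral>z. - ((of_bool (x < z \<and> z < 0) *\<^sub>R (of_real (p z) * h z)) / of_real (p x)) \<partial>per_measure)"
    using x0 by (intro Bochner_Integration.integral_cong) (auto simp: k_def)
  also have "\<dots> = P x / of_real (p x)"
    using per_measure_integral_Ioo[OF abs] x int by simp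
  finally show ?thesis by simp
qed

text \<open>Monotonicity of \<open>p\<close> bounds the kernel \<open>p z / p x\<close> by 1, and
  its support has length \<open>\<bar>x\<bar>\<close>. The bound makes \<open>W / f\<close>
  integrable near 0, where \<open>f\<close> vanishes linearly.\<close>

lemma weighted_mean_bound:
  assumes P: "indef_on per_ivl P (\<lambda>x. of_real (p x) * h x)" "P 0 = 0" 
    and x: "x \<in> per_ivl" and h: "square_integrable h"
  shows "cmod (P x / of_real (p x)) \<le> sqrt \<bar>x\<bar> * l2_norm h"
proof (cases "x = 0")
  case False
  define b where "b = (\<lambda>z. of_bool (min 0 x < z \<and> z < max 0 x) *\<^sub>R (1::real))"
  define k where "k = (\<lambda>z. if 0 < z \<and> z < x then p z / p x else if x < z \<and> z < 0 then - (p z / p x) else 0)"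
  have [measurable]: "p \<in> borel_measurable per_measure" "(\<lambda>z. z) \<in> borel_measurable per_measure"
    by (auto intro!: p_measurable continuous_imp_measurable_on_sets_lebesgue)
  have km [measurable]: "k \<in> borel_measurable per_measure"
    unfolding k_def by measurable
  have b_int: "integrable per_measure b" "integral\<^sup>L per_measure b = \<bar>x\<bar>"
    unfolding b_def
    using per_measure_integral_Ioo[of "min 0 x" "max 0 x" "\<lambda>_. 1::real"] x
      absolutely_integrable_continuous_real[OF continuous_on_const, of "min 0 x" "max 0 x" "1::real"]
    by (auto simp: min_def max_def)
  have kb: "\<bar>k z\<bar> \<le> b z" if "z \<in> per_ivl" for z
  proof -
    have "0 < p x" using p_pos x False by auto
    then show ?thesis
      using p_mono[of z x] p_antimono[of x z] p_pos[of z] that x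
      by (auto simp: k_def b_def of_bool_def)
  qed
  have b1: "b z \<le> 1" "0 \<le> b z" "(b z)\<^sup>2 = b z" for z by (auto simp: b_def of_bool_def)
  have k: "square_integrable (\<lambda>z. complex_of_real (k z))"
    using kb b1 order_trans by (intro square_integrable_bounded(1)[where B = 1]) fastforce+
  have "(\<integral>z. (cmod (of_real (k z)))\<^sup>2 \<partial>per_measure) \<le> integral\<^sup>L per_measure b"
  proof (rule integral_mono)
    show "integrable per_measure (\<lambda>z. (cmod (of_real (k z)))\<^sup>2)"
      using k by (simp add: square_integrable_def)
    show "(cmod (of_real (k z)))\<^sup>2 \<le> b z" if "z \<in> space per_measure" for z
      using power_mono[OF kb[of z], of 2] b1[of z] that by (simp add: space_restrict_space)
  qed (rule b_int)
  then have "l2_norm (\<lambda>z. complex_of_real (k z)) \<le> sqrt \<bar>x\<bar>"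
    unfolding l2_norm_def b_int by (rule real_sqrt_le_mono)
  then show ?thesis
    using weighted_mean_eq[OF P x False] Cauchy_Schwarz_per_measure(2)[OF k h]
      mult_right_mono[OF _ l2_norm_nonneg[of h]] unfolding k_def by (metis (no_types, lifting) order_trans)
qed (simp add: p_zero l2_norm_nonneg)

lemma T_eq_primitives:
  assumes H: "indef_on per_ivl H h" "H 0 = 0" and P: "indef_on per_ivl P (\<lambda>x. of_real (p x) * h x)" "P 0 = 0" 
    and h: "square_integrable h" and x: "x \<in> per_ivl"
  shows "T h x = - \<i> * (H x - P x / of_real (p x))"
proof (cases "0 < x")
  case True
  have abs: "h absolutely_integrable_on {0..x}" "(\<lambda>z. of_real (p z) * h z) absolutely_integrable_on {0..x}"
    and int: "integral {0..x} h = H x" "integral {0..x} (\<lambda>z. of_real (p z) * h z) = P x"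
    using indef_onD[OF P(1), of 0 x] indef_onD[OF H(1), of 0 x] x True P(2) H(2) by auto
  have "(\<integral>z. of_real (ker x z) * h z \<partial>per_measure)
      = (\<integral>z. of_bool (0 < z \<and> z < x) *\<^sub>R h z - (of_bool (0 < z \<and> z < x) *\<^sub>R (of_real (p z) * h z)) / of_real (p x) \<partial>per_measure)"
    using True by (intro Bochner_Integration.integral_cong) (auto simp: ker_def algebra_simps)
  also have "\<dots> = H x - P x / of_real (p x)"
    using per_measure_integral_Ioo[OF abs(1)] per_measure_integral_Ioo[OF abs(2)] x int
    by (subst Bochner_Integration.integral_diff) auto
  finally show ?thesis by (simp add: T_def)
next
  case False
  then have x0: "x \<le> 0" using x by simp
  have abs: "h absolutely_integrable_on {x..0}" "(\<lambda>z. of_real (p z) * h z) absolutely_integrable_on {x..0}"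
    and int: "integral {x..0} h = - H x" "integral {x..0} (\<lambda>z. of_real (p z) * h z) = - P x"
    using indef_onD[OF P(1), of x 0] indef_onD[OF H(1), of x 0] x x0 P(2) H(2) by auto
  have "(\<integral>z. of_real (ker x z) * h z \<partial>per_measure)
      = (\<integral>z. (of_bool (x < z \<and> z < 0) *\<^sub>R (of_real (p z) * h z)) / of_real (p x) - of_bool (x < z \<and> z < 0) *\<^sub>R h z \<partial>per_measure)"
    using x0 by (intro Bochner_Integration.integral_cong) (auto simp: ker_def algebra_simps)
  also have "\<dots> = H x - P x / of_real (p x)"
    using per_measure_integral_Ioo[OF abs(1)] per_measure_integral_Ioo[OF abs(2)] x int
    by (subst Bochner_Integration.integral_diff) auto
  finally show ?thesis by (simp add: T_def)
qed

text \<open>The kernels at the two end points differ by 1 for all \<open>z \<noteq> 0\<close>.\<close>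

lemma T_ends:
  assumes h: "square_integrable h"
  shows "T h pi - T h (-pi) = - \<i> * (\<integral>z. h z \<partial>per_measure)"
proof -
  have [measurable]: "h \<in> borel_measurable per_measure" using h by (simp add: square_integrable_def)
  have "T h pi - T h (-pi) = - \<i> * (\<integral>z. of_real (ker pi z) * h z - of_real (ker (-pi) z) * h z \<partial>per_measure)"
    using T_integrable[of pi, OF _ h] T_integrable[of "-pi", OF _ h]
    by (simp add: T_def right_diff_distrib)
  also have "(\<integral>z. of_real (ker pi z) * h z - of_real (ker (-pi) z) * h z \<partial>per_measure) = (\<integral>z. h z \<partial>per_measure)"
  proof (rule integral_cong_AE)
    have "AE z in lebesgue. z \<noteq> (0::real)" by (intro AE_completion AE_lborel_singleton)
    then have "AE z in lebesgue. z \<in> per_ivl \<longrightarrow> of_real (ker pi z) * h z - of_real (ker (-pi) z) * h z = h z"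
      by eventually_elim (auto simp: ker_def p_zero)
    then show "AE z in per_measure. of_real (ker pi z) * h z - of_real (ker (-pi) z) * h z = h z"
      by (simp add: AE_restrict_space_iff)
  qed auto
  finally show ?thesis .
qed

end

section \<open>The differential equation as an integral equation\<close>

context weight
begin

lemma f_nonzero: "x \<in> per_ivl \<Longrightarrow> x \<noteq> 0 \<Longrightarrow> f x \<noteq> 0"
  using f_pos[of x] f_neg[of x] by (cases "0 < x") auto

lemma p_nonzero: "x \<in> per_ivl \<Longrightarrow> x \<noteq> 0 \<Longrightarrow> p x \<noteq> 0"
  using p_pos[of x] by auto

lemma p_indef_on:
  assumes "S \<subseteq> per_ivl - {0}"
  shows "indef_on S (\<lambda>x. of_real (p x)) (\<lambda>x. of_real (p x / (\<epsilon> * f x)))"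
proof (rule indef_on_vector_derivative)
  show "((\<lambda>x. complex_of_real (p x)) has_vector_derivative of_real (p x / (\<epsilon> * f x))) (at x)" if "x \<in> S" for x
  proof -
    have "x \<noteq> 0" "-pi < x" "x < pi" using that assms by auto
    then have "(p has_real_derivative p x / (\<epsilon> * f x)) (at x)" by (rule p_deriv)
    then show ?thesis
      by (intro has_vector_derivative_of_real) (simp flip: has_real_derivative_iff_has_vector_derivative)
  qed
  have "continuous_on S p"
    using assms by (intro continuous_at_imp_continuous_on) (auto intro: p_isCont)
  moreover have "continuous_on S f" using f_cont continuous_on_subset by blast
  ultimately show "continuous_on S (\<lambda>x. complex_of_real (p x / (\<epsilon> * f x)))"
    using eps f_nonzero assms by (intro continuous_intros) (auto simp: subset_iff)
qed

lemma inverse_p_indef_on: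
  assumes "S \<subseteq> per_ivl - {0}"
  shows "indef_on S (\<lambda>x. inverse (of_real (p x))) (\<lambda>x. - inverse (of_real (p x)) / of_real (\<epsilon> * f x))"
proof (rule indef_on_vector_derivative)
  show "((\<lambda>x. inverse (complex_of_real (p x))) has_vector_derivative - inverse (of_real (p x)) / of_real (\<epsilon> * f x)) (at x)"
    if "x \<in> S" for x
  proof -
    have x: "x \<in> per_ivl" "x \<noteq> 0" using that assms by auto
    have "((\<lambda>x. inverse (p x)) has_real_derivative - inverse (p x) / (\<epsilon> * f x)) (at x)"
      using p_nonzero[OF x] x
      by (auto intro!: derivative_eq_intros p_deriv simp: field_simps)
    then have "((\<lambda>x. complex_of_real (inverse (p x))) has_vector_derivative of_real (- inverse (p x) / (\<epsilon> * f x))) (at x)"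
      by (intro has_vector_derivative_of_real) (simp flip: has_real_derivative_iff_has_vector_derivative)
    then show ?thesis by simp
  qed
  have "continuous_on S p"
    using assms by (intro continuous_at_imp_continuous_on) (auto intro: p_isCont)
  moreover have "continuous_on S f" using f_cont continuous_on_subset by blast
  ultimately show "continuous_on S (\<lambda>x. - inverse (complex_of_real (p x)) / complex_of_real (\<epsilon> * f x))"
    using eps f_nonzero p_nonzero assms by (intro continuous_intros) (auto simp: subset_iff)
qed

text \<open>Multiplying by \<open>p\<close> turns the equation into \<open>(p W)' = - \<i> p h /
  \<epsilon>\<close> on each side of 0. The constant of integration vanishes because \<open>p
  W\<close> is continuous with value 0 at 0.\<close>

lemma ode_imp_T:
  assumes U: "indef_on per_ivl U u'" and W: "indef_on per_ivl W w"
    and fu: "AE x in per_measure. of_real (f x) * u' x = W x"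
    and h: "square_integrable h" and hw: "AE x in per_measure. h x = \<i> * of_real \<epsilon> * w x + \<i> * u' x"
  obtains c where "\<And>x. x \<in> per_ivl \<Longrightarrow> x \<noteq> 0 \<Longrightarrow> U x = c + T h x"
proof -
  obtain H P where H: "indef_on per_ivl H h" "H 0 = 0"
    and P: "indef_on per_ivl P (\<lambda>x. of_real (p x) * h x)" "P 0 = 0"
    using ex_primitives[OF h] .
  have cont: "continuous_on per_ivl W" "continuous_on per_ivl P"
    using indef_on_continuous W P(1) by blast+
  have W_eq: "of_real \<epsilon> * (of_real (p x) * W x) = - \<i> * P x" if S: "S = {0<..<pi} \<or> S = {-pi<..<0}" and x: "x \<in> S" for S x
  proof -
    have sub: "S \<subseteq> per_ivl - {0}" "S \<subseteq> per_ivl" and S': "is_interval S" "S \<in> sets lebesgue"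
      using S by (auto simp: is_interval_oo)
    have "indef_on S (\<lambda>x. of_real \<epsilon> * (W x * of_real (p x))) (\<lambda>x. of_real \<epsilon> * (w x * of_real (p x) + W x * of_real (p x / (\<epsilon> * f x))))"
      by (intro indef_on_cmult indef_on_mult p_indef_on sub indef_on_subset[OF W])
    then have A: "indef_on S (\<lambda>x. of_real \<epsilon> * (W x * of_real (p x))) (\<lambda>x. - \<i> * (of_real (p x) * h x))"
    proof (rule indef_on_AE_cong[rotated 2])
      have "AE x in lebesgue. x \<in> per_ivl \<longrightarrow> of_real (f x) * u' x = W x"
           "AE x in lebesgue. x \<in> per_ivl \<longrightarrow> h x = \<i> * of_real \<epsilon> * w x + \<i> * u' x"
        using fu hw by (auto simp: AE_restrict_space_iff)
      then have "AE x in lebesgue. x \<in> S \<longrightarrow> of_real \<epsilon> * (w x * of_real (p x) + W x * of_real (p x / (\<epsilon> * f x)))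
          = - \<i> * (of_real (p x) * h x)"
      proof eventually_elim
        case (elim x)
        show ?case
        proof
          assume "x \<in> S"
          then have x: "x \<in> per_ivl" "x \<noteq> 0" using sub by auto
          then have "W x = of_real (f x) * u' x" "h x = \<i> * of_real \<epsilon> * w x + \<i> * u' x" using elim by auto
          then show "of_real \<epsilon> * (w x * of_real (p x) + W x * of_real (p x / (\<epsilon> * f x))) = - \<i> * (of_real (p x) * h x)"
            using f_nonzero[OF x] eps by (simp add: field_simps)
        qed
      qed
      then show "AE x in lebesgue_on S. of_real \<epsilon> * (w x * of_real (p x) + W x * of_real (p x / (\<epsilon> * f x))) = - \<i> * (of_real (p x) * h x)"
        using S' by (simp add: AE_restrict_space_iff)
    qed (use S' in auto)
    have B: "indef_on S (\<lambda>x. - \<i> * P x) (\<lambda>x. - \<i> * (of_real (p x) * h x))"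
      by (intro indef_on_cmult indef_on_subset[OF P(1) sub(2)])
    define D where "D = (\<lambda>y. of_real \<epsilon> * (W y * of_real (p y)) - (- \<i> * P y))"
    \<comment> \<open>\<open>D\<close> is constant on \<open>S\<close> and continuous at 0, where it vanishes.\<close>
    have const: "D y = D x" if "y \<in> S" for y
      unfolding D_def by (rule indef_on_unique[OF A B S'(1) that x])
    have "continuous_on per_ivl p"
      by (intro continuous_at_imp_continuous_on) (auto intro: p_isCont)
    then have "continuous_on per_ivl D"
      unfolding D_def using cont by (intro continuous_intros)
    then have "(D \<longlongrightarrow> D 0) (at 0 within per_ivl)"
      unfolding continuous_on_def by simp
    then have "(D \<longlongrightarrow> D 0) (at 0 within S)"
      by (rule tendsto_within_subset[OF _ sub(2)])
    moreover have "\<forall>\<^sub>F y in at 0 within S. D x = D y"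
      unfolding eventually_at_filter using const by (intro always_eventually) metis
    then have "(D \<longlongrightarrow> D x) (at 0 within S)"
      by (rule Lim_transform_eventually[OF tendsto_const])
    moreover have "S - {0} = S" "0 \<in> closure S" using S by auto
    then have "at 0 within S \<noteq> bot"
      using trivial_limit_within[of 0 S] by (simp add: islimpt_in_closure)
    ultimately have "D x = D 0"
      using tendsto_unique by blast
    then show ?thesis by (simp add: D_def p_zero P(2) mult.commute eq_neg_iff_add_eq_0)
  qed
  have "indef_on per_ivl (\<lambda>x. \<i> * of_real \<epsilon> * W x + \<i> * U x) h"
    by (rule indef_on_AE_cong[OF _ _ indef_on_add[OF indef_on_cmult[OF W] indef_on_cmult[OF U]]])
       (use hw in \<open>auto elim: eventually_mono\<close>)
  then have const: "\<i> * of_real \<epsilon> * W x + \<i> * U x - H x = \<i> * of_real \<epsilon> * W 0 + \<i> * U 0 - H 0" if "x \<in> per_ivl" for x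
    using indef_on_unique[OF _ H(1) _ that, of _ 0] by (auto simp: is_interval_oo)
  show ?thesis
  proof (rule that)
    fix x assume x: "x \<in> per_ivl" "x \<noteq> 0"
    have "of_real \<epsilon> * (of_real (p x) * W x) = - \<i> * P x"
      using W_eq[of "{0<..<pi}" x] W_eq[of "{-pi<..<0}" x] x by (cases "0 < x") auto
    then have "of_real \<epsilon> * W x = - \<i> * (P x / of_real (p x))"
      using p_nonzero[OF x] by (simp add: field_simps)
    moreover have "U x = - \<i> * H x - of_real \<epsilon> * W x - \<i> * (\<i> * of_real \<epsilon> * W 0 + \<i> * U 0 - H 0)"
      using const[OF x(1)] by (simp add: algebra_simps complex_eq_iff)
    ultimately show "U x = - \<i> * (\<i> * of_real \<epsilon> * W 0 + \<i> * U 0 - H 0) + T h x"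
      unfolding T_eq_primitives[OF H P h x(1)] by (simp add: algebra_simps)
  qed
qed

text \<open>The converse. The function \<open>W\<close> is continuous at 0 and \<open>u' = W /
  f\<close> is integrable there, so the equation holds in the weak sense across 0 as well.\<close>

lemma T_imp_ode:
  assumes h: "square_integrable h"
  obtains u' W w where "indef_on per_ivl (T h) u'" "indef_on per_ivl W w"
    "\<And>x. x \<in> per_ivl \<Longrightarrow> of_real (f x) * u' x = W x"
    "\<And>x. h x = \<i> * of_real \<epsilon> * w x + \<i> * u' x"
proof -
  obtain H P where H: "indef_on per_ivl H h" "H 0 = 0"
    and P: "indef_on per_ivl P (\<lambda>x. of_real (p x) * h x)" "P 0 = 0"
    using ex_primitives[OF h] .
  define W where "W = (\<lambda>x. - \<i> / of_real \<epsilon> * (P x / of_real (p x)))"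
  define u' where "u' = (\<lambda>x. W x / of_real (f x))"
  define w where "w = (\<lambda>x. - \<i> / of_real \<epsilon> * h x - u' x / of_real \<epsilon>)"
  have W0: "W 0 = 0" by (simp add: W_def p_zero)
  have W_side: "indef_on S W w" if S: "S = {0<..<pi} \<or> S = {-pi<..<0}" for S
  proof -
    have sub: "S \<subseteq> per_ivl - {0}" "S \<subseteq> per_ivl" using S by auto
    have "indef_on S (\<lambda>x. - \<i> / of_real \<epsilon> * (P x * inverse (of_real (p x))))
      (\<lambda>x. - \<i> / of_real \<epsilon> * (of_real (p x) * h x * inverse (of_real (p x)) + P x * (- inverse (of_real (p x)) / of_real (\<epsilon> * f x))))"
      by (intro indef_on_cmult indef_on_mult inverse_p_indef_on sub indef_on_subset[OF P(1)])
    then show ?thesis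
    proof (rule indef_on_cong[rotated 2])
      fix x assume "x \<in> S"
      then have x: "x \<in> per_ivl" "x \<noteq> 0" using sub by auto
      show "- \<i> / of_real \<epsilon> * (P x * inverse (of_real (p x))) = W x"
        by (simp add: W_def divide_inverse)
      show "- \<i> / of_real \<epsilon> * (of_real (p x) * h x * inverse (of_real (p x)) + P x * (- inverse (of_real (p x)) / of_real (\<epsilon> * f x))) = w x"
        using p_nonzero[OF x] f_nonzero[OF x] eps by (simp add: w_def u'_def W_def field_simps)
    qed
  qed
  have Wb: "cmod (W x) \<le> 1 / \<epsilon> * (sqrt \<bar>x\<bar> * l2_norm h)" if "x \<in> per_ivl" for x
  proof -
    have "cmod (W x) = 1 / \<epsilon> * cmod (P x / of_real (p x))"
      using eps by (simp add: W_def norm_mult norm_divide)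
    then show ?thesis
      using weighted_mean_bound[OF P that h] eps by (simp add: divide_right_mono)
  qed
  have "isCont W 0"
  proof -
    have "((\<lambda>x. 1 / \<epsilon> * (sqrt \<bar>x\<bar> * l2_norm h)) \<longlongrightarrow> 1 / \<epsilon> * (sqrt \<bar>0\<bar> * l2_norm h)) (at 0)"
      by (intro tendsto_intros)
    then have "((\<lambda>x. 1 / \<epsilon> * (sqrt \<bar>x\<bar> * l2_norm h)) \<longlongrightarrow> 0) (at 0)" by simp
    moreover have "\<forall>\<^sub>F x in at 0. cmod (W x) \<le> 1 / \<epsilon> * (sqrt \<bar>x\<bar> * l2_norm h)"
      using eventually_at_in_open'[of per_ivl 0] by (rule eventually_mono) (use Wb in auto)
    ultimately have "(W \<longlongrightarrow> 0) (at 0)" by (rule Lim_null_comparison[rotated])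
    then show ?thesis by (simp add: isCont_def W0)
  qed
  obtain m r where m: "0 < m" and r: "0 < r" and fl: "\<And>x. \<bar>x\<bar> \<le> r \<Longrightarrow> m * \<bar>x\<bar> \<le> \<bar>f x\<bar>"
    using f_lower by blast
  have u_cont: "continuous_on (per_ivl - {0}) u'"
  proof -
    have "continuous_on (per_ivl - {0}) W"
    proof (rule continuous_on_subset)
      have "continuous_on ({0<..<pi} \<union> {-pi<..<0}) W"
        by (intro continuous_on_open_Un indef_on_continuous[OF W_side]) auto
      then show "continuous_on ({0<..<pi} \<union> {-pi<..<0}) W" .
    qed auto
    moreover have "continuous_on (per_ivl - {0}) f" using f_cont continuous_on_subset by blast
    ultimately show ?thesis
      unfolding u'_def using f_nonzero by (intro continuous_intros) auto
  qed
  have u_near: "cmod (u' x) \<le> l2_norm h / (\<epsilon> * m) * \<bar>x\<bar> powr (-1/2)" if "x \<in> per_ivl" "\<bar>x\<bar> \<le> r" for x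
  proof (cases "x = 0")
    case False
    have "cmod (u' x) = cmod (W x) / \<bar>f x\<bar>" by (simp add: u'_def norm_divide)
    also have "\<dots> \<le> 1 / \<epsilon> * (sqrt \<bar>x\<bar> * l2_norm h) / (m * \<bar>x\<bar>)"
      using Wb[OF that(1)] fl[OF that(2)] m False eps by (intro frac_le) (auto simp: l2_norm_nonneg)
    also have "\<dots> = l2_norm h / (\<epsilon> * m) * (sqrt \<bar>x\<bar> / \<bar>x\<bar>)" by (simp add: mult_ac)
    also have "sqrt \<bar>x\<bar> / \<bar>x\<bar> = \<bar>x\<bar> powr (-1/2)"
      using powr_minus[of "\<bar>x\<bar>" "1/2"] by (simp add: powr_half_sqrt sqrt_divide_self_eq)
    finally show ?thesis .
  qed (simp add: u'_def W0)
  have u_int: "u' absolutely_integrable_on {s..t}" if st: "-pi < s" "s \<le> t" "t < pi" for s t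
  proof (rule absolutely_integrable_bounded_near_0[OF _ _ r])
    show "continuous_on ({s..t} - {0}) u'"
      using st by (intro continuous_on_subset[OF u_cont]) auto
    have "continuous_on {s..t} P"
      using st by (intro indef_on_continuous_Icc[OF P(1)]) auto
    moreover have "continuous_on {s..t} (\<lambda>x. complex_of_real (f x))"
      using f_cont continuous_on_subset by (intro continuous_on_of_real) blast
    ultimately have [measurable]: "P \<in> borel_measurable (lebesgue_on {s..t})"
      "(\<lambda>x. complex_of_real (p x)) \<in> borel_measurable (lebesgue_on {s..t})"
      "(\<lambda>x. complex_of_real (f x)) \<in> borel_measurable (lebesgue_on {s..t})"
      using p_continuous_Icc[of s t] st by (auto intro!: continuous_imp_measurable_on_sets_lebesgue)
    show "u' \<in> borel_measurable (lebesgue_on {s..t})"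
      unfolding u'_def W_def by measurable
    show "cmod (u' x) \<le> l2_norm h / (\<epsilon> * m) * \<bar>x\<bar> powr (-1/2)" if "x \<in> {s..t}" "\<bar>x\<bar> \<le> r" for x
      using that st by (intro u_near) auto
    show "0 \<le> l2_norm h / (\<epsilon> * m)" using eps m by (simp add: l2_norm_nonneg)
  qed
  have W: "indef_on per_ivl W w"
  proof (rule indef_on_glue[OF W_side W_side _ _ \<open>isCont W 0\<close>])
    fix s t :: real assume st: "-pi < s" "s \<le> t" "t < pi"
    have "h absolutely_integrable_on {s..t}"
      using st by (intro square_integrable_imp_absolutely_integrable[OF h]) auto
    then show "w absolutely_integrable_on {s..t}"
      unfolding w_def by (intro set_integral_diff(1) set_integrable_mult_right set_integrable_divide u_int st) auto
  qed auto
  have "indef_on per_ivl (\<lambda>x. - \<i> * H x - of_real \<epsilon> * W x) (\<lambda>x. - \<i> * h x - of_real \<epsilon> * w x)"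
    by (intro indef_on_diff indef_on_cmult H(1) W)
  then have "indef_on per_ivl (T h) u'"
  proof (rule indef_on_cong[rotated 2])
    fix x assume x: "x \<in> per_ivl"
    show "- \<i> * H x - of_real \<epsilon> * W x = T h x"
      using eps unfolding T_eq_primitives[OF H P h x] W_def by (simp add: algebra_simps)
    show "- \<i> * h x - of_real \<epsilon> * w x = u' x"
      using eps by (simp add: w_def algebra_simps)
  qed
  then show ?thesis
  proof (rule that[OF _ W])
    show "of_real (f x) * u' x = W x" if "x \<in> per_ivl" for x
      using f_nonzero[OF that] by (cases "x = 0") (auto simp: u'_def W0 f_zero)
    show "h x = \<i> * of_real \<epsilon> * w x + \<i> * u' x" for x
      using eps by (simp add: w_def algebra_simps)
  qed
qed

end

section \<open>The resolvent equation\<close>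

lemma Lmax_graph_unique:
  assumes "Lmax_graph \<epsilon> f u k" "Lmax_graph \<epsilon> f u k'"
  shows "k = k'"
proof (rule l2_eqI)
  obtain u1 w1 where 1: "has_weak_derivative (rep_l2 u) u1"
    "has_weak_derivative (\<lambda>x. of_real (f x) * u1 x) w1"
    "AE x in per_measure. rep_l2 k x = \<i> * of_real \<epsilon> * w1 x + \<i> * u1 x"
    using assms(1) by (auto simp: Lmax_graph_def)
  obtain u2 w2 where 2: "has_weak_derivative (rep_l2 u) u2"
    "has_weak_derivative (\<lambda>x. of_real (f x) * u2 x) w2"
    "AE x in per_measure. rep_l2 k' x = \<i> * of_real \<epsilon> * w2 x + \<i> * u2 x"
    using assms(2) by (auto simp: Lmax_graph_def)
  have u: "AE x in per_measure. u1 x = u2 x"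
    by (rule has_weak_derivative_unique[OF 1(1) 2(1)]) simp
  have "AE x in per_measure. w1 x = w2 x"
    by (rule has_weak_derivative_unique[OF 1(2) 2(2)]) (use u in \<open>auto elim: eventually_mono\<close>)
  with u 1(3) 2(3) show "AE x in per_measure. rep_l2 k x = rep_l2 k' x"
    by eventually_elim simp
qed

lemma Lper_eqI: "Lmax_graph \<epsilon> f u k \<Longrightarrow> Lper \<epsilon> f u = k"
  unfolding Lper_def using Lmax_graph_unique by blast

context weight
begin

text \<open>The resolvent equation for the class \<open>u\<close> and the right hand side
  \<open>g\<close> as an integral equation for the continuous representative \<open>v\<close> of
  \<open>u\<close>: \<open>v = c + T (g + \<mu> v)\<close> together with the periodic boundary
  condition \<open>\<integral> (g + \<mu> v) = 0\<close>.\<close>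

definition solves :: "complex \<Rightarrow> l2 \<Rightarrow> l2 \<Rightarrow> (real \<Rightarrow> complex) \<Rightarrow> complex \<Rightarrow> bool"
  where "solves \<mu> u g v c \<longleftrightarrow> continuous_on {-pi..pi} v \<and> (AE x in per_measure. rep_l2 u x = v x) \<and>
    (\<forall>x\<in>{-pi..pi}. v x = c + T (rep_l2 g) x + \<mu> * T v x) \<and>
    (\<integral>z. rep_l2 g z \<partial>per_measure) + \<mu> * (\<integral>z. v z \<partial>per_measure) = 0"

lemma rhs_square_integrable:
  assumes "continuous_on {-pi..pi} v"
  shows "square_integrable (\<lambda>z. rep_l2 g z + \<mu> * v z)"
  using assms by (auto intro!: square_integrable_add square_integrable_mult intro: square_integrable_continuous)

lemma T_split:
  assumes "x \<in> {-pi..pi}" "continuous_on {-pi..pi} v"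
  shows "T (\<lambda>z. rep_l2 g z + \<mu> * v z) x = T (rep_l2 g) x + \<mu> * T v x"
  using T_add[OF assms(1) square_integrable_rep_l2 square_integrable_mult[OF square_integrable_continuous[OF assms(2)]]]
  by (simp add: T_cmult)

lemma integral_split:
  assumes "continuous_on {-pi..pi} v"
  shows "(\<integral>z. rep_l2 g z + \<mu> * v z \<partial>per_measure) = (\<integral>z. rep_l2 g z \<partial>per_measure) + \<mu> * (\<integral>z. v z \<partial>per_measure)"
  using square_integrable_integrable[OF square_integrable_rep_l2[of g]]
    square_integrable_integrable[OF square_integrable_continuous[OF assms]]
  by simp

lemma Lmax_graph_imp_solves:
  assumes L: "Lmax_graph \<epsilon> f u (g + l2_scale \<mu> u)" and bc: "periodic_bc u"
  obtains v c where "solves \<mu> u g v c"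
proof -
  obtain v where v: "continuous_on {-pi..pi} v" "AE x in per_measure. rep_l2 u x = v x" "v (-pi) = v pi"
    using bc by (auto simp: periodic_bc_def)
  obtain u' w where u': "has_weak_derivative (rep_l2 u) u'"
    and w: "has_weak_derivative (\<lambda>x. of_real (f x) * u' x) w"
    and eq: "AE x in per_measure. rep_l2 (g + l2_scale \<mu> u) x = \<i> * of_real \<epsilon> * w x + \<i> * u' x"
    using L by (auto simp: Lmax_graph_def)
  define h where "h = (\<lambda>z. rep_l2 g z + \<mu> * v z)"
  have h: "square_integrable h"
    unfolding h_def by (rule rhs_square_integrable[OF v(1)])
  have h_eq: "AE x in per_measure. h x = \<i> * of_real \<epsilon> * w x + \<i> * u' x"
    using eq rep_l2_add[of g "l2_scale \<mu> u"] rep_l2_scale[of \<mu> u] v(2) by eventually_elim (simp add: h_def)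
  obtain U where U: "indef_on per_ivl U u'" "AE x in per_measure. rep_l2 u x = U x"
    using has_weak_derivative_imp_indef_on[OF u'] .
  obtain W where W: "indef_on per_ivl W w" "AE x in per_measure. of_real (f x) * u' x = W x"
    using has_weak_derivative_imp_indef_on[OF w] .
  obtain c where c: "\<And>x. x \<in> per_ivl \<Longrightarrow> x \<noteq> 0 \<Longrightarrow> U x = c + T h x"
    using ode_imp_T[OF U(1) W(1) W(2) h h_eq] by blast
  have "AE x in per_measure. v x = c + T h x"
  proof -
    have "AE z in lebesgue. z \<noteq> (0::real)" by (intro AE_completion AE_lborel_singleton)
    moreover have "AE x in lebesgue. x \<in> per_ivl \<longrightarrow> rep_l2 u x = v x"
      "AE x in lebesgue. x \<in> per_ivl \<longrightarrow> rep_l2 u x = U x"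
      using v(2) U(2) by (simp_all add: AE_restrict_space_iff)
    ultimately have "AE x in lebesgue. x \<in> per_ivl \<longrightarrow> v x = c + T h x"
      by eventually_elim (use c in auto)
    then show ?thesis by (simp add: AE_restrict_space_iff)
  qed
  then have v_eq: "v x = c + T h x" if "x \<in> {-pi..pi}" for x
    using that by (intro AE_eq_imp_eq_Icc[of "-pi" pi v "\<lambda>x. c + T h x"] v continuous_intros T_continuous h) auto
  have "T h pi - T h (-pi) = 0"
    using v_eq[of pi] v_eq[of "-pi"] v(3) by simp
  then have "(\<integral>z. h z \<partial>per_measure) = 0"
    using T_ends[OF h] by simp
  then have "solves \<mu> u g v c"
    unfolding solves_def using v v_eq T_split[OF _ v(1)] integral_split[OF v(1)]
    by (simp add: h_def add.assoc)
  then show ?thesis by (rule that)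
qed

lemma solves_imp_Lmax_graph:
  assumes "solves \<mu> u g v c"
  shows "Lmax_graph \<epsilon> f u (g + l2_scale \<mu> u)" "periodic_bc u"
proof -
  have v: "continuous_on {-pi..pi} v" "AE x in per_measure. rep_l2 u x = v x"
    using assms by (auto simp: solves_def)
  define h where "h = (\<lambda>z. rep_l2 g z + \<mu> * v z)"
  have h: "square_integrable h"
    unfolding h_def by (rule rhs_square_integrable[OF v(1)])
  have v_eq: "v x = c + T h x" if "x \<in> {-pi..pi}" for x
    using assms that T_split[OF that v(1)] by (simp add: solves_def h_def add.assoc)
  have "(\<integral>z. h z \<partial>per_measure) = 0"
    using assms integral_split[OF v(1)] by (simp add: solves_def h_def)
  then have "T h pi = T h (-pi)" using T_ends[OF h] by simp
  then have "v (-pi) = v pi" using v_eq by simp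
  then show "periodic_bc u" using v by (auto simp: periodic_bc_def)
  obtain u' W w where uW: "indef_on per_ivl (T h) u'" "indef_on per_ivl W w"
    and fu: "\<And>x. x \<in> per_ivl \<Longrightarrow> of_real (f x) * u' x = W x"
    and hw: "\<And>x. h x = \<i> * of_real \<epsilon> * w x + \<i> * u' x"
    using T_imp_ode[OF h] by blast
  have U: "indef_on per_ivl (\<lambda>x. c + T h x) u'"
    using indef_on_add[OF indef_on_const[of _ c] uW(1)] by simp
  have "AE x in per_measure. rep_l2 u x = c + T h x"
  proof -
    have "AE x in lebesgue. x \<in> per_ivl \<longrightarrow> rep_l2 u x = v x"
      using v(2) by (simp add: AE_restrict_space_iff)
    then have "AE x in lebesgue. x \<in> per_ivl \<longrightarrow> rep_l2 u x = c + T h x"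
      by eventually_elim (use v_eq in auto)
    then show ?thesis by (simp add: AE_restrict_space_iff)
  qed
  then have "has_weak_derivative (rep_l2 u) u'"
    by (rule indef_on_imp_has_weak_derivative[OF U])
  moreover have "has_weak_derivative (\<lambda>x. of_real (f x) * u' x) w"
    by (rule indef_on_imp_has_weak_derivative[OF uW(2)]) (auto intro!: AE_I2 simp: fu space_restrict_space)
  moreover have "AE x in per_measure. rep_l2 (g + l2_scale \<mu> u) x = \<i> * of_real \<epsilon> * w x + \<i> * u' x"
    using rep_l2_add[of g "l2_scale \<mu> u"] rep_l2_scale[of \<mu> u] v(2)
  proof eventually_elim
    case (elim x)
    then show ?case using hw[of x] by (simp add: h_def)
  qed
  ultimately show "Lmax_graph \<epsilon> f u (g + l2_scale \<mu> u)"
    unfolding Lmax_graph_def by blast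
qed

lemma Lper_shift_eq_iff_solves:
  "u \<in> Lper_dom \<epsilon> f \<and> Lper_shift \<epsilon> f \<mu> u = g \<longleftrightarrow> (\<exists>v c. solves \<mu> u g v c)"
proof
  assume u: "u \<in> Lper_dom \<epsilon> f \<and> Lper_shift \<epsilon> f \<mu> u = g"
  then obtain k where k: "Lmax_graph \<epsilon> f u k" and bc: "periodic_bc u"
    by (auto simp: Lper_dom_def)
  have "Lper \<epsilon> f u = k" using Lper_eqI[OF k] .
  then have "k = g + l2_scale \<mu> u" using u by (auto simp: Lper_shift_def)
  then show "\<exists>v c. solves \<mu> u g v c"
    using Lmax_graph_imp_solves k bc by blast
next
  assume "\<exists>v c. solves \<mu> u g v c"
  then have k: "Lmax_graph \<epsilon> f u (g + l2_scale \<mu> u)" "periodic_bc u"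
    using solves_imp_Lmax_graph by blast+
  then show "u \<in> Lper_dom \<epsilon> f \<and> Lper_shift \<epsilon> f \<mu> u = g"
    using Lper_eqI[OF k(1)] by (auto simp: Lper_dom_def Lper_shift_def)
qed

end

section \<open>Solvability and compactness of the resolvent\<close>

text \<open>A set in which every sequence has a subsequence that converges in the ambient space is
  relatively compact; completeness of the space is not needed.\<close>

lemma compact_closure_if_convergent_subseq:
  fixes S :: "'a::metric_space set"
  assumes "\<And>y. (\<And>n. y n \<in> S) \<Longrightarrow> \<exists>l r. strict_mono (r :: nat \<Rightarrow> nat) \<and> (y \<circ> r) \<longlonglongrightarrow> l"
  shows "compact (closure S)"
  unfolding compact_eq_seq_compact_metric seq_compact_def
proof (intro allI impI)
  fix x :: "nat \<Rightarrow> 'a" assume x: "\<forall>n. x n \<in> closure S"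
  have "\<exists>y\<in>S. dist y (x n) < inverse (real (Suc n))" for n
    using x closure_approachable[of "x n" S] by auto
  then obtain y where y: "\<And>n. y n \<in> S" "\<And>n. dist (y n) (x n) < inverse (real (Suc n))"
    by metis
  obtain l r where r: "strict_mono r" "(y \<circ> r) \<longlonglongrightarrow> l"
    using assms[of y] y(1) by blast
  have "(\<lambda>n. dist (y n) (x n)) \<longlonglongrightarrow> 0"
    by (rule tendsto_sandwich[OF _ _ tendsto_const LIMSEQ_inverse_real_of_nat])
       (use y(2) in \<open>auto intro: less_imp_le always_eventually\<close>)
  then have "(\<lambda>n. dist (y (r n)) (x (r n))) \<longlonglongrightarrow> 0"
    using LIMSEQ_subseq_LIMSEQ[OF _ r(1)] unfolding comp_def by blast
  moreover have "(\<lambda>n. dist (y (r n)) l) \<longlonglongrightarrow> 0"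
    by (rule iffD1[OF tendsto_dist_iff r(2)[unfolded comp_def]])
  ultimately have "(\<lambda>n. dist (y (r n)) (x (r n)) + dist (y (r n)) l) \<longlonglongrightarrow> 0"
    by (rule tendsto_add_zero)
  then have "(\<lambda>n. dist (x (r n)) l) \<longlonglongrightarrow> 0"
    by (rule tendsto_sandwich[OF _ _ tendsto_const, rotated 2])
       (auto intro: always_eventually simp: dist_triangle3)
  then have "(x \<circ> r) \<longlonglongrightarrow> l"
    unfolding comp_def by (rule iffD2[OF tendsto_dist_iff])
  moreover have "l \<in> closure S"
    using r(2) y(1) by (auto simp: closure_sequential intro!: exI[of _ "y \<circ> r"])
  ultimately show "\<exists>l\<in>closure S. \<exists>r. strict_mono r \<and> (x \<circ> r) \<longlonglongrightarrow> l"
    using r(1) by blast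
qed

lemma rep_l2_measurable [measurable]: "rep_l2 g \<in> borel_measurable per_measure"
  using square_integrable_rep_l2[of g] by (simp add: square_integrable_def)

lemma integral_per_measure_bound:
  assumes "square_integrable h"
  shows "cmod (\<integral>z. h z \<partial>per_measure) \<le> sqrt (2 * pi) * l2_norm h"
proof -
  have "l2_norm (\<lambda>_. 1) \<le> sqrt (2 * pi) * 1"
    by (rule square_integrable_bounded(2)) auto
  then show ?thesis
    using Cauchy_Schwarz_per_measure(2)[OF square_integrable_continuous[of "\<lambda>_. 1"] assms]
      mult_right_mono[OF _ l2_norm_nonneg[of h], of "l2_norm (\<lambda>_. 1)" "sqrt (2 * pi)"] by simp
qed

lemma l2_norm_continuous_le:
  assumes "continuous_on {-pi..pi} v" "\<And>x. x \<in> {-pi..pi} \<Longrightarrow> cmod (v x) \<le> V"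
  shows "l2_norm v \<le> sqrt (2 * pi) * V"
  using assms square_integrable_continuous[OF assms(1)]
  by (intro square_integrable_bounded(2)) (auto simp: square_integrable_def)

context weight
begin

lemma T_rep_zero: "T (rep_l2 0) x = 0"
proof -
  have "T (rep_l2 0) x = T (\<lambda>_. 0) x"
    by (intro T_cong_AE rep_l2_zero) measurable
  then show ?thesis by (simp add: T_def)
qed

lemma integral_rep_zero: "(\<integral>z. rep_l2 0 z \<partial>per_measure) = 0"
proof -
  have "(\<integral>z. rep_l2 0 z \<partial>per_measure) = (\<integral>z. 0 \<partial>per_measure)"
    by (intro integral_cong_AE rep_l2_zero) measurable
  then show ?thesis by simp
qed

lemma T_rep_add:
  assumes "x \<in> {-pi..pi}"
  shows "T (rep_l2 (g + g')) x = T (rep_l2 g) x + T (rep_l2 g') x"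
proof -
  have "T (rep_l2 (g + g')) x = T (\<lambda>z. rep_l2 g z + rep_l2 g' z) x"
    by (intro T_cong_AE rep_l2_add) measurable
  then show ?thesis using T_add[OF assms] by simp
qed

lemma T_rep_scale: "T (rep_l2 (l2_scale k g)) x = k * T (rep_l2 g) x"
proof -
  have "T (rep_l2 (l2_scale k g)) x = T (\<lambda>z. k * rep_l2 g z) x"
    by (intro T_cong_AE rep_l2_scale) measurable
  then show ?thesis by (simp add: T_cmult)
qed

lemma integral_rep_add:
  "(\<integral>z. rep_l2 (g + g') z \<partial>per_measure) = (\<integral>z. rep_l2 g z \<partial>per_measure) + (\<integral>z. rep_l2 g' z \<partial>per_measure)"
proof -
  have "(\<integral>z. rep_l2 (g + g') z \<partial>per_measure) = (\<integral>z. rep_l2 g z + rep_l2 g' z \<partial>per_measure)"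
    by (intro integral_cong_AE rep_l2_add) measurable
  then show ?thesis by (simp add: square_integrable_integrable)
qed

lemma integral_rep_scale:
  "(\<integral>z. rep_l2 (l2_scale k g) z \<partial>per_measure) = k * (\<integral>z. rep_l2 g z \<partial>per_measure)"
proof -
  have "(\<integral>z. rep_l2 (l2_scale k g) z \<partial>per_measure) = (\<integral>z. k * rep_l2 g z \<partial>per_measure)"
    by (intro integral_cong_AE rep_l2_scale) measurable
  then show ?thesis by simp
qed

lemma solvesD:
  assumes "solves \<mu> u g v c"
  shows "continuous_on {-pi..pi} v" "AE x in per_measure. rep_l2 u x = v x"
    "\<And>x. x \<in> {-pi..pi} \<Longrightarrow> v x = c + T (rep_l2 g) x + \<mu> * T v x"
    "(\<integral>z. rep_l2 g z \<partial>per_measure) + \<mu> * (\<integral>z. v z \<partial>per_measure) = 0"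
  using assms by (auto simp: solves_def)

lemma solves_add:
  assumes "solves \<mu> u g v c" "solves \<mu> u' g' v' c'"
  shows "solves \<mu> (u + u') (g + g') (\<lambda>x. v x + v' x) (c + c')"
proof -
  note 1 = solvesD[OF assms(1)] and 2 = solvesD[OF assms(2)]
  have sq: "square_integrable v" "square_integrable v'"
    using 1(1) 2(1) square_integrable_continuous by auto
  show ?thesis
    unfolding solves_def
  proof (intro conjI ballI)
    show "continuous_on {-pi..pi} (\<lambda>x. v x + v' x)" using 1(1) 2(1) by (intro continuous_intros)
    show "AE x in per_measure. rep_l2 (u + u') x = v x + v' x"
      using rep_l2_add[of u u'] 1(2) 2(2) by eventually_elim simp
    show "v x + v' x = c + c' + T (rep_l2 (g + g')) x + \<mu> * T (\<lambda>x. v x + v' x) x" if "x \<in> {-pi..pi}" for x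
      using 1(3)[OF that] 2(3)[OF that] T_add[OF that sq] T_rep_add[OF that] by (simp add: distrib_left)
    show "(\<integral>z. rep_l2 (g + g') z \<partial>per_measure) + \<mu> * (\<integral>z. v z + v' z \<partial>per_measure) = 0"
      using 1(4) 2(4) sq integral_rep_add
      by (simp add: square_integrable_integrable distrib_left add_eq_0_iff2 add_eq_0_iff)
  qed
qed

lemma solves_scale:
  assumes "solves \<mu> u g v c"
  shows "solves \<mu> (l2_scale k u) (l2_scale k g) (\<lambda>x. k * v x) (k * c)"
proof -
  note 1 = solvesD[OF assms(1)]
  show ?thesis
    unfolding solves_def
  proof (intro conjI ballI)
    show "continuous_on {-pi..pi} (\<lambda>x. k * v x)" using 1(1) by (intro continuous_intros)
    show "AE x in per_measure. rep_l2 (l2_scale k u) x = k * v x"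
      using rep_l2_scale[of k u] 1(2) by eventually_elim simp
    show "k * v x = k * c + T (rep_l2 (l2_scale k g)) x + \<mu> * T (\<lambda>x. k * v x) x" if "x \<in> {-pi..pi}" for x
    proof -
      have "k * v x = k * (c + T (rep_l2 g) x + \<mu> * T v x)" using 1(3)[OF that] by simp
      then show ?thesis by (simp add: T_rep_scale T_cmult algebra_simps)
    qed
    have "k * ((\<integral>z. rep_l2 g z \<partial>per_measure) + \<mu> * (\<integral>z. v z \<partial>per_measure)) = 0" using 1(4) by simp
    then show "(\<integral>z. rep_l2 (l2_scale k g) z \<partial>per_measure) + \<mu> * (\<integral>z. k * v z \<partial>per_measure) = 0"
      by (simp add: integral_rep_scale algebra_simps)
  qed
qed

lemma eigenvalue_if_solves_zero:
  assumes "solves \<mu> u 0 v c" "u \<noteq> 0"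
  shows "eigenvalue_Lper \<epsilon> f \<mu>"
proof -
  have "u \<in> Lper_dom \<epsilon> f" "Lper_shift \<epsilon> f \<mu> u = 0"
    using Lper_shift_eq_iff_solves assms(1) by blast+
  then show ?thesis using assms(2) by (auto simp: eigenvalue_Lper_def Lper_shift_def)
qed

lemma solves_unique:
  assumes "\<not> eigenvalue_Lper \<epsilon> f \<mu>" "solves \<mu> u g v c" "solves \<mu> u' g v' c'"
  shows "u = u'"
proof -
  have minus: "k + l2_scale (-1) k' = 0 \<longleftrightarrow> k = k'" for k k'
  proof -
    have *: "AE x in per_measure. rep_l2 (k + l2_scale (-1) k') x = rep_l2 (k - k') x"
      using rep_l2_add[of k "l2_scale (-1) k'"] rep_l2_scale[of "-1" k'] rep_l2_diff[of k k']
      by eventually_elim simp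
    show ?thesis using l2_eqI[OF *] by simp
  qed
  have "solves \<mu> (u + l2_scale (-1) u') (g + l2_scale (-1) g) (\<lambda>x. v x + (-1) * v' x) (c + (-1) * c')"
    by (intro solves_add solves_scale assms)
  then show ?thesis
    using eigenvalue_if_solves_zero assms(1) minus by metis
qed

text \<open>If the integral were 0, \<open>e\<close> would solve the homogeneous resolvent
  equation.\<close>

lemma ex_unit_solution:
  assumes "\<not> eigenvalue_Lper \<epsilon> f \<mu>"
  obtains e where "continuous_on {-pi..pi} e" "\<And>x. x \<in> {-pi..pi} \<Longrightarrow> e x = 1 + \<mu> * T e x"
    "\<mu> * (\<integral>z. e z \<partial>per_measure) \<noteq> 0"
proof -
  obtain e where e: "continuous_on {-pi..pi} e" "\<And>x. x \<in> {-pi..pi} \<Longrightarrow> e x = 1 + \<mu> * T e x"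
    using volterra_exists[of "\<lambda>_. 1" \<mu>] by (auto intro: continuous_on_const)
  have rep: "AE x in per_measure. rep_l2 (abs_l2 e) x = e x"
    by (rule rep_abs_l2[OF square_integrable_continuous[OF e(1)]])
  have "\<mu> * (\<integral>z. e z \<partial>per_measure) \<noteq> 0"
  proof
    assume "\<mu> * (\<integral>z. e z \<partial>per_measure) = 0"
    then have s: "solves \<mu> (abs_l2 e) 0 e 1"
      using e rep by (simp add: solves_def T_rep_zero integral_rep_zero)
    have "abs_l2 e \<noteq> 0"
    proof
      assume "abs_l2 e = 0"
      then have "AE x in per_measure. rep_l2 0 x = e x" using rep by simp
      with rep_l2_zero have "AE x in per_measure. e x = 0"
        by eventually_elim simp
      then have "e 0 = 0"
        by (intro AE_eq_imp_eq_Icc[of "-pi" pi e "\<lambda>_. 0"] e(1) continuous_on_const) auto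
      then show False using e(2)[of 0] by simp
    qed
    then show False using eigenvalue_if_solves_zero[OF s] assms by blast
  qed
  then show ?thesis using that e by blast
qed

lemma solves_exists:
  assumes "\<not> eigenvalue_Lper \<epsilon> f \<mu>"
  obtains u v c where "solves \<mu> u g v c"
proof -
  obtain e where e: "continuous_on {-pi..pi} e" "\<And>x. x \<in> {-pi..pi} \<Longrightarrow> e x = 1 + \<mu> * T e x"
    "\<mu> * (\<integral>z. e z \<partial>per_measure) \<noteq> 0"
    using ex_unit_solution[OF assms] by blast
  obtain r where r: "continuous_on {-pi..pi} r" "\<And>x. x \<in> {-pi..pi} \<Longrightarrow> r x = T (rep_l2 g) x + \<mu> * T r x"
    using volterra_exists[OF T_continuous[OF square_integrable_rep_l2[of g]], of \<mu>] by blast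
  \<comment> \<open>the only choice compatible with the integral condition\<close>
  define c where "c = - ((\<integral>z. rep_l2 g z \<partial>per_measure) + \<mu> * (\<integral>z. r z \<partial>per_measure)) / (\<mu> * (\<integral>z. e z \<partial>per_measure))"
  define v where "v = (\<lambda>x. c * e x + r x)"
  have v: "continuous_on {-pi..pi} v" unfolding v_def using e(1) r(1) by (intro continuous_intros)
  have sq: "square_integrable (\<lambda>x. c * e x)" "square_integrable r" "square_integrable e"
    using e(1) r(1) by (auto intro: square_integrable_mult square_integrable_continuous)
  have "solves \<mu> (abs_l2 v) g v c"
    unfolding solves_def
  proof (intro conjI ballI v rep_abs_l2 square_integrable_continuous)
    fix x :: real assume x: "x \<in> {-pi..pi}"
    have "v x = c * (1 + \<mu> * T e x) + (T (rep_l2 g) x + \<mu> * T r x)"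
      using e(2)[OF x] r(2)[OF x] by (simp add: v_def)
    then show "v x = c + T (rep_l2 g) x + \<mu> * T v x"
      unfolding v_def T_add[OF x sq(1,2)] by (simp add: T_cmult algebra_simps)
  next
    have "(\<integral>z. v z \<partial>per_measure) = c * (\<integral>z. e z \<partial>per_measure) + (\<integral>z. r z \<partial>per_measure)"
      unfolding v_def using sq square_integrable_integrable by simp
    moreover have "c * (\<mu> * (\<integral>z. e z \<partial>per_measure)) = - ((\<integral>z. rep_l2 g z \<partial>per_measure) + \<mu> * (\<integral>z. r z \<partial>per_measure))"
      using e(3) by (simp add: c_def)
    ultimately show "(\<integral>z. rep_l2 g z \<partial>per_measure) + \<mu> * (\<integral>z. v z \<partial>per_measure) = 0"
      by (simp add: algebra_simps)
  qed
  then show ?thesis by (rule that)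
qed

lemma bij_Lper_shift:
  assumes "\<not> eigenvalue_Lper \<epsilon> f \<mu>"
  shows "bij_betw (Lper_shift \<epsilon> f \<mu>) (Lper_dom \<epsilon> f) UNIV"
proof (rule bij_betw_imageI)
  show "inj_on (Lper_shift \<epsilon> f \<mu>) (Lper_dom \<epsilon> f)"
  proof (rule inj_onI)
    fix u u' assume u: "u \<in> Lper_dom \<epsilon> f" "u' \<in> Lper_dom \<epsilon> f" "Lper_shift \<epsilon> f \<mu> u = Lper_shift \<epsilon> f \<mu> u'"
    obtain v c where "solves \<mu> u (Lper_shift \<epsilon> f \<mu> u') v c"
      using Lper_shift_eq_iff_solves u(1,3) by blast
    moreover obtain v' c' where "solves \<mu> u' (Lper_shift \<epsilon> f \<mu> u') v' c'"
      using Lper_shift_eq_iff_solves u(2) by blast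
    ultimately show "u = u'" using solves_unique[OF assms] by blast
  qed
  have "g \<in> Lper_shift \<epsilon> f \<mu> ` Lper_dom \<epsilon> f" for g
  proof -
    obtain u v c where "solves \<mu> u g v c" using solves_exists[OF assms] .
    then have "u \<in> Lper_dom \<epsilon> f \<and> Lper_shift \<epsilon> f \<mu> u = g"
      using Lper_shift_eq_iff_solves by blast
    then show ?thesis by blast
  qed
  then show "Lper_shift \<epsilon> f \<mu> ` Lper_dom \<epsilon> f = UNIV" by blast
qed

lemma resolvent_eqI:
  assumes "\<not> eigenvalue_Lper \<epsilon> f \<mu>" "solves \<mu> u g v c"
  shows "Lper_resolvent \<epsilon> f \<mu> g = u"
proof -
  have "u \<in> Lper_dom \<epsilon> f" "Lper_shift \<epsilon> f \<mu> u = g"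
    using Lper_shift_eq_iff_solves assms(2) by blast+
  then show ?thesis
    unfolding Lper_resolvent_def using bij_Lper_shift[OF assms(1)] by (auto simp: bij_betw_def intro: inv_into_f_eq)
qed

text \<open>The function \<open>d = v - c e\<close> solves the Volterra equation with inhomogeneity
  \<open>T g\<close>, which bounds \<open>d\<close>. The integral condition then bounds
  \<open>c\<close>, as \<open>\<mu> \<integral> e\<close> is a nonzero number that does not depend
  on \<open>g\<close>.\<close>

lemma solves_bounded:
  assumes "\<not> eigenvalue_Lper \<epsilon> f \<mu>" and K: "0 \<le> K"
  obtains V where "0 \<le> V"
    "\<And>u g v c x. solves \<mu> u g v c \<Longrightarrow> norm g \<le> K \<Longrightarrow> x \<in> {-pi..pi} \<Longrightarrow> cmod (v x) \<le> V"
proof -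
  obtain e where e: "continuous_on {-pi..pi} e" "\<And>x. x \<in> {-pi..pi} \<Longrightarrow> e x = 1 + \<mu> * T e x"
    "\<mu> * (\<integral>z. e z \<partial>per_measure) \<noteq> 0"
    using ex_unit_solution[OF assms(1)] by blast
  obtain E where E: "\<forall>x\<in>{-pi..pi}. cmod (e x) \<le> E"
    using compact_imp_bounded[OF compact_continuous_image[OF e(1) compact_Icc]] by (auto simp: bounded_iff)
  have E0: "0 \<le> E" using E by (meson atLeastAtMost_iff norm_ge_zero order_trans pi_ge_zero neg_le_0_iff_le order_refl)
  define s where "s = sqrt (2 * pi)"
  have s: "0 \<le> s" by (simp add: s_def)
  \<comment> \<open>\<open>D\<close> is an upper bound for \<open>\<bar>d\<bar>\<close>, and \<open>C\<close> one for \<open>\<bar>c\<bar>\<close>.\<close>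
  define D where "D = 2 * (s * K) * exp ((2 * cmod \<mu> + 1) * pi)"
  have D: "0 \<le> D" using K s by (simp add: D_def)
  define \<kappa> where "\<kappa> = cmod (\<mu> * (\<integral>z. e z \<partial>per_measure))"
  have \<kappa>: "0 < \<kappa>" using e(3) by (simp add: \<kappa>_def)
  define C where "C = (s * K + cmod \<mu> * (s * (s * D))) / \<kappa>"
  have C: "0 \<le> C" using K s D \<kappa> by (simp add: C_def)
  show ?thesis
  proof (rule that[of "D + C * E"])
    show "0 \<le> D + C * E" using D C E0 by simp
    fix u g v c x assume sol: "solves \<mu> u g v c" and g: "norm g \<le> K" and x: "x \<in> {-pi..pi}"
    note v = solvesD[OF sol]
    have gK: "l2_norm (rep_l2 g) \<le> K" using g by (simp add: norm_rep_l2)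
    define d where "d = (\<lambda>x. v x - c * e x)"
    have dc: "continuous_on {-pi..pi} d" unfolding d_def using v(1) e(1) by (intro continuous_intros)
    have sq: "square_integrable v" "square_integrable (\<lambda>x. c * e x)" "square_integrable e" "square_integrable d"
      using v(1) e(1) dc by (auto intro: square_integrable_mult square_integrable_continuous)
    have "d y = T (rep_l2 g) y + \<mu> * T d y" if "y \<in> {-pi..pi}" for y
    proof -
      have "T d y = T v y - c * T e y"
        unfolding d_def T_diff[OF that sq(1,2)] by (simp add: T_cmult)
      moreover have "d y = (c + T (rep_l2 g) y + \<mu> * T v y) - c * (1 + \<mu> * T e y)"
        using v(3)[OF that] e(2)[OF that] by (simp add: d_def)
      ultimately show ?thesis by (simp only:) (simp add: algebra_simps)
    qed
    moreover have "cmod (T (rep_l2 g) y) \<le> s * K" if "y \<in> {-pi..pi}" for y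
      by (rule order_trans[OF T_bound[OF that square_integrable_rep_l2, folded s_def] mult_left_mono[OF gK s]])
    ultimately have d_le: "cmod (d y) \<le> D" if "y \<in> {-pi..pi}" for y
      unfolding D_def using volterra_bound[OF dc _ _ that] by blast
    have "(\<integral>z. d z \<partial>per_measure) = (\<integral>z. v z \<partial>per_measure) - c * (\<integral>z. e z \<partial>per_measure)"
      unfolding d_def using sq square_integrable_integrable by simp
    then have "(\<integral>z. v z \<partial>per_measure) = (\<integral>z. d z \<partial>per_measure) + c * (\<integral>z. e z \<partial>per_measure)"
      by simp
    then have "c * (\<mu> * (\<integral>z. e z \<partial>per_measure)) = - ((\<integral>z. rep_l2 g z \<partial>per_measure) + \<mu> * (\<integral>z. d z \<partial>per_measure))"
      using v(4) by (simp add: algebra_simps eq_neg_iff_add_eq_0)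
    then have "cmod c * \<kappa> = cmod ((\<integral>z. rep_l2 g z \<partial>per_measure) + \<mu> * (\<integral>z. d z \<partial>per_measure))"
      unfolding \<kappa>_def by (metis norm_minus_cancel norm_mult)
    also have "\<dots> \<le> cmod (\<integral>z. rep_l2 g z \<partial>per_measure) + cmod \<mu> * cmod (\<integral>z. d z \<partial>per_measure)"
      by (metis norm_mult norm_triangle_ineq)
    also have "\<dots> \<le> s * K + cmod \<mu> * (s * (s * D))"
    proof (intro add_mono mult_left_mono)
      show "cmod (\<integral>z. rep_l2 g z \<partial>per_measure) \<le> s * K"
        by (rule order_trans[OF integral_per_measure_bound[OF square_integrable_rep_l2, folded s_def] mult_left_mono[OF gK s]])
      show "cmod (\<integral>z. d z \<partial>per_measure) \<le> s * (s * D)"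
        by (rule order_trans[OF integral_per_measure_bound[OF sq(4), folded s_def]
              mult_left_mono[OF l2_norm_continuous_le[OF dc d_le, folded s_def] s]])
    qed simp
    finally have "cmod c \<le> C"
      using \<kappa> by (simp add: C_def pos_le_divide_eq)
    then have "cmod (c * e x) \<le> C * E"
      using E x C by (simp add: norm_mult mult_mono)
    then show "cmod (v x) \<le> D + C * E"
      using d_le[OF x] norm_triangle_ineq[of "d x" "c * e x"] by (simp add: d_def)
  qed
qed

lemma compact_resolvent:
  assumes ne: "\<not> eigenvalue_Lper \<epsilon> f \<mu>" and B: "bounded B"
  shows "compact (closure (Lper_resolvent \<epsilon> f \<mu> ` B))"
proof (rule compact_closure_if_convergent_subseq)
  fix y assume y: "\<And>n::nat. y n \<in> Lper_resolvent \<epsilon> f \<mu> ` B"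
  obtain K where K: "0 < K" "\<And>g. g \<in> B \<Longrightarrow> norm g \<le> K"
    using B by (auto simp: bounded_pos)
  have "\<exists>g v c. g \<in> B \<and> solves \<mu> (y n) g v c" for n
  proof -
    obtain g where g: "g \<in> B" "y n = Lper_resolvent \<epsilon> f \<mu> g" using y[of n] by blast
    obtain u v c where s: "solves \<mu> u g v c" using solves_exists[OF ne] .
    then have "y n = u" using resolvent_eqI[OF ne] g(2) by blast
    then show ?thesis using s g(1) by blast
  qed
  then obtain g v c where gB: "\<And>n. g n \<in> B" and sol: "\<And>n. solves \<mu> (y n) (g n) (v n) (c n)"
    by metis
  have gK: "norm (g n) \<le> K" for n using K(2) gB by blast
  note v = solvesD[OF sol]
  obtain V where V: "0 \<le> V" "\<And>n x. x \<in> {-pi..pi} \<Longrightarrow> cmod (v n x) \<le> V"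
    using solves_bounded[OF ne, of K] sol gK K(1) by (metis less_imp_le)
  define K' where "K' = K + cmod \<mu> * (sqrt (2 * pi) * V)"
  have K': "0 \<le> K'" using K V by (simp add: K'_def)
  define h where "h = (\<lambda>n z. rep_l2 (g n) z + \<mu> * v n z)"
  have h: "square_integrable (h n)" for n
    unfolding h_def by (rule rhs_square_integrable[OF v(1)])
  have hK: "l2_norm (h n) \<le> K'" for n
  proof -
    have "l2_norm (h n) \<le> l2_norm (rep_l2 (g n)) + l2_norm (\<lambda>z. \<mu> * v n z)"
      unfolding h_def by (intro l2_norm_add_le square_integrable_mult square_integrable_continuous[OF v(1)]) simp
    also have "\<dots> \<le> K + cmod \<mu> * (sqrt (2 * pi) * V)"
      using gK[of n] l2_norm_continuous_le[OF v(1) V(2)] by (intro add_mono) (auto simp: norm_rep_l2 l2_norm_scale intro: mult_left_mono)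
    finally show ?thesis by (simp add: K'_def)
  qed
  have v_eq: "v n x = c n + T (h n) x" if "x \<in> {-pi..pi}" for n x
    using v(3)[OF that, of n] T_split[OF that v(1)] by (simp add: h_def add.assoc)
  obtain w r where w: "continuous_on {-pi..pi} w" and r: "strict_mono (r :: nat \<Rightarrow> nat)"
    and unif: "\<And>e. 0 < e \<Longrightarrow> \<exists>N. \<forall>n x. n \<ge> N \<and> x \<in> {-pi..pi} \<longrightarrow> norm (v (r n) x - w x) < e"
  proof (rule Arzela_Ascoli[of "{-pi..pi}" v V])
    fix x e :: real assume x: "x \<in> {-pi..pi}" and e: "0 < e"
    obtain d where d: "0 < d" "\<And>h y. square_integrable h \<Longrightarrow> l2_norm h \<le> K' \<Longrightarrow> y \<in> {-pi..pi} \<Longrightarrow>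
       \<bar>y - x\<bar> < d \<Longrightarrow> cmod (T h y - T h x) < e"
      using T_equicontinuous[OF x e K'] by blast
    show "\<exists>d>0. \<forall>n y. y \<in> {-pi..pi} \<and> norm (x - y) < d \<longrightarrow> norm (v n x - v n y) < e"
    proof (intro exI conjI allI impI)
      fix n y assume y: "y \<in> {-pi..pi} \<and> norm (x - y) < d"
      then have "cmod (T (h n) y - T (h n) x) < e"
        using d(2)[OF h hK] by (simp add: abs_minus_commute)
      then show "norm (v n x - v n y) < e"
        using v_eq[OF x] v_eq[of y n] y by (simp add: norm_minus_commute)
    qed (rule d(1))
  qed (use V in auto)
  have y_le: "dist (y n) (abs_l2 w) = l2_norm (\<lambda>x. v n x - w x)" for n
  proof -
    have "dist (y n) (abs_l2 w) = l2_norm (rep_l2 (y n - abs_l2 w))"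
      by (simp add: dist_norm norm_rep_l2)
    also have "\<dots> = l2_norm (\<lambda>x. v n x - w x)"
    proof (rule l2_norm_cong_AE)
      show "square_integrable (\<lambda>x. v n x - w x)"
        using v(1) w by (intro square_integrable_continuous continuous_intros)
      show "AE x in per_measure. rep_l2 (y n - abs_l2 w) x = v n x - w x"
        using rep_l2_diff[of "y n" "abs_l2 w"] rep_abs_l2[OF square_integrable_continuous[OF w]] v(2)[of n]
        by eventually_elim simp
    qed simp
    finally show ?thesis .
  qed
  have "(y \<circ> r) \<longlonglongrightarrow> abs_l2 w"
    unfolding lim_sequentially
  proof (intro allI impI)
    fix e :: real assume e: "0 < e"
    define e' where "e' = e / (2 * sqrt (2 * pi))"
    have e': "0 < e'" using e by (simp add: e'_def)
    then obtain N where N: "\<forall>n x. n \<ge> N \<and> x \<in> {-pi..pi} \<longrightarrow> norm (v (r n) x - w x) < e'"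
      using unif by blast
    have "dist ((y \<circ> r) n) (abs_l2 w) < e" if "n \<ge> N" for n
    proof -
      have "l2_norm (\<lambda>x. v (r n) x - w x) \<le> sqrt (2 * pi) * e'"
        using v(1) w N that by (intro l2_norm_continuous_le continuous_intros) (auto intro: less_imp_le)
      also have "\<dots> < e" using e by (simp add: e'_def)
      finally show ?thesis by (simp add: y_le)
    qed
    then show "\<exists>N. \<forall>n\<ge>N. dist ((y \<circ> r) n) (abs_l2 w) < e" by blast
  qed
  then show "\<exists>l r. strict_mono (r :: nat \<Rightarrow> nat) \<and> (y \<circ> r) \<longlonglongrightarrow> l"
    using r by blast
qed

lemma compact_operator_resolvent:
  assumes ne: "\<not> eigenvalue_Lper \<epsilon> f \<mu>"
  shows "compact_operator (Lper_resolvent \<epsilon> f \<mu>)"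
  unfolding compact_operator_def
proof (intro conjI allI impI)
  fix g g' :: l2 and k :: complex
  obtain u v c where s: "solves \<mu> u g v c" using solves_exists[OF ne] .
  obtain u' v' c' where s': "solves \<mu> u' g' v' c'" using solves_exists[OF ne] .
  show "Lper_resolvent \<epsilon> f \<mu> (g + g') = Lper_resolvent \<epsilon> f \<mu> g + Lper_resolvent \<epsilon> f \<mu> g'"
    using resolvent_eqI[OF ne s] resolvent_eqI[OF ne s'] resolvent_eqI[OF ne solves_add[OF s s']] by simp
  show "Lper_resolvent \<epsilon> f \<mu> (l2_scale k g) = l2_scale k (Lper_resolvent \<epsilon> f \<mu> g)"
    using resolvent_eqI[OF ne s] resolvent_eqI[OF ne solves_scale[OF s]] by simp
qed (rule compact_resolvent[OF ne])

end

section \<open>Construction of the weight\<close>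

text \<open>The weight is \<open>exp (F \<bar>x\<bar>)\<close> with an antiderivative
  \<open>F\<close> of \<open>1 / (\<epsilon> f)\<close> between 0 and \<open>pi\<close>. Comparison
  of \<open>F\<close> with \<open>a ln\<close> near 0 and near \<open>pi\<close>, where
  \<open>f\<close> is symmetric about \<open>pi / 2\<close>, gives the limits of
  \<open>p\<close>.\<close>

lemma weight_exists:
  fixes f :: "real \<Rightarrow> real"
  assumes eps: "0 < \<epsilon>"
    and shift: "\<And>x. f (x + pi) = - f x" and odd: "\<And>x. f (- x) = - f x"
    and pos: "\<And>x. x \<in> {0<..<pi} \<Longrightarrow> f x > 0"
    and cont: "continuous_on UNIV f"
    and D: "(f has_real_derivative m) (at 0)" and m: "0 < m"
  obtains p where "weight \<epsilon> f p"
proof -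
  have f0: "f 0 = 0" using odd[of 0] by simp
  have f_sym: "f (pi - x) = f x" for x
    using shift[of "- x"] odd[of x] by simp
  obtain r where r: "0 < r" "r < pi" and near: "\<And>x. 0 < x \<Longrightarrow> x \<le> r \<Longrightarrow> m / 2 * x \<le> f x \<and> f x \<le> 2 * m * x"
  proof -
    have "((\<lambda>x. f x / x) \<longlongrightarrow> m) (at 0)"
      using D by (simp add: has_field_derivative_iff f0)
    then have "\<forall>\<^sub>F x in at 0. m / 2 < f x / x" "\<forall>\<^sub>F x in at 0. f x / x < 2 * m"
      using m by (auto dest: order_tendstoD(1)[of _ _ _ "m / 2"] order_tendstoD(2)[of _ _ _ "2 * m"])
    then have "\<forall>\<^sub>F x in at 0. m / 2 < f x / x \<and> f x / x < 2 * m" by eventually_elim simp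
    then obtain d where d: "0 < d" "\<And>x. x \<noteq> 0 \<Longrightarrow> \<bar>x\<bar> < d \<Longrightarrow> m / 2 < f x / x \<and> f x / x < 2 * m"
      unfolding eventually_at by (auto simp: dist_real_def)
    show ?thesis
    proof (rule that[of "min (d / 2) 1"])
      fix x :: real assume x: "0 < x" "x \<le> min (d / 2) 1"
      then have "m / 2 < f x / x \<and> f x / x < 2 * m" using d by auto
      then show "m / 2 * x \<le> f x \<and> f x \<le> 2 * m * x"
        using x by (simp add: pos_less_divide_eq pos_divide_less_eq)
    qed (use d pi_gt3 in auto)
  qed
  have f_cont: "isCont f x" for x using cont by (simp add: continuous_on_eq_continuous_at)
  have "\<exists>F. \<forall>x. ereal 0 < ereal x \<longrightarrow> ereal x < ereal pi \<longrightarrow> (F has_vector_derivative 1 / (\<epsilon> * f x)) (at x)"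
  proof (rule einterval_antiderivative)
    fix x :: real assume "ereal 0 < ereal x" "ereal x < ereal pi"
    then have "f x \<noteq> 0" using pos[of x] by auto
    then show "isCont (\<lambda>x. 1 / (\<epsilon> * f x)) x" using eps f_cont by (intro continuous_intros) auto
  qed simp
  then obtain F where F: "\<And>x. 0 < x \<Longrightarrow> x < pi \<Longrightarrow> (F has_real_derivative 1 / (\<epsilon> * f x)) (at x)"
    by (auto simp: has_real_derivative_iff_has_vector_derivative)
  have F_mono: "F z \<le> F x" if "0 < z" "z \<le> x" "x < pi" for z x
  proof (rule DERIV_nonneg_imp_nondecreasing[OF that(2)])
    fix y assume "z \<le> y" "y \<le> x"
    then show "\<exists>D. (F has_real_derivative D) (at y) \<and> 0 \<le> D"
      using F[of y] pos[of y] eps that by (intro exI[of _ "1 / (\<epsilon> * f y)"]) auto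
  qed
  \<comment> \<open>As \<open>f x \<le> 2 m x\<close> near 0, the derivative of \<open>F\<close> is at least \<open>a / x\<close> there.\<close>
  define a where "a = 1 / (\<epsilon> * (2 * m))"
  have a: "0 < a" using eps m by (simp add: a_def)
  have a_le: "a / x \<le> 1 / (\<epsilon> * f x)" if "0 < x" "x \<le> r" for x
  proof -
    have "0 < f x" using pos[of x] that r by auto
    moreover have "f x \<le> 2 * m * x" using near that by blast
    ultimately have "1 / (\<epsilon> * (2 * m * x)) \<le> 1 / (\<epsilon> * f x)"
      using eps by (intro divide_left_mono mult_left_mono mult_pos_pos) (use that m in auto)
    then show ?thesis by (simp add: a_def mult.assoc)
  qed
  \<comment> \<open>near 0, \<open>exp F\<close> is bounded by a multiple of \<open>x powr a\<close>\<close>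
  have at_0: "exp (F x) \<le> exp (F r - a * ln r) * x powr a" if "0 < x" "x \<le> r" for x
  proof -
    have "F x - a * ln x \<le> F r - a * ln r"
    proof (rule DERIV_nonneg_imp_nondecreasing[OF that(2)])
      fix y assume y: "x \<le> y" "y \<le> r"
      then have "((\<lambda>x. F x - a * ln x) has_real_derivative (1 / (\<epsilon> * f y) - a / y)) (at y)"
        using that r by (auto intro!: derivative_eq_intros F)
      then show "\<exists>D. ((\<lambda>x. F x - a * ln x) has_real_derivative D) (at y) \<and> 0 \<le> D"
        using a_le[of y] y that by (intro exI[of _ "1 / (\<epsilon> * f y) - a / y"]) auto
    qed
    then have "exp (F x) \<le> exp (F r - a * ln r + a * ln x)" by simp
    then show ?thesis using that by (simp add: exp_add powr_def)
  qed
  \<comment> \<open>near \<open>pi\<close>, \<open>exp (- F)\<close> is bounded by a multiple of \<open>(pi - x) powr a\<close>\<close>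
  have at_pi: "exp (- F (pi - y)) \<le> exp (- F (pi - r) - a * ln r) * y powr a" if "0 < y" "y \<le> r" for y
  proof -
    have "F (pi - r) + a * ln r \<le> F (pi - y) + a * ln y"
    proof (rule DERIV_nonpos_imp_nonincreasing[OF that(2)])
      fix z assume z: "y \<le> z" "z \<le> r"
      then have "((\<lambda>y. F (pi - y)) has_real_derivative (1 / (\<epsilon> * f (pi - z)) * (- 1))) (at z)"
        using that r by (intro DERIV_chain2[of F]) (auto intro!: F derivative_eq_intros)
      then have "((\<lambda>y. F (pi - y) + a * ln y) has_real_derivative (- 1 / (\<epsilon> * f z) + a / z)) (at z)"
        using that z by (auto intro!: derivative_eq_intros simp: f_sym)
      then show "\<exists>D. ((\<lambda>y. F (pi - y) + a * ln y) has_real_derivative D) (at z) \<and> D \<le> 0"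
        using a_le[of z] z that by (intro exI[of _ "- 1 / (\<epsilon> * f z) + a / z"]) auto
    qed
    then have "exp (- F (pi - y)) \<le> exp (- F (pi - r) - a * ln r + a * ln y)" by simp
    then show ?thesis using that by (simp add: exp_add powr_def)
  qed
  define p where "p = (\<lambda>x. if 0 < \<bar>x\<bar> \<and> \<bar>x\<bar> < pi then exp (F \<bar>x\<bar>) else 0)"
  have powr_0: "((\<lambda>x. K * (g x) powr a) \<longlongrightarrow> 0) G"
    if "(g \<longlongrightarrow> 0) G" "\<forall>\<^sub>F x in G. 0 \<le> g x" for K :: real and g :: "real \<Rightarrow> real" and G
  proof -
    have "((\<lambda>x. K * (g x) powr a) \<longlongrightarrow> K * 0 powr a) G"
      using a that by (intro tendsto_intros tendsto_powr') auto
    then show ?thesis by simp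
  qed
  have "weight \<epsilon> f p"
  proof
    show "0 < \<epsilon>" by fact
    show "continuous_on UNIV f" by fact
    show "f 0 = 0" by fact
    show "0 < x \<Longrightarrow> x < pi \<Longrightarrow> 0 < f x" for x using pos by auto
    show "-pi < x \<Longrightarrow> x < 0 \<Longrightarrow> f x < 0" for x using pos[of "-x"] odd[of x] by auto
    show "p 0 = 0" "p pi = 0" "p (- pi) = 0" by (auto simp: p_def)
    show "x \<noteq> 0 \<Longrightarrow> -pi < x \<Longrightarrow> x < pi \<Longrightarrow> 0 < p x" for x by (auto simp: p_def)
    show "0 < z \<Longrightarrow> z \<le> x \<Longrightarrow> x < pi \<Longrightarrow> p z \<le> p x" for z x by (auto simp: p_def F_mono)
    show "-pi < x \<Longrightarrow> x \<le> z \<Longrightarrow> z < 0 \<Longrightarrow> p z \<le> p x" for x z by (auto simp: p_def F_mono)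
    show "\<exists>m>0. \<exists>r>0. \<forall>x. \<bar>x\<bar> \<le> r \<longrightarrow> m * \<bar>x\<bar> \<le> \<bar>f x\<bar>"
    proof (intro exI conjI allI impI)
      fix x :: real assume x: "\<bar>x\<bar> \<le> r"
      have "\<bar>f x\<bar> = \<bar>f \<bar>x\<bar>\<bar>" using odd[of x] by (simp add: abs_if)
      moreover have "m / 2 * \<bar>x\<bar> \<le> \<bar>f \<bar>x\<bar>\<bar>" if "x \<noteq> 0" using near[of "\<bar>x\<bar>"] x that by auto
      ultimately show "m / 2 * \<bar>x\<bar> \<le> \<bar>f x\<bar>" by (cases "x = 0") auto
    qed (use m r in auto)
    show "(p has_real_derivative p x / (\<epsilon> * f x)) (at x)" if "x \<noteq> 0" "-pi < x" "x < pi" for x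
    proof (cases "0 < x")
      case True
      have "((\<lambda>x. exp (F x)) has_real_derivative p x / (\<epsilon> * f x)) (at x)"
        using True that by (auto intro!: derivative_eq_intros F simp: p_def)
      then show ?thesis
        by (rule has_field_derivative_transform_within_open[of _ _ _ "{0<..<pi}"]) (use True that in \<open>auto simp: p_def\<close>)
    next
      case False
      have "((\<lambda>x. F (- x)) has_real_derivative (1 / (\<epsilon> * f (- x)) * (- 1))) (at x)"
        using that False by (intro DERIV_chain2[of F]) (auto intro!: F derivative_eq_intros)
      then have "((\<lambda>x. exp (F (- x))) has_real_derivative p x / (\<epsilon> * f x)) (at x)"
        using False that by (auto intro!: derivative_eq_intros simp: p_def odd)
      then show ?thesis
        by (rule has_field_derivative_transform_within_open[of _ _ _ "{-pi<..<0}"]) (use False that in \<open>auto simp: p_def\<close>)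
    qed
    have "(p \<longlongrightarrow> 0) (at 0)"
    proof (rule Lim_null_comparison)
      show "\<forall>\<^sub>F x in at 0. norm (p x) \<le> exp (F r - a * ln r) * \<bar>x\<bar> powr a"
      proof (rule eventually_mono)
        show "\<forall>\<^sub>F x in at 0. x \<in> {-r<..<r}"
          using eventually_at_in_open'[of "{-r<..<r}" 0] r by simp
        fix x assume "x \<in> {-r<..<r}"
        then show "norm (p x) \<le> exp (F r - a * ln r) * \<bar>x\<bar> powr a"
          using at_0[of "\<bar>x\<bar>"] by (auto simp: p_def)
      qed
      show "((\<lambda>x. exp (F r - a * ln r) * \<bar>x\<bar> powr a) \<longlongrightarrow> 0) (at 0)"
        by (rule powr_0) (auto intro: tendsto_rabs_zero)
    qed
    then show "isCont p 0" by (simp add: isCont_def p_def)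
    show "((\<lambda>x. inverse (p x)) \<longlongrightarrow> 0) (at_left pi)"
    proof (rule Lim_null_comparison)
      show "\<forall>\<^sub>F x in at_left pi. norm (inverse (p x)) \<le> exp (- F (pi - r) - a * ln r) * (pi - x) powr a"
      proof (rule eventually_mono)
        show "\<forall>\<^sub>F x in at_left pi. x \<in> {pi - r<..<pi}"
          using eventually_at_left_real[of "pi - r" pi] r by simp
        fix x assume "x \<in> {pi - r<..<pi}"
        then show "norm (inverse (p x)) \<le> exp (- F (pi - r) - a * ln r) * (pi - x) powr a"
          using at_pi[of "pi - x"] r by (auto simp: p_def exp_minus)
      qed
      show "((\<lambda>x. exp (- F (pi - r) - a * ln r) * (pi - x) powr a) \<longlongrightarrow> 0) (at_left pi)"
      proof (rule powr_0)
        have "((\<lambda>x. pi - x) \<longlongrightarrow> pi - pi) (at_left pi)" by (intro tendsto_intros)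
        then show "((\<lambda>x. pi - x) \<longlongrightarrow> 0) (at_left pi)" by simp
        show "\<forall>\<^sub>F x in at_left pi. 0 \<le> pi - x" by (auto simp: eventually_at_filter)
      qed
    qed
    show "((\<lambda>x. inverse (p x)) \<longlongrightarrow> 0) (at_right (-pi))"
    proof (rule Lim_null_comparison)
      show "\<forall>\<^sub>F x in at_right (-pi). norm (inverse (p x)) \<le> exp (- F (pi - r) - a * ln r) * (pi + x) powr a"
      proof (rule eventually_mono)
        show "\<forall>\<^sub>F x in at_right (-pi). x \<in> {-pi<..<r - pi}"
          using eventually_at_right_real[of "-pi" "r - pi"] r by simp
        fix x assume "x \<in> {-pi<..<r - pi}"
        then show "norm (inverse (p x)) \<le> exp (- F (pi - r) - a * ln r) * (pi + x) powr a"
          using at_pi[of "pi + x"] r by (auto simp: p_def exp_minus)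
      qed
      show "((\<lambda>x. exp (- F (pi - r) - a * ln r) * (pi + x) powr a) \<longlongrightarrow> 0) (at_right (-pi))"
      proof (rule powr_0)
        have "((\<lambda>x. pi + x) \<longlongrightarrow> pi + - pi) (at_right (-pi))" by (intro tendsto_intros)
        then show "((\<lambda>x. pi + x) \<longlongrightarrow> 0) (at_right (-pi))" by simp
        show "\<forall>\<^sub>F x in at_right (-pi). 0 \<le> pi + x" by (auto simp: eventually_at_filter)
      qed
    qed
  qed
  then show ?thesis by (rule that)
qed

theorem theorem3:
  fixes \<epsilon> :: real and f :: "real \<Rightarrow> real" and \<mu> :: complex
  assumes "0 < \<epsilon>" and "\<epsilon> < pi"
    and "\<And>x. f (x + 2 * pi) = f x"
    and "\<And>x. f (x + pi) = - f x"
    and "\<And>x. f (- x) = - f x"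
    and "\<And>x. x \<in> {0<..<pi} \<Longrightarrow> f x > 0"
    and "continuous_on UNIV f"
    and "finite {x \<in> {-pi..pi}. \<not> f differentiable (at x)}"
    and "\<And>k::int. f differentiable (at (of_int k * pi))"
    and "(f has_real_derivative 2 / pi) (at 0)"
    and "\<not> eigenvalue_Lper \<epsilon> f \<mu>"
  shows "bij_betw (Lper_shift \<epsilon> f \<mu>) (Lper_dom \<epsilon> f) UNIV \<and>
         compact_operator (Lper_resolvent \<epsilon> f \<mu>)"
proof -
  obtain p where "weight \<epsilon> f p"
    using weight_exists[of \<epsilon> f "2 / pi"] assms(1,4,5,6,7,10) by auto
  then show ?thesis
    using weight.bij_Lper_shift weight.compact_operator_resolvent assms(11) by blast
qed

end
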